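(* Let $\bar M$, $\mathcal{M}$, $\mathcal{M}_0$ and $(R_n)_{n\ge 1}$ be as in the context, and assume that $\mathcal{M}$ is definably complete. Suppose that $n\ge 1$ and that $f\in R_n$ is such that $V_n(f)$ is nonempty. Then there exist $m\ge 0$ and $f_1,\ldots,f_{n+m}\in R_{n+m}$ such that $$V_{n+m}^{reg}(f_1,\ldots,f_{n+m})\cap V_{n+m}(f)\neq\emptyset,$$ where $f$ is regarded as an element of $R_{n+m}$, so that $V_{n+m}(f)=V_n(f)\times M^m$.
   Context: Let $\bar M=\langle M,<,+,\cdot,0,1\rangle$ be a real closed field and let $\mathcal{M}$ be an arbitrary expansion of $\bar M$. Let $\mathcal{M}_0$ be a reduct of $\mathcal{M}$ which is also an expansion of $\bar M$ and which is o-minimal and polynomially bounded (for every function $h:M\to M$ definable in $\mathcal{M}_0$ there is $k\in\mathbb{N}$ with $|h(x)|\le x^k$ for all sufficiently large $x\in M$). "Definable" means definable in $\mathcal{M}$ with parameters, unless another structure is mentioned. Topological notions on $M^n$ refer to the order topology. An open box in $M^n$ is a product of open intervals. $\mathcal{M}$ is definably complete if every nonempty definable subset of $M$ with an upper bound has a least upper bound in $M$. A definable function $f:U\to M$ with $U\subseteq M^n$ open is locally tame if $f$ is smooth (infinitely differentiable on $U$ in the usual $\varepsilon$-$\delta$ sense formulated in $\mathcal{M}$) and, for every open box $B\subseteq M^n$ having sides of length $\le 1$ and with closure $\overline{B}\subseteq U$, the restriction $f|_B$ is definable in $\mathcal{M}_0$. For each $n\ge1$, $R_n$ is a given $\mathbb{Q}$-algebra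 of locally tame functions $f:M^n\to M$, closed under partial differentiation. It is assumed that $R_n\subseteq R_{n+1}$ (regarding $f\in R_n$ as a function of $n+1$ variables not depending on the last one) and $\mathbb{Q}[X_1,\ldots,X_n]\subseteq R_n$. For $f\in R_n$ and $\bar a\in M^n$, $\nabla f(\bar a)=\langle\frac{\partial f}{\partial x_1}(\bar a),\ldots,\frac{\partial f}{\partial x_n}(\bar a)\rangle\in M^n$. For $p\ge1$ and $f_1,\ldots,f_p\in R_n$, $$V_n(f_1,\ldots,f_p)=\{\bar x\in M^n: f_1(\bar x)=\cdots=f_p(\bar x)=0\},$$ $$V_n^{reg}(f_1,\ldots,f_p)=\{\bar x\in V_n(f_1,\ldots,f_p):\nabla f_1(\bar x),\ldots,\nabla f_p(\bar x)\text{ are linearly independent}\},$$ linear independence being in the $\bar M$-vector space $M^n$. *)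

theory Defs
  imports "HOL-Analysis.Analysis"
begin

class real_closed_field = linordered_field +
  assumes nonneg_square: "0 \<le> x \<Longrightarrow> \<exists>y. x = y * y"
    and odd_degree_root: "odd n \<Longrightarrow> c n \<noteq> 0 \<Longrightarrow> \<exists>x. (\<Sum>k\<le>n. c k * x ^ k) = 0"

section \<open>Expansions of an ordered field and definability\<close>

text \<open>
  First-order formulas over the language of ordered rings enlarged by function symbols of type
  \<open>'f\<close> and relation symbols of type \<open>'r\<close>. The symbols of the ordered ring are logical constructors
  with a fixed interpretation, so every structure below is an expansion of the ordered field
  \<open>'a\<close>. A constant is a function symbol of arity 0.
\<close>

datatype 'f tm =
  Var nat | Zero | One | Plus "'f tm" "'f tm" | Times "'f tm" "'f tm" | Fn 'f "'f tm list"

datatype ('f, 'r) fm =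
  Equal "'f tm" "'f tm" | Less "'f tm" "'f tm" | Rel 'r "'f tm list"
| Neg "('f, 'r) fm" | Conj "('f, 'r) fm" "('f, 'r) fm" | Exi nat "('f, 'r) fm"

record ('f, 'r, 'a) expansion =
  funs :: "'f set"
  rels :: "'r set"
  farity :: "'f \<Rightarrow> nat"
  rarity :: "'r \<Rightarrow> nat"
  finterp :: "'f \<Rightarrow> 'a list \<Rightarrow> 'a"
  rinterp :: "'r \<Rightarrow> 'a list \<Rightarrow> bool"

fun wf_tm :: "('f, 'r, 'a) expansion \<Rightarrow> 'f tm \<Rightarrow> bool" where
  "wf_tm S (Var i) = True"
| "wf_tm S Zero = True"
| "wf_tm S One = True"
| "wf_tm S (Plus s t) = (wf_tm S s \<and> wf_tm S t)"
| "wf_tm S (Times s t) = (wf_tm S s \<and> wf_tm S t)"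
| "wf_tm S (Fn f ts) = (f \<in> funs S \<and> length ts = farity S f \<and> (\<forall>t \<in> set ts. wf_tm S t))"

fun wf_fm :: "('f, 'r, 'a) expansion \<Rightarrow> ('f, 'r) fm \<Rightarrow> bool" where
  "wf_fm S (Equal s t) = (wf_tm S s \<and> wf_tm S t)"
| "wf_fm S (Less s t) = (wf_tm S s \<and> wf_tm S t)"
| "wf_fm S (Rel r ts) = (r \<in> rels S \<and> length ts = rarity S r \<and> (\<forall>t \<in> set ts. wf_tm S t))"
| "wf_fm S (Neg \<phi>) = wf_fm S \<phi>"
| "wf_fm S (Conj \<phi> \<psi>) = (wf_fm S \<phi> \<and> wf_fm S \<psi>)"
| "wf_fm S (Exi i \<phi>) = wf_fm S \<phi>"

fun tm_val :: "('f, 'r, 'a :: linordered_field) expansion \<Rightarrow> (nat \<Rightarrow> 'a) \<Rightarrow> 'f tm \<Rightarrow> 'a" where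
  "tm_val S e (Var i) = e i"
| "tm_val S e Zero = 0"
| "tm_val S e One = 1"
| "tm_val S e (Plus s t) = tm_val S e s + tm_val S e t"
| "tm_val S e (Times s t) = tm_val S e s * tm_val S e t"
| "tm_val S e (Fn f ts) = finterp S f (map (tm_val S e) ts)"

fun sat :: "('f, 'r, 'a :: linordered_field) expansion \<Rightarrow> (nat \<Rightarrow> 'a) \<Rightarrow> ('f, 'r) fm \<Rightarrow> bool" where
  "sat S e (Equal s t) \<longleftrightarrow> tm_val S e s = tm_val S e t"
| "sat S e (Less s t) \<longleftrightarrow> tm_val S e s < tm_val S e t"
| "sat S e (Rel r ts) \<longleftrightarrow> rinterp S r (map (tm_val S e) ts)"
| "sat S e (Neg \<phi>) \<longleftrightarrow> \<not> sat S e \<phi>"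
| "sat S e (Conj \<phi> \<psi>) \<longleftrightarrow> sat S e \<phi> \<and> sat S e \<psi>"
| "sat S e (Exi i \<phi>) \<longleftrightarrow> (\<exists>a. sat S (e(i := a)) \<phi>)"

definition is_reduct :: "('f, 'r, 'a) expansion \<Rightarrow> ('f, 'r, 'a) expansion \<Rightarrow> bool" where
  "is_reduct S0 S \<longleftrightarrow>
     funs S0 \<subseteq> funs S \<and> rels S0 \<subseteq> rels S \<and>
     (\<forall>f \<in> funs S0. farity S0 f = farity S f \<and>
        (\<forall>as. length as = farity S f \<longrightarrow> finterp S0 f as = finterp S f as)) \<and>
     (\<forall>r \<in> rels S0. rarity S0 r = rarity S r \<and>
        (\<forall>as. length as = rarity S r \<longrightarrow> rinterp S0 r as = rinterp S r as))"

text \<open>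
  Points of \<open>M\<^sup>n\<close> are the functions on \<open>{..<n}\<close> (coordinates are numbered from 0), extended by
  \<open>undefined\<close>; this is the carrier of the library's product topology over \<open>{..<n}\<close>.
\<close>

definition tuples :: "nat \<Rightarrow> (nat \<Rightarrow> 'a) set" where
  "tuples n = {..<n} \<rightarrow>\<^sub>E UNIV"

text \<open>The free variables of \<open>\<phi>\<close> with index \<open>\<ge> n\<close> are the parameters, with values given by \<open>e\<close>.\<close>

definition definable :: "('f, 'r, 'a :: linordered_field) expansion \<Rightarrow> nat \<Rightarrow> (nat \<Rightarrow> 'a) set \<Rightarrow> bool" where
  "definable S n A \<longleftrightarrow>
     (\<exists>\<phi> e. wf_fm S \<phi> \<and> A = {x \<in> tuples n. sat S (\<lambda>i. if i < n then x i else e i) \<phi>})"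

definition definable1 :: "('f, 'r, 'a :: linordered_field) expansion \<Rightarrow> 'a set \<Rightarrow> bool" where
  "definable1 S A \<longleftrightarrow> definable S 1 {x \<in> tuples 1. x 0 \<in> A}"

definition definable_fun ::
  "('f, 'r, 'a :: linordered_field) expansion \<Rightarrow> nat \<Rightarrow> (nat \<Rightarrow> 'a) set \<Rightarrow> ((nat \<Rightarrow> 'a) \<Rightarrow> 'a) \<Rightarrow> bool"
  where
  "definable_fun S n A f \<longleftrightarrow>
     A \<subseteq> tuples n \<and>
     definable S (Suc n)
       {y \<in> tuples (Suc n). restrict y {..<n} \<in> A \<and> y n = f (restrict y {..<n})}"

definition definably_complete :: "('f, 'r, 'a :: linordered_field) expansion \<Rightarrow> bool" where
  "definably_complete S \<longleftrightarrow>
     (\<forall>A. definable1 S A \<and> A \<noteq> {} \<and> (\<exists>u. \<forall>a \<in> A. a \<le> u) \<longrightarrow>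
        (\<exists>s. (\<forall>a \<in> A. a \<le> s) \<and> (\<forall>u. (\<forall>a \<in> A. a \<le> u) \<longrightarrow> s \<le> u)))"

definition open_interval :: "'a :: linorder set \<Rightarrow> bool" where
  "open_interval J \<longleftrightarrow>
     (\<exists>a b. a < b \<and> J = {a<..<b}) \<or> (\<exists>a. J = {a<..}) \<or> (\<exists>b. J = {..<b}) \<or> J = UNIV"

definition o_minimal :: "('f, 'r, 'a :: linordered_field) expansion \<Rightarrow> bool" where
  "o_minimal S \<longleftrightarrow>
     (\<forall>A. definable1 S A \<longrightarrow>
        (\<exists>\<J>. finite \<J> \<and> (\<forall>J \<in> \<J>. open_interval J \<or> (\<exists>a. J = {a})) \<and> A = \<Union>\<J>))"

definition polynomially_bounded :: "('f, 'r, 'a :: linordered_field) expansion \<Rightarrow> bool" where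
  "polynomially_bounded S \<longleftrightarrow>
     (\<forall>h :: 'a \<Rightarrow> 'a. definable_fun S 1 (tuples 1) (\<lambda>x. h (x 0)) \<longrightarrow>
        (\<exists>k :: nat. \<exists>b. \<forall>x > b. \<bar>h x\<bar> \<le> x ^ k))"

section \<open>Locally tame functions\<close>

text \<open>
  \<open>linorder_topology\<close> makes \<open>open\<close> on \<open>'a\<close> the order topology.
\<close>

definition tuple_topology :: "nat \<Rightarrow> (nat \<Rightarrow> 'a :: linorder_topology) topology" where
  "tuple_topology n = product_topology (\<lambda>_. euclidean) {..<n}"

text \<open>
  Total differentiability at a point, the tuple \<open>D\<close> being the matrix of the derivative. The
  \<open>\<ell>\<^sup>1\<close>-norm is used in the remainder; the choice of norm does not matter.
\<close>

definition differentiable_at ::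
  "nat \<Rightarrow> (nat \<Rightarrow> 'a :: linordered_field) set \<Rightarrow> ((nat \<Rightarrow> 'a) \<Rightarrow> 'a) \<Rightarrow> (nat \<Rightarrow> 'a) \<Rightarrow> bool" where
  "differentiable_at n U f x \<longleftrightarrow>
     (\<exists>D. \<forall>\<epsilon> > 0. \<exists>\<delta> > 0. \<forall>y \<in> U. (\<forall>i < n. \<bar>y i - x i\<bar> < \<delta>) \<longrightarrow>
        \<bar>f y - f x - (\<Sum>i<n. D i * (y i - x i))\<bar> \<le> \<epsilon> * (\<Sum>i<n. \<bar>y i - x i\<bar>))"

definition partial_deriv ::
  "(nat \<Rightarrow> 'a :: {linordered_field, linorder_topology}) set \<Rightarrow> nat \<Rightarrow>
    ((nat \<Rightarrow> 'a) \<Rightarrow> 'a) \<Rightarrow> (nat \<Rightarrow> 'a) \<Rightarrow> 'a" where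
  "partial_deriv U i f = (\<lambda>x \<in> U. Lim (at 0) (\<lambda>h. (f (x(i := x i + h)) - f x) / h))"

primrec times_differentiable ::
  "nat \<Rightarrow> (nat \<Rightarrow> 'a :: {linordered_field, linorder_topology}) set \<Rightarrow> nat \<Rightarrow>
    ((nat \<Rightarrow> 'a) \<Rightarrow> 'a) \<Rightarrow> bool" where
  "times_differentiable n U 0 f \<longleftrightarrow> True"
| "times_differentiable n U (Suc k) f \<longleftrightarrow>
     (\<forall>x \<in> U. differentiable_at n U f x) \<and>
     (\<forall>i < n. times_differentiable n U k (partial_deriv U i f))"

definition smooth ::
  "nat \<Rightarrow> (nat \<Rightarrow> 'a :: {linordered_field, linorder_topology}) set \<Rightarrow>
    ((nat \<Rightarrow> 'a) \<Rightarrow> 'a) \<Rightarrow> bool" where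
  "smooth n U f \<longleftrightarrow> (\<forall>k. times_differentiable n U k f)"

text \<open>
  In the last clause the sides of the box have length at most 1, so only bounded intervals occur.
\<close>

definition locally_tame ::
  "('f, 'r, 'a :: {linordered_field, linorder_topology}) expansion \<Rightarrow> ('f, 'r, 'a) expansion \<Rightarrow>
    nat \<Rightarrow> (nat \<Rightarrow> 'a) set \<Rightarrow> ((nat \<Rightarrow> 'a) \<Rightarrow> 'a) \<Rightarrow> bool" where
  "locally_tame S S0 n U f \<longleftrightarrow>
     openin (tuple_topology n) U \<and> definable_fun S n U f \<and> smooth n U f \<and>
     (\<forall>a b. (\<forall>i < n. a i < b i \<and> b i - a i \<le> 1) \<longrightarrow>
        (let B = (\<Pi>\<^sub>E i \<in> {..<n}. {a i<..<b i})
         in tuple_topology n closure_of B \<subseteq> U \<longrightarrow> definable_fun S0 n B f))"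

section \<open>The rings of functions and their zero sets\<close>

text \<open>
  Functions \<open>M\<^sup>n \<rightarrow> M\<close> are extensional on \<^term>\<open>tuples n\<close>, so that equal functions are equal terms.
\<close>

definition rat_subalgebra :: "nat \<Rightarrow> ((nat \<Rightarrow> 'a :: linordered_field) \<Rightarrow> 'a) set \<Rightarrow> bool" where
  "rat_subalgebra n A \<longleftrightarrow>
     A \<subseteq> extensional (tuples n) \<and>
     (\<lambda>x \<in> tuples n. 1) \<in> A \<and>
     (\<forall>f \<in> A. \<forall>g \<in> A. (\<lambda>x \<in> tuples n. f x + g x) \<in> A) \<and>
     (\<forall>f \<in> A. \<forall>g \<in> A. (\<lambda>x \<in> tuples n. f x * g x) \<in> A) \<and>
     (\<forall>q. \<forall>f \<in> A. (\<lambda>x \<in> tuples n. of_rat q * f x) \<in> A)"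

text \<open>Sums over a finite set \<open>E\<close> of exponents \<open>\<alpha>\<close>, with rational coefficients \<open>c\<close>.\<close>

definition rat_polys :: "nat \<Rightarrow> ((nat \<Rightarrow> 'a :: linordered_field) \<Rightarrow> 'a) set" where
  "rat_polys n =
     {(\<lambda>x \<in> tuples n. \<Sum>\<alpha>\<in>E. of_rat (c \<alpha>) * (\<Prod>i<n. x i ^ \<alpha> i)) | c (E :: (nat \<Rightarrow> nat) set). finite E}"

definition more_vars :: "nat \<Rightarrow> nat \<Rightarrow> ((nat \<Rightarrow> 'a) \<Rightarrow> 'a) \<Rightarrow> (nat \<Rightarrow> 'a) \<Rightarrow> 'a" where
  "more_vars n n' f = (\<lambda>x \<in> tuples n'. f (restrict x {..<n}))"

definition tame_rings ::
  "('f, 'r, 'a :: {linordered_field, linorder_topology}) expansion \<Rightarrow> ('f, 'r, 'a) expansion \<Rightarrow>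
    (nat \<Rightarrow> ((nat \<Rightarrow> 'a) \<Rightarrow> 'a) set) \<Rightarrow> bool" where
  "tame_rings S S0 R \<longleftrightarrow>
     (\<forall>n \<ge> 1.
        rat_subalgebra n (R n) \<and>
        (\<forall>f \<in> R n. locally_tame S S0 n (tuples n) f) \<and>
        (\<forall>f \<in> R n. \<forall>i < n. partial_deriv (tuples n) i f \<in> R n) \<and>
        more_vars n (Suc n) ` R n \<subseteq> R (Suc n) \<and>
        rat_polys n \<subseteq> R n)"

definition V :: "nat \<Rightarrow> ((nat \<Rightarrow> 'a :: linordered_field) \<Rightarrow> 'a) list \<Rightarrow> (nat \<Rightarrow> 'a) set" where
  "V n fs = {x \<in> tuples n. \<forall>f \<in> set fs. f x = 0}"

definition grad ::
  "nat \<Rightarrow> ((nat \<Rightarrow> 'a :: {linordered_field, linorder_topology}) \<Rightarrow> 'a) \<Rightarrow> (nat \<Rightarrow> 'a) \<Rightarrow> nat \<Rightarrow> 'a"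
  where
  "grad n f x = (\<lambda>i \<in> {..<n}. partial_deriv (tuples n) i f x)"

text \<open>Linear independence of a family of vectors: a repeated vector makes it dependent.\<close>

definition lin_indep :: "nat \<Rightarrow> (nat \<Rightarrow> 'a :: linordered_field) list \<Rightarrow> bool" where
  "lin_indep n vs \<longleftrightarrow>
     (\<forall>c. (\<forall>i < n. (\<Sum>j<length vs. c j * (vs ! j) i) = 0) \<longrightarrow> (\<forall>j < length vs. c j = 0))"

definition V_reg ::
  "nat \<Rightarrow> ((nat \<Rightarrow> 'a :: {linordered_field, linorder_topology}) \<Rightarrow> 'a) list \<Rightarrow> (nat \<Rightarrow> 'a) set" where
  "V_reg n fs = {x \<in> V n fs. lin_indep n (map (\<lambda>f. grad n f x) fs)}"

end

theory Submission
  imports Defs "Jordan_Normal_Form.Determinant"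
begin

text \<open>
  Consider functions \<open>F\<^sub>1, \<dots>, F\<^sub>N\<close> in \<open>R\<^sub>N\<close> whose Jacobian is invertible at a point \<open>p\<close> above \<open>V(f)\<close>, and
  such that \<open>F\<^sub>k(p) = 0\<close> for all \<open>k\<close> outside a set \<open>K\<close> of free indices: a \<^emph>\<open>chart\<close> at \<open>p\<close>. The coordinate
  functions form a chart in which every index is free, and a chart without free indices is what has
  to be found. So take a chart, over all \<open>N\<close>, with as few free indices as possible, and suppose that
  \<open>K\<close> is not empty. Let \<open>M\<close> be the common zero set of the \<open>F\<^sub>k\<close> with \<open>k\<close> not free, and let \<open>D\<^sub>k\<close> be
  the vector fields dual to the differentials of the \<open>F\<^sub>k\<close>; those with \<open>k\<close> free are tangent to \<open>M\<close>.

  Minimality forces \<open>D\<^sub>k g\<close> to vanish with \<open>g\<close> at every point of \<open>M \<inter> V(f)\<close>, for \<open>g\<close> in the ring and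
  \<open>k\<close> free: otherwise \<open>g\<close> could replace \<open>F\<^sub>k\<close> (\<open>chart_exchange\<close>). To iterate this, the coefficients of
  \<open>D\<^sub>k\<close> have to belong to the ring; one more variable, constrained to be the inverse of the Jacobian
  determinant, achieves this and makes \<open>M\<close> regular at all of its points (\<open>regularise\<close>). Hence if \<open>g\<close>
  vanishes at a point of \<open>M \<inter> V(f)\<close>, so do all its iterated derivatives along \<open>M\<close>. A function of one
  variable that is definable in the polynomially bounded reduct and has all derivatives zero at a
  point vanishes from there on (\<open>flat_imp_zero\<close>); applied along the paths in \<open>M\<close> which the inverse
  function theorem provides, this shows that \<open>g\<close> vanishes on \<open>M\<close> near the point (\<open>vanishes_nearby\<close>).

  Consequently every nonempty subset of \<open>M \<inter> V(f)\<close> cut out by finitely many further elements of the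
  ring is relatively open in \<open>M\<close>, and it is closed. The squared distance to a fixed point \<open>a\<close> attains
  a minimum on such a set, which by openness is a local minimum on \<open>M\<close>, so there all \<open>D\<^sub>k\<close> with \<open>k\<close>
  free annihilate it (\<open>min_critical\<close>). For \<open>a\<close> with entries 0 and 1 these conditions are again
  equations between elements of the ring, so they can be imposed one after the other for \<open>a = 0\<close> and
  all unit vectors \<open>a\<close>. At the resulting point \<open>D\<^sub>k\<close> annihilates all coordinate functions, so it is
  zero, whereas it is a column of an invertible matrix (\<open>no_free_index\<close>).

  Over an arbitrary ordered field, completeness is available for definable sets only. Therefore
  the mean value inequality, the existence of minima and the inverse function theorem are proved here
  for definable functions, on the basis of closure properties of definability.
\<close>

section \<open>Closure properties of definability\<close>

fun ren_tm :: "(nat \<Rightarrow> nat) \<Rightarrow> 'f tm \<Rightarrow> 'f tm" where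
  "ren_tm \<rho> (Var i) = Var (\<rho> i)"
| "ren_tm \<rho> Zero = Zero"
| "ren_tm \<rho> One = One"
| "ren_tm \<rho> (Plus s t) = Plus (ren_tm \<rho> s) (ren_tm \<rho> t)"
| "ren_tm \<rho> (Times s t) = Times (ren_tm \<rho> s) (ren_tm \<rho> t)"
| "ren_tm \<rho> (Fn g ts) = Fn g (map (ren_tm \<rho>) ts)"

fun ren_fm :: "(nat \<Rightarrow> nat) \<Rightarrow> ('f, 'r) fm \<Rightarrow> ('f, 'r) fm" where
  "ren_fm \<rho> (Equal s t) = Equal (ren_tm \<rho> s) (ren_tm \<rho> t)"
| "ren_fm \<rho> (Less s t) = Less (ren_tm \<rho> s) (ren_tm \<rho> t)"
| "ren_fm \<rho> (Rel r ts) = Rel r (map (ren_tm \<rho>) ts)"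
| "ren_fm \<rho> (Neg \<phi>) = Neg (ren_fm \<rho> \<phi>)"
| "ren_fm \<rho> (Conj \<phi> \<psi>) = Conj (ren_fm \<rho> \<phi>) (ren_fm \<rho> \<psi>)"
| "ren_fm \<rho> (Exi i \<phi>) = Exi (\<rho> i) (ren_fm \<rho> \<phi>)"

lemma wf_ren_tm: "wf_tm S t \<Longrightarrow> wf_tm S (ren_tm \<rho> t)"
  by (induction t) auto

lemma wf_ren_fm: "wf_fm S \<phi> \<Longrightarrow> wf_fm S (ren_fm \<rho> \<phi>)"
  by (induction \<phi>) (auto simp: wf_ren_tm)

lemma tm_val_ren: "tm_val S e (ren_tm \<rho> t) = tm_val S (\<lambda>i. e (\<rho> i)) t"
proof (induction t)
  case (Fn g ts)
  then have "map (tm_val S e \<circ> ren_tm \<rho>) ts = map (tm_val S (\<lambda>i. e (\<rho> i))) ts"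
    by (intro map_cong) auto
  then show ?case by (simp only: ren_tm.simps tm_val.simps map_map)
qed auto

lemma sat_ren: "inj \<rho> \<Longrightarrow> sat S e (ren_fm \<rho> \<phi>) = sat S (\<lambda>i. e (\<rho> i)) \<phi>"
proof (induction \<phi> arbitrary: e)
  case (Rel r ts)
  have "map (tm_val S e \<circ> ren_tm \<rho>) ts = map (tm_val S (\<lambda>i. e (\<rho> i))) ts"
    by (intro map_cong) (auto simp: tm_val_ren)
  then show ?case by (simp only: ren_fm.simps sat.simps map_map)
next
  case (Exi i \<phi>)
  have "(\<lambda>j. (e(\<rho> i := a)) (\<rho> j)) = (\<lambda>j. e (\<rho> j))(i := a)" for a
    using Exi.prems by (auto simp: fun_eq_iff inj_eq)
  then show ?case using Exi by simp
qed (auto simp: tm_val_ren)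

text \<open>
  The coordinates of a point occupy the even variables and the parameters the odd ones. Points are
  sequences here: with all coordinates present at once, definability of a predicate does not
  depend on a number of variables, and parameters can always be added.
\<close>

definition merge :: "(nat \<Rightarrow> 'a) \<Rightarrow> (nat \<Rightarrow> 'a) \<Rightarrow> nat \<Rightarrow> 'a" where
  "merge x e i = (if even i then x (i div 2) else e (i div 2))"

definition def_pred :: "('f, 'r, 'a :: linordered_field) expansion \<Rightarrow> ((nat \<Rightarrow> 'a) \<Rightarrow> bool) \<Rightarrow> bool" where
  "def_pred S P \<longleftrightarrow> (\<exists>\<phi> e. wf_fm S \<phi> \<and> (\<forall>x. P x \<longleftrightarrow> sat S (merge x e) \<phi>))"

text \<open>Definability of the graph, whose value coordinate comes first so that the arguments keep their
  order.\<close>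

definition def_fun :: "('f, 'r, 'a :: linordered_field) expansion \<Rightarrow> ((nat \<Rightarrow> 'a) \<Rightarrow> 'a) \<Rightarrow> bool" where
  "def_fun S t \<longleftrightarrow> def_pred S (\<lambda>x. x 0 = t (\<lambda>i. x (Suc i)))"

lemma def_predI:
  assumes "wf_fm S \<phi>" "inj \<rho>" "\<And>x. P x \<longleftrightarrow> sat S (\<lambda>i. merge x e (\<rho> i)) \<phi>"
  shows "def_pred S P"
  unfolding def_pred_def
  using assms wf_ren_fm[OF assms(1)] sat_ren[OF assms(2)] by blast

text \<open>The renaming of variables has to be injective, as it could capture bound variables otherwise, so no
  coordinate may occur twice. Repeated coordinates are obtained from equations in
  \<open>def_pred_subst\<close>.\<close>

lemma def_pred_reindex:
  fixes S :: "('f, 'r, 'a :: linordered_field) expansion"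
  assumes P: "def_pred S P" and inj: "\<And>i i' j. \<kappa> i = Inl j \<Longrightarrow> \<kappa> i' = Inl j \<Longrightarrow> i = i'"
  shows "def_pred S (\<lambda>x. P (\<lambda>i. case \<kappa> i of Inl j \<Rightarrow> x j | Inr a \<Rightarrow> a))"
proof -
  obtain \<phi> e where \<phi>: "wf_fm S \<phi>" "\<And>x. P x \<longleftrightarrow> sat S (merge x e) \<phi>"
    using P unfolding def_pred_def by blast
  define \<rho> where "\<rho> k = (if odd k then 2 * k + 1 else
     case \<kappa> (k div 2) of Inl j \<Rightarrow> 2 * j | Inr _ \<Rightarrow> 2 * k + 1)" for k
  define e' where "e' k = (if odd k then e (k div 2) else
     case \<kappa> (k div 2) of Inl j \<Rightarrow> undefined | Inr a \<Rightarrow> a)" for k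
  have "inj \<rho>"
  proof (rule injI)
    fix k k' assume eq: "\<rho> k = \<rho> k'"
    have *: "k = k'" if "\<rho> k = 2 * k + 1 \<or> \<rho> k' = 2 * k' + 1"
      using that eq unfolding \<rho>_def by (auto split: if_splits sum.splits) presburger+
    show "k = k'"
    proof (cases "\<rho> k = 2 * k + 1 \<or> \<rho> k' = 2 * k' + 1")
      case False
      then obtain j j' where "even k" "even k'" "\<kappa> (k div 2) = Inl j" "\<kappa> (k' div 2) = Inl j'"
        "\<rho> k = 2 * j" "\<rho> k' = 2 * j'"
        unfolding \<rho>_def by (auto split: if_splits sum.splits)
      with eq inj[of "k div 2" j "k' div 2"] show ?thesis by auto
    qed (rule *)
  qed
  moreover have "merge x e' (\<rho> k) = merge (\<lambda>i. case \<kappa> i of Inl j \<Rightarrow> x j | Inr a \<Rightarrow> a) e k" for x k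
    by (auto simp: merge_def \<rho>_def e'_def split: sum.splits)
  ultimately show ?thesis
    using \<phi> by (intro def_predI[of S \<phi> \<rho> _ e']) auto
qed

lemma def_pred_reindexing:
  assumes "def_pred S P" "inj \<rho>"
  shows "def_pred S (\<lambda>x. P (\<lambda>i. x (\<rho> i)))"
  using def_pred_reindex[of S P "\<lambda>i. Inl (\<rho> i)"] assms by (auto simp: inj_def)

lemma def_fun_reindexing:
  assumes "def_fun S t" "inj \<rho>"
  shows "def_fun S (\<lambda>x. t (\<lambda>i. x (\<rho> i)))"
proof -
  have "inj (case_nat 0 (\<lambda>i. Suc (\<rho> i)))"
    by (rule injI) (use assms(2) in \<open>auto split: nat.split_asm simp: inj_eq\<close>)
  from def_pred_reindexing[OF assms(1)[unfolded def_fun_def] this]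
  show ?thesis by (simp add: def_fun_def)
qed

lemma def_fun_shift: "def_fun S t \<Longrightarrow> def_fun S (\<lambda>x. t (\<lambda>i. x (Suc i)))"
  by (rule def_fun_reindexing) auto

lemma def_pred_not: "def_pred S P \<Longrightarrow> def_pred S (\<lambda>x. \<not> P x)"
proof -
  assume "def_pred S P"
  then obtain \<phi> e where "wf_fm S \<phi>" "\<And>x. P x \<longleftrightarrow> sat S (merge x e) \<phi>"
    unfolding def_pred_def by blast
  then show ?thesis by (intro def_predI[of S "Neg \<phi>" id _ e]) auto
qed

lemma def_pred_conj:
  fixes S :: "('f, 'r, 'a :: linordered_field) expansion"
  assumes "def_pred S P" "def_pred S Q"
  shows "def_pred S (\<lambda>x. P x \<and> Q x)"
proof -
  obtain \<phi> e where \<phi>: "wf_fm S \<phi>" "\<And>x. P x \<longleftrightarrow> sat S (merge x e) \<phi>"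
    using assms(1) unfolding def_pred_def by blast
  obtain \<psi> e' where \<psi>: "wf_fm S \<psi>" "\<And>x. Q x \<longleftrightarrow> sat S (merge x e') \<psi>"
    using assms(2) unfolding def_pred_def by blast
  define \<rho> :: "nat \<Rightarrow> nat" where "\<rho> k = (if even k then k else 2 * k - 1)" for k
  define \<rho>' :: "nat \<Rightarrow> nat" where "\<rho>' k = (if even k then k else 2 * k + 1)" for k
  have inj: "inj \<rho>" "inj \<rho>'"
    by (auto intro!: injI simp: \<rho>_def \<rho>'_def split: if_splits elim!: oddE evenE) presburger+
  have m: "merge x (merge e e') (\<rho> k) = merge x e k" "merge x (merge e e') (\<rho>' k) = merge x e' k" for x k
    by (auto simp: merge_def \<rho>_def \<rho>'_def elim!: oddE evenE) (presburger+)?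
  show ?thesis
    using \<phi> \<psi> inj m by (intro def_predI[of S "Conj (ren_fm \<rho> \<phi>) (ren_fm \<rho>' \<psi>)" id _ "merge e e'"])
      (auto simp: wf_ren_fm sat_ren)
qed

text \<open>The quantified coordinate is the first one of the extended sequence, in the manner of de Bruijn
  indices. This form lets the closure properties decompose a predicate written in ordinary notation.\<close>

lemma def_pred_ex:
  fixes S :: "('f, 'r, 'a :: linordered_field) expansion"
  assumes "def_pred S (\<lambda>x. Q (x 0) (\<lambda>i. x (Suc i)))"
  shows "def_pred S (\<lambda>x. \<exists>a. Q a x)"
proof -
  obtain \<phi> e where \<phi>: "wf_fm S \<phi>" "\<And>x. Q (x 0) (\<lambda>i. x (Suc i)) \<longleftrightarrow> sat S (merge x e) \<phi>"
    using assms unfolding def_pred_def by blast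
  have Q: "Q a x \<longleftrightarrow> sat S (merge (case_nat a x) e) \<phi>" for a x
    using \<phi>(2)[of "case_nat a x"] by simp
  define \<rho> :: "nat \<Rightarrow> nat" where "\<rho> k = (if k = 0 then 1 else if even k then k - 2 else k + 2)" for k
  have inj: "inj \<rho>"
    by (rule injI) (auto simp: \<rho>_def split: if_splits; presburger)
  have m: "((merge x (case_nat undefined e))(1 := a)) (\<rho> k) = merge (case_nat a x) e k" for x a k
    by (cases "k = 0"; cases "even k")
       (auto simp: merge_def \<rho>_def split: nat.splits elim!: oddE evenE)
  show ?thesis
    using \<phi>(1) inj Q m
    by (intro def_predI[of S "Exi 1 (ren_fm \<rho> \<phi>)" id _ "case_nat undefined e"])
       (auto simp: wf_ren_fm sat_ren cong: if_cong)
qed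

lemma def_pred_app:
  assumes "def_fun S t" "def_pred S (\<lambda>x. Q (x 0) (\<lambda>i. x (Suc i)))"
  shows "def_pred S (\<lambda>x. Q (t x) x)"
proof -
  have "def_pred S (\<lambda>x. \<exists>a. a = t x \<and> Q a x)"
    by (intro def_pred_ex def_pred_conj assms(2) assms(1)[unfolded def_fun_def])
  then show ?thesis by simp
qed

text \<open>Substitution of definable functions, one argument at a time: \<open>P (T x)\<close> means that some \<open>a\<close>
  satisfies \<open>a = T x\<close> and \<open>P a\<close>.\<close>

lemma def_pred_subst:
  fixes S :: "('f, 'r, 'a :: linordered_field) expansion"
  assumes "def_pred S P" "\<And>i. i < n \<Longrightarrow> def_fun S (T i)"
  shows "def_pred S (\<lambda>x. P (\<lambda>i. if i < n then T i x else x (i - n)))"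
  using assms(2)
proof (induction n arbitrary: T)
  case 0
  then show ?case using assms(1) by simp
next
  case (Suc n)
  have eq: "(\<lambda>i. if i < n then T i (\<lambda>j. x (Suc j)) else x (i - n)) =
      (\<lambda>i. if i < n then T i (\<lambda>j. x (Suc j)) else if i = n then x 0 else x (Suc (i - Suc n)))" for x :: "nat \<Rightarrow> 'a"
    by (rule ext) (auto simp: Suc_diff_Suc)
  have "def_pred S (\<lambda>x. P (\<lambda>i. if i < n then T i (\<lambda>j. x (Suc j)) else x (i - n)))"
    by (rule Suc.IH[of "\<lambda>i x. T i (\<lambda>j. x (Suc j))"], rule def_fun_shift) (use Suc.prems in simp)
  then have "def_pred S (\<lambda>x. P (\<lambda>i. if i < n then T i (\<lambda>j. x (Suc j)) else
       if i = n then x 0 else x (Suc (i - Suc n))))"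
    by (simp only: eq)
  then have "def_pred S (\<lambda>x. P (\<lambda>i. if i < n then T i x else if i = n then T n x else x (i - Suc n)))"
    using Suc.prems[of n]
    by (intro def_pred_app[where t = "T n" and Q = "\<lambda>a x. P (\<lambda>i. if i < n then T i x else if i = n then a else x (i - Suc n))"]) auto
  moreover have "(\<lambda>i. if i < n then T i x else if i = n then T n x else x (i - Suc n)) =
      (\<lambda>i. if i < Suc n then T i x else x (i - Suc n))" for x
    by (rule ext) (auto simp: less_Suc_eq)
  ultimately show ?case by simp
qed

lemma def_fun_coord: "def_fun S (\<lambda>x. x i)"
  unfolding def_fun_def
  by (rule def_predI[of S "Equal (Var 0) (Var (2 * Suc i))" id]) (auto simp: merge_def)

lemma def_fun_const: "def_fun S (\<lambda>x. c)"
  unfolding def_fun_def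
  by (rule def_predI[of S "Equal (Var 0) (Var 1)" id _ "\<lambda>_. c"]) (auto simp: merge_def)

lemma def_pred_atoms:
  "def_pred S (\<lambda>x. x 0 = x 1)" "def_pred S (\<lambda>x. x 0 < x 1)"
  "def_pred S (\<lambda>x. x 0 = x 1 + x 2)" "def_pred S (\<lambda>x. x 0 = x 1 * x 2)"
  "def_pred S (\<lambda>x. x 0 + x 1 = 0)"
  by (rule def_predI[of S "Equal (Var 0) (Var 2)" id]
           def_predI[of S "Less (Var 0) (Var 2)" id]
           def_predI[of S "Equal (Var 0) (Plus (Var 2) (Var 4))" id]
           def_predI[of S "Equal (Var 0) (Times (Var 2) (Var 4))" id]
           def_predI[of S "Equal (Plus (Var 0) (Var 2)) Zero" id], auto simp: merge_def)+

lemma def_pred_eq: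
  assumes "def_fun S t" "def_fun S u" shows "def_pred S (\<lambda>x. t x = u x)"
proof -
  have "def_fun S ((if i = 0 then t else u))" if "i < 2" for i :: nat
    using assms by simp
  from def_pred_subst[where n = 2 and T = "\<lambda>i. if i = 0 then t else u", OF def_pred_atoms(1) this] show ?thesis by simp
qed

lemma def_pred_less:
  assumes "def_fun S t" "def_fun S u" shows "def_pred S (\<lambda>x. t x < u x)"
proof -
  have "def_fun S ((if i = 0 then t else u))" if "i < 2" for i :: nat
    using assms by simp
  from def_pred_subst[where n = 2 and T = "\<lambda>i. if i = 0 then t else u", OF def_pred_atoms(2) this] show ?thesis by simp
qed

lemma def_pred_le:
  assumes "def_fun S t" "def_fun S u" shows "def_pred S (\<lambda>x. t x \<le> u x)"
  using def_pred_not[OF def_pred_less[OF assms(2,1)]] by (simp add: not_less)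

lemma def_fun_add:
  assumes "def_fun S t" "def_fun S u" shows "def_fun S (\<lambda>x. t x + u x)"
proof -
  have "def_fun S (if i = 0 then (\<lambda>x. x 0) else if i = 1 then (\<lambda>x. t (\<lambda>i. x (Suc i))) else (\<lambda>x. u (\<lambda>i. x (Suc i))))"
    if "i < 3" for i :: nat
    using assms by (simp add: def_fun_shift def_fun_coord)
  from def_pred_subst[where n = 3 and T = "\<lambda>i. if i = 0 then (\<lambda>x. x 0) else if i = 1 then (\<lambda>x. t (\<lambda>i. x (Suc i))) else (\<lambda>x. u (\<lambda>i. x (Suc i)))", OF def_pred_atoms(3) this] show ?thesis by (simp add: def_fun_def)
qed

lemma def_fun_mult:
  assumes "def_fun S t" "def_fun S u" shows "def_fun S (\<lambda>x. t x * u x)"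
proof -
  have "def_fun S (if i = 0 then (\<lambda>x. x 0) else if i = 1 then (\<lambda>x. t (\<lambda>i. x (Suc i))) else (\<lambda>x. u (\<lambda>i. x (Suc i))))"
    if "i < 3" for i :: nat
    using assms by (simp add: def_fun_shift def_fun_coord)
  from def_pred_subst[where n = 3 and T = "\<lambda>i. if i = 0 then (\<lambda>x. x 0) else if i = 1 then (\<lambda>x. t (\<lambda>i. x (Suc i))) else (\<lambda>x. u (\<lambda>i. x (Suc i)))", OF def_pred_atoms(4) this] show ?thesis by (simp add: def_fun_def)
qed

lemma def_fun_diff:
  assumes "def_fun S t" "def_fun S u" shows "def_fun S (\<lambda>x. t x - u x)"
  using def_fun_add[OF assms(1) def_fun_mult[OF def_fun_const assms(2)], of "- 1"] by simp

lemma def_pred_cong: "(\<And>x. P x = Q x) \<Longrightarrow> def_pred S Q \<Longrightarrow> def_pred S P"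
  by (subgoal_tac "P = Q") auto

lemma def_pred_disj:
  "def_pred S P \<Longrightarrow> def_pred S Q \<Longrightarrow> def_pred S (\<lambda>x. P x \<or> Q x)"
  by (rule def_pred_cong[of _ "\<lambda>x. \<not> (\<not> P x \<and> \<not> Q x)"], simp) (intro def_pred_not def_pred_conj)

lemma def_pred_imp:
  "def_pred S P \<Longrightarrow> def_pred S Q \<Longrightarrow> def_pred S (\<lambda>x. P x \<longrightarrow> Q x)"
  by (rule def_pred_cong[of _ "\<lambda>x. \<not> (P x \<and> \<not> Q x)"], simp) (intro def_pred_not def_pred_conj)

lemma def_pred_all:
  assumes "def_pred S (\<lambda>x. Q (x 0) (\<lambda>i. x (Suc i)))"
  shows "def_pred S (\<lambda>x. \<forall>a. Q a x)"
  by (rule def_pred_cong[of _ "\<lambda>x. \<not> (\<exists>a. \<not> Q a x)"], simp)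
     (intro def_pred_not def_pred_ex assms)

lemma def_fun_if:
  assumes "def_pred S P" "def_fun S t" "def_fun S u"
  shows "def_fun S (\<lambda>x. if P x then t x else u x)"
  unfolding def_fun_def
proof (rule def_pred_cong)
  show "def_pred S (\<lambda>x. (P (\<lambda>i. x (Suc i)) \<and> x 0 = t (\<lambda>i. x (Suc i))) \<or> 
     (\<not> P (\<lambda>i. x (Suc i)) \<and> x 0 = u (\<lambda>i. x (Suc i))))"
    using assms(2,3)[unfolded def_fun_def]
    by (intro def_pred_disj def_pred_conj def_pred_not def_pred_reindexing[OF assms(1)]) auto
qed auto

lemma def_fun_abs: "def_fun S t \<Longrightarrow> def_fun S (\<lambda>x. \<bar>t x\<bar>)"
  unfolding abs_if
  using def_fun_diff[OF def_fun_const[of S 0], of t]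
  by (intro def_fun_if def_pred_less) (auto intro: def_fun_const)

lemma def_fun_sum: "(\<And>i. i \<in> I \<Longrightarrow> def_fun S (t i)) \<Longrightarrow> def_fun S (\<lambda>x. \<Sum>i\<in>I. t i x)"
  by (induction I rule: infinite_finite_induct) (auto intro: def_fun_const def_fun_add)

lemma def_pred_true: "def_pred S (\<lambda>x. c)"
  by (intro def_predI[of S "if c then Equal Zero Zero else Neg (Equal Zero Zero)" id]) auto

lemma def_pred_ball: "finite I \<Longrightarrow> (\<And>i. i \<in> I \<Longrightarrow> def_pred S (P i)) \<Longrightarrow> def_pred S (\<lambda>x. \<forall>i\<in>I. P i x)"
  by (induction I rule: finite_induct) (auto intro: def_pred_true def_pred_conj)

lemma def_pred_all_less: "(\<And>i. i < (n::nat) \<Longrightarrow> def_pred S (P i)) \<Longrightarrow> def_pred S (\<lambda>x. \<forall>i<n. P i x)"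
  using def_pred_ball[of "{..<n}" S P] by (simp add: Ball_def)

text \<open>In graphs of functions the value is the last coordinate, whereas \<open>def_pred_ex\<close> quantifies over the
  first one. This renaming mediates.\<close>

definition to_front :: "nat \<Rightarrow> nat \<Rightarrow> nat" where
  "to_front n i = (if i = n then 0 else if i < n then Suc i else i)"

lemma inj_to_front: "inj (to_front n)"
  by (auto simp: inj_def to_front_def split: if_splits)

lemma def_pred_ex_many:
  fixes S :: "('f, 'r, 'a :: linordered_field) expansion"
  assumes "def_pred S Q"
  shows "def_pred S (\<lambda>x. \<exists>y. Q (\<lambda>i. if i < n then y i else x (i - n)))"
  using assms
proof (induction n arbitrary: Q)
  case (Suc n)
  \<comment> \<open>The last of the \<open>Suc n\<close> coordinates is quantified first, so that the induction hypothesis applies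
  to the others.\<close>
  define Q' where "Q' z = (\<exists>a. Q (\<lambda>i. if i < n then z i else if i = n then a else z (i - 1)))" for z
  have k: "(\<lambda>i. x (to_front n i)) = (\<lambda>i. if i < n then x (Suc i) else if i = n then x 0 else x (Suc (i - 1)))" for x :: "nat \<Rightarrow> 'a"
    by (auto simp: to_front_def)
  have "def_pred S (\<lambda>x. Q (\<lambda>i. if i < n then x (Suc i) else if i = n then x 0 else x (Suc (i - 1))))"
    using def_pred_reindexing[OF Suc.prems inj_to_front[of n]] by (simp only: k)
  then have "def_pred S Q'"
    unfolding Q'_def by (rule def_pred_ex)
  from Suc.IH[OF this]
  show ?case
  proof (rule def_pred_cong[rotated])
    fix x
    show "(\<exists>y. Q (\<lambda>i. if i < Suc n then y i else x (i - Suc n))) \<longleftrightarrow>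
      (\<exists>y. Q' (\<lambda>i. if i < n then y i else x (i - n)))" (is "?L \<longleftrightarrow> ?R")
    proof
      assume ?L
      then obtain y where y: "Q (\<lambda>i. if i < Suc n then y i else x (i - Suc n))" ..
      have "(\<lambda>i. if i < Suc n then y i else x (i - Suc n)) = (\<lambda>i. if i < n then (if i < n then y i else x (i - n)) 
         else if i = n then y n else if i - 1 < n then y (i - 1) else x (i - 1 - n))"
        by (rule ext) (auto simp: less_Suc_eq)
      with y have "Q' (\<lambda>i. if i < n then y i else x (i - n))"
        unfolding Q'_def by (intro exI[of _ "y n"]) (simp only:)
      then show ?R by blast
    next
      assume ?R
      then obtain y a where y: "Q (\<lambda>i. if i < n then (if i < n then y i else x (i - n)) 
         else if i = n then a else if i - 1 < n then y (i - 1) else x (i - 1 - n))" unfolding Q'_def by blast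
      have "(\<lambda>i. if i < n then (if i < n then y i else x (i - n)) 
         else if i = n then a else if i - 1 < n then y (i - 1) else x (i - 1 - n)) =
         (\<lambda>i. if i < Suc n then (y(n := a)) i else x (i - Suc n))"
        by (rule ext) (auto simp: less_Suc_eq)
      with y have "Q (\<lambda>i. if i < Suc n then (y(n := a)) i else x (i - Suc n))" by (simp only:)
      then show ?L by blast
    qed
  qed
qed simp

lemma def_pred_ex_tuple:
  fixes S :: "('f, 'r, 'a :: linordered_field) expansion"
  assumes "def_pred S (\<lambda>x. Q (restrict x {..<n}) (\<lambda>i. x (i + n)))"
  shows "def_pred S (\<lambda>x. \<exists>y \<in> tuples n. Q y x)"
proof (rule def_pred_cong)
  show "def_pred S (\<lambda>x. \<exists>y. Q (restrict (\<lambda>i. if i < n then y i else x (i - n)) {..<n})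
     (\<lambda>i. if i + n < n then y (i + n) else x (i + n - n)))"
    by (rule def_pred_ex_many[OF assms])
next
  fix x :: "nat \<Rightarrow> 'a"
  have "restrict (\<lambda>i. if i < n then y i else x (i - n)) {..<n} = restrict y {..<n}" for y
    by (auto simp: fun_eq_iff)
  moreover have "restrict y {..<n} \<in> tuples n" "z \<in> tuples n \<Longrightarrow> restrict z {..<n} = z" for y z :: "nat \<Rightarrow> 'a"
    by (auto simp: tuples_def fun_eq_iff PiE_def extensional_def)
  ultimately show "(\<exists>y \<in> tuples n. Q y x) \<longleftrightarrow> (\<exists>y. Q (restrict (\<lambda>i. if i < n then y i else x (i - n)) {..<n})
     (\<lambda>i. if i + n < n then y (i + n) else x (i + n - n)))"
    by (simp, metis)
qed

lemma def_pred_all_tuple: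
  assumes "def_pred S (\<lambda>x. Q (restrict x {..<n}) (\<lambda>i. x (i + n)))"
  shows "def_pred S (\<lambda>x. \<forall>y \<in> tuples n. Q y x)"
  by (rule def_pred_cong[of _ "\<lambda>x. \<not> (\<exists>y\<in>tuples n. \<not> Q y x)"], simp)
     (intro def_pred_not def_pred_ex_tuple assms)

lemma def_fun_comp:
  fixes S :: "('f, 'r, 'a :: linordered_field) expansion"
  assumes "def_fun S (\<lambda>x. g (restrict x {..<n}))" "\<And>i. i < n \<Longrightarrow> def_fun S (T i)"
  shows "def_fun S (\<lambda>x. g (\<lambda>i\<in>{..<n}. T i x))"
proof -
  have *: "def_pred S (\<lambda>x. x 0 = g (restrict (\<lambda>i. x (Suc i)) {..<n}))"
    using assms(1) by (simp add: def_fun_def)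
  have "def_pred S (\<lambda>x. (if 0 < Suc n then case_nat (\<lambda>x. x 0) (\<lambda>i x. T i (\<lambda>j. x (Suc j))) 0 x else x (0 - Suc n))
      = g (restrict (\<lambda>i. if Suc i < Suc n then case_nat (\<lambda>x. x 0) (\<lambda>i x. T i (\<lambda>j. x (Suc j))) (Suc i) x else x (Suc i - Suc n)) {..<n}))"
    by (rule def_pred_subst[OF *]) (auto intro: def_fun_coord def_fun_shift assms(2) split: nat.splits)
  moreover have "restrict (\<lambda>i. if i < n then T i y else x (i - n)) {..<n} = (\<lambda>i\<in>{..<n}. T i y)" for x y
    by (auto simp: fun_eq_iff)
  moreover have "(\<lambda>i\<in>{..<n}. if Suc i < Suc n then (case Suc i of 0 \<Rightarrow> \<lambda>x. x 0 | Suc i \<Rightarrow> \<lambda>x. T i (\<lambda>j. x (Suc j))) x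
      else x (Suc i - Suc n)) = (\<lambda>i\<in>{..<n}. T i (\<lambda>j. x (Suc j)))" for x
    by (auto simp: fun_eq_iff)
  ultimately show ?thesis by (simp only: def_fun_def) simp
qed

lemma def_fun_restrict_coord: "def_fun S (\<lambda>x. restrict x {..<n} i)"
  by (cases "i < n") (auto intro: def_fun_coord def_fun_const)

lemmas def_intros = def_pred_conj def_pred_disj def_pred_imp def_pred_not def_pred_ex_tuple def_pred_all_tuple
  def_pred_ex def_pred_all
  def_pred_less def_pred_le def_pred_eq def_pred_all_less def_fun_restrict_coord def_fun_coord
  def_fun_add def_fun_diff def_fun_mult def_fun_abs def_fun_sum def_fun_const

lemma definable_imp_def_pred:
  fixes S :: "('f, 'r, 'a :: linordered_field) expansion"
  assumes "definable S n A" shows "def_pred S (\<lambda>x. restrict x {..<n} \<in> A)"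
proof -
  obtain \<phi> e where \<phi>: "wf_fm S \<phi>" "A = {x \<in> tuples n. sat S (\<lambda>i. if i < n then x i else e i) \<phi>}"
    using assms unfolding definable_def by blast
  have 1: "(\<lambda>i. if i < n then restrict x {..<n} i else e i) =
     (\<lambda>i. merge x e (if i < n then 2 * i else 2 * i + 1))" for x
    by (auto simp: merge_def)
  have 2: "inj (\<lambda>i. if i < n then 2 * i else 2 * i + 1)" by (rule injI) (auto split: if_splits)
  show ?thesis
    by (rule def_predI[OF \<phi>(1) 2, of _ e]) (auto simp: \<phi>(2) 1 tuples_def)
qed

lemma def_pred_imp_definable:
  fixes S :: "('f, 'r, 'a :: linordered_field) expansion"
  assumes "def_pred S P" 
  shows "definable S n {x \<in> tuples n. P x}"
proof -
  obtain \<phi> e where \<phi>: "wf_fm S \<phi>" "\<And>x. P x \<longleftrightarrow> sat S (merge x e) \<phi>"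
    using assms unfolding def_pred_def by blast
  define \<rho> where "\<rho> k = (if even k \<and> k div 2 < n then k div 2 else n + k)" for k :: nat
  define e' where "e' k = merge (\<lambda>_. undefined) e (k - n)" for k
  have inj: "inj \<rho>" by (auto simp: inj_def \<rho>_def split: if_splits elim!: evenE)
  have "(if \<rho> k < n then x (\<rho> k) else e' (\<rho> k)) = merge x e k" if "x \<in> tuples n" for x k
    using that by (auto simp: merge_def e'_def \<rho>_def tuples_def PiE_def extensional_def)
  then have "P x \<longleftrightarrow> sat S (\<lambda>k. if k < n then x k else e' k) (ren_fm \<rho> \<phi>)" if "x \<in> tuples n" for x
    using that by (simp add: sat_ren[OF inj] \<phi>(2))
  then have "{x \<in> tuples n. P x} = {x \<in> tuples n. sat S (\<lambda>k. if k < n then x k else e' k) (ren_fm \<rho> \<phi>)}"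
    by auto
  then show ?thesis unfolding definable_def using wf_ren_fm[OF \<phi>(1)] by blast
qed

lemma def_pred_imp_definable1:
  assumes "def_pred S (\<lambda>x. P (x 0))" shows "definable1 S {a. P a}"
  unfolding definable1_def using def_pred_imp_definable[OF assms, of 1] by simp

lemma def_fun_imp_definable_fun:
  fixes S :: "('f, 'r, 'a :: linordered_field) expansion"
  assumes "def_fun S (\<lambda>x. h (x 0))" shows "definable_fun S 1 (tuples 1) (\<lambda>x. h (x 0))"
proof -
  have "def_pred S (\<lambda>x. x 1 = h (x 0))"
    using assms by (intro def_pred_eq def_fun_coord)
  from def_pred_imp_definable[OF this, of "Suc 1"]
  have "definable S (Suc 1) {x \<in> tuples (Suc 1). x 1 = h (x 0)}" .
  moreover have "restrict y {..<1} \<in> tuples 1" for y :: "nat \<Rightarrow> 'a"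
    by (auto simp: tuples_def)
  ultimately show ?thesis unfolding definable_fun_def
    by (simp del: One_nat_def)
qed

text \<open>A function that is definable on \<open>B\<close> only, such as an element of the ring with respect to the
  reduct, becomes a totally defined definable function when it is set to 0 outside \<open>B\<close>.\<close>

definition cutoff :: "(nat \<Rightarrow> 'a) set \<Rightarrow> ((nat \<Rightarrow> 'a) \<Rightarrow> 'a :: zero) \<Rightarrow> (nat \<Rightarrow> 'a) \<Rightarrow> 'a" where
  "cutoff B g x = (if x \<in> B then g x else 0)"

lemma definable_fun_imp_def_fun:
  fixes S :: "('f, 'r, 'a :: linordered_field) expansion"
  assumes "definable_fun S n B g"
  shows "def_fun S (\<lambda>x. cutoff B g (restrict x {..<n}))"
    and "def_pred S (\<lambda>x. restrict x {..<n} \<in> B)"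
proof -
  have B: "B \<subseteq> tuples n" and "definable S (Suc n)
       {y \<in> tuples (Suc n). restrict y {..<n} \<in> B \<and> y n = g (restrict y {..<n})}"
    using assms unfolding definable_fun_def by auto
  from definable_imp_def_pred[OF this(2)]
  have *: "def_pred S (\<lambda>x. restrict x {..<n} \<in> B \<and> x n = g (restrict x {..<n}))"
  proof (rule def_pred_cong[rotated])
    fix x :: "nat \<Rightarrow> 'a"
    have "restrict (restrict x {..<Suc n}) {..<n} = restrict x {..<n}" "restrict x {..<Suc n} \<in> tuples (Suc n)"
      by (auto simp: fun_eq_iff tuples_def)
    then show "(restrict x {..<n} \<in> B \<and> x n = g (restrict x {..<n})) \<longleftrightarrow> restrict x {..<Suc n} \<in> 
      {y \<in> tuples (Suc n). restrict y {..<n} \<in> B \<and> y n = g (restrict y {..<n})}" by simp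
  qed
  \<comment> \<open>The value is the last coordinate in the graph of \<open>g\<close>; move it to the front.\<close>
  have k: "restrict (\<lambda>i. x (to_front n i)) {..<n} = restrict (\<lambda>i. x (Suc i)) {..<n}" "to_front n n = 0"
    for x :: "nat \<Rightarrow> 'a"
    by (auto simp: to_front_def fun_eq_iff)
  show **: "def_pred S (\<lambda>x. restrict x {..<n} \<in> B)"
  proof (rule def_pred_cong)
    show "def_pred S (\<lambda>x. \<exists>a. restrict x {..<n} \<in> B \<and> a = g (restrict x {..<n}))"
      using def_pred_reindexing[OF * inj_to_front[of n]] by (intro def_pred_ex) (simp only: k)
  qed auto
  have 1: "def_pred S (\<lambda>x. restrict (\<lambda>i. x (Suc i)) {..<n} \<in> B \<and> x 0 = g (restrict (\<lambda>i. x (Suc i)) {..<n}))"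
    using def_pred_reindexing[OF * inj_to_front[of n]] by (simp only: k)
  have 2: "def_pred S (\<lambda>x. restrict (\<lambda>i. x (Suc i)) {..<n} \<in> B)"
    using def_pred_reindexing[OF **, of Suc] by simp
  show "def_fun S (\<lambda>x. cutoff B g (restrict x {..<n}))"
    unfolding def_fun_def
    by (rule def_pred_cong[OF _ def_pred_disj[OF 1 def_pred_conj[OF def_pred_not[OF 2] def_pred_eq[OF def_fun_coord def_fun_const]]]])
       (auto simp: cutoff_def)
qed

section \<open>Functions of one variable in a definably complete structure\<close>

lemma def_fun_inverse:
  fixes S :: "('a, 'b, 'c :: linordered_field) expansion"
  assumes "def_fun S t" shows "def_fun S (\<lambda>x. inverse (t x))"
  unfolding def_fun_def
proof (rule def_pred_cong)
  show "def_pred S (\<lambda>x. (t (\<lambda>i. x (Suc i)) = 0 \<and> x 0 = 0) \<or> x 0 * t (\<lambda>i. x (Suc i)) = 1)"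
    by (intro def_intros def_fun_shift assms)
next
  fix x :: "nat \<Rightarrow> 'c"
  show "x 0 = inverse (t (\<lambda>i. x (Suc i))) \<longleftrightarrow> (t (\<lambda>i. x (Suc i)) = 0 \<and> x 0 = 0) \<or> x 0 * t (\<lambda>i. x (Suc i)) = 1"
    by (cases "t (\<lambda>i. x (Suc i)) = 0") (auto simp: field_simps)
qed

lemma def_fun_comp1:
  assumes "def_fun S (\<lambda>x. g (x 0))" "def_fun S t"
  shows "def_fun S (\<lambda>x. g (t x))"
  using def_fun_comp[of S "\<lambda>y. g (y 0)" 1 "\<lambda>_. t"] assms by simp

lemma definable_sup:
  fixes P :: "'a :: linordered_field \<Rightarrow> bool"
  assumes "definably_complete S" "def_pred S (\<lambda>x. P (x 0))" "P a" "\<And>a. P a \<Longrightarrow> a \<le> u"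
  obtains s where "\<And>a. P a \<Longrightarrow> a \<le> s" "\<And>u. u < s \<Longrightarrow> \<exists>a. P a \<and> u < a"
proof -
  have "definable1 S {a. P a}" using assms(2) by (rule def_pred_imp_definable1)
  then obtain s where s: "\<forall>a \<in> {a. P a}. a \<le> s" "\<forall>u. (\<forall>a \<in> {a. P a}. a \<le> u) \<longrightarrow> s \<le> u"
    using assms(1,3,4) unfolding definably_complete_def by blast
  show ?thesis
    by (rule that[of s]) (use s in \<open>auto simp: not_le[symmetric]\<close>)
qed

text \<open>Differentiability relative to \<open>X\<close>; at an end point of an interval it is one-sided.\<close>

definition has_deriv :: "('a :: linordered_field \<Rightarrow> 'a) \<Rightarrow> 'a \<Rightarrow> 'a \<Rightarrow> 'a set \<Rightarrow> bool" where
  "has_deriv \<phi> d s X \<longleftrightarrow> (\<forall>\<epsilon>>0. \<exists>\<delta>>0. \<forall>s'\<in>X. \<bar>s' - s\<bar> < \<delta> \<longrightarrow> \<bar>\<phi> s' - \<phi> s - d * (s' - s)\<bar> \<le> \<epsilon> * \<bar>s' - s\<bar>)"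

lemma has_deriv_subset: "has_deriv \<phi> d s X \<Longrightarrow> Y \<subseteq> X \<Longrightarrow> has_deriv \<phi> d s Y"
  unfolding has_deriv_def by (meson subset_eq)

lemma has_deriv_lipschitz:
  assumes "has_deriv \<phi> d s X" "\<epsilon> > 0"
  obtains \<delta> where "\<delta> > 0" "\<And>s'. s' \<in> X \<Longrightarrow> \<bar>s' - s\<bar> < \<delta> \<Longrightarrow> \<bar>\<phi> s' - \<phi> s\<bar> \<le> (\<bar>d\<bar> + \<epsilon>) * \<bar>s' - s\<bar>"
proof -
  obtain \<delta> where \<delta>: "\<delta> > 0" "\<forall>s'\<in>X. \<bar>s' - s\<bar> < \<delta> \<longrightarrow> \<bar>\<phi> s' - \<phi> s - d * (s' - s)\<bar> \<le> \<epsilon> * \<bar>s' - s\<bar>"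
    using assms unfolding has_deriv_def by blast
  have "\<bar>\<phi> s' - \<phi> s\<bar> \<le> (\<bar>d\<bar> + \<epsilon>) * \<bar>s' - s\<bar>" if "s' \<in> X" "\<bar>s' - s\<bar> < \<delta>" for s'
  proof -
    have "\<bar>\<phi> s' - \<phi> s\<bar> \<le> \<bar>\<phi> s' - \<phi> s - d * (s' - s)\<bar> + \<bar>d * (s' - s)\<bar>" by linarith
    also have "\<dots> \<le> \<epsilon> * \<bar>s' - s\<bar> + \<bar>d\<bar> * \<bar>s' - s\<bar>"
      using \<delta>(2) that by (simp add: abs_mult)
    finally show ?thesis by (simp add: algebra_simps)
  qed
  then show ?thesis using \<delta>(1) that by blast
qed

lemma has_deriv_limit_zero:
  assumes "has_deriv \<phi> d s X" "\<And>\<delta>. \<delta> > 0 \<Longrightarrow> \<exists>r\<in>X. \<bar>r - s\<bar> < \<delta> \<and> \<phi> r = 0"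
  shows "\<phi> s = 0"
proof (rule ccontr)
  assume ne: "\<phi> s \<noteq> 0"
  obtain \<delta> where \<delta>: "\<delta> > 0" "\<And>r. r \<in> X \<Longrightarrow> \<bar>r - s\<bar> < \<delta> \<Longrightarrow> \<bar>\<phi> r - \<phi> s\<bar> \<le> (\<bar>d\<bar> + 1) * \<bar>r - s\<bar>"
    by (rule has_deriv_lipschitz[OF assms(1), of 1]) auto
  have K: "\<bar>d\<bar> + 1 > 0" by (simp add: add_nonneg_pos)
  then obtain r where r: "r \<in> X" "\<bar>r - s\<bar> < \<delta>" "\<bar>r - s\<bar> < \<bar>\<phi> s\<bar> / (\<bar>d\<bar> + 1)" "\<phi> r = 0"
    using assms(2)[of "min \<delta> (\<bar>\<phi> s\<bar> / (\<bar>d\<bar> + 1))"] \<delta>(1) ne by auto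
  then have "(\<bar>d\<bar> + 1) * \<bar>r - s\<bar> < \<bar>\<phi> s\<bar>" using K by (simp add: pos_less_divide_eq mult.commute)
  then show False using \<delta>(2)[OF r(1,2)] r(4) by simp
qed

lemma has_deriv_eq_zero:
  assumes "has_deriv \<phi> d s X" "\<And>\<delta>. \<delta> > 0 \<Longrightarrow> \<exists>r\<in>X. r \<noteq> s \<and> \<bar>r - s\<bar> < \<delta> \<and> \<phi> r = \<phi> s"
  shows "d = 0"
proof (rule ccontr)
  assume "d \<noteq> 0"
  then have "\<bar>d\<bar> / 2 > 0" by simp
  then obtain \<delta> where \<delta>: "\<delta> > 0" "\<forall>r\<in>X. \<bar>r - s\<bar> < \<delta> \<longrightarrow> \<bar>\<phi> r - \<phi> s - d * (r - s)\<bar> \<le> \<bar>d\<bar> / 2 * \<bar>r - s\<bar>"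
    using assms(1) unfolding has_deriv_def by blast
  obtain r where "r \<in> X" "r \<noteq> s" "\<bar>r - s\<bar> < \<delta>" "\<phi> r = \<phi> s" using assms(2)[OF \<delta>(1)] by blast
  with \<delta>(2) have "\<bar>d\<bar> * \<bar>r - s\<bar> \<le> \<bar>d\<bar> / 2 * \<bar>r - s\<bar>" by (force simp: abs_mult)
  then show False using \<open>d \<noteq> 0\<close> \<open>r \<noteq> s\<close> by (simp add: mult_le_cancel_right)
qed

text \<open>For \<open>\<epsilon> > 0\<close>, consider the points \<open>s\<close> with \<open>\<bar>\<phi> s - \<phi> a\<bar> \<le> (K + \<epsilon>) (s - a)\<close>. Their supremum
  exists by definable completeness, belongs to them by continuity and cannot be smaller than \<open>b\<close>
  because of the derivative there.\<close>

lemma mean_value_inequality: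
  fixes \<phi> d :: "'a :: linordered_field \<Rightarrow> 'a"
  assumes dc: "definably_complete S" and \<phi>: "def_fun S (\<lambda>x. \<phi> (x 0))"
    and "a \<le> b" and der: "\<And>s. a \<le> s \<Longrightarrow> s \<le> b \<Longrightarrow> has_deriv \<phi> (d s) s {a..b}"
    and d: "\<And>s. a \<le> s \<Longrightarrow> s \<le> b \<Longrightarrow> \<bar>d s\<bar> \<le> K"
  shows "\<bar>\<phi> b - \<phi> a\<bar> \<le> K * (b - a)"
proof -
  have "\<bar>\<phi> b - \<phi> a\<bar> \<le> (K + \<epsilon>) * (b - a)" if "\<epsilon> > 0" for \<epsilon>
  proof -
    define P where "P s \<longleftrightarrow> a \<le> s \<and> s \<le> b \<and> \<bar>\<phi> s - \<phi> a\<bar> \<le> (K + \<epsilon>) * (s - a)" for s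
    have Pdef: "def_pred S (\<lambda>x. P (x 0))"
      unfolding P_def by (intro def_intros def_fun_comp1[OF \<phi>])
    have "P a" using \<open>a \<le> b\<close> by (simp add: P_def)
    obtain s where s: "\<And>a. P a \<Longrightarrow> a \<le> s" "\<And>u. u < s \<Longrightarrow> \<exists>a. P a \<and> u < a"
      by (rule definable_sup[OF dc Pdef \<open>P a\<close>, of b]) (auto simp: P_def)
    have "a \<le> s" using s(1) \<open>P a\<close> by blast
    have "s \<le> b" by (rule ccontr) (use s(2)[of b] in \<open>auto simp: P_def\<close>)
    have K: "\<bar>d s\<bar> + \<epsilon> \<le> K + \<epsilon>" using d \<open>a \<le> s\<close> \<open>s \<le> b\<close> by simp
    obtain \<delta> where \<delta>: "\<delta> > 0" "\<And>s'. s' \<in> {a..b} \<Longrightarrow> \<bar>s' - s\<bar> < \<delta> \<Longrightarrow> \<bar>\<phi> s' - \<phi> s\<bar> \<le> (\<bar>d s\<bar> + \<epsilon>) * \<bar>s' - s\<bar>"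
      using has_deriv_lipschitz[OF der[OF \<open>a \<le> s\<close> \<open>s \<le> b\<close>] \<open>\<epsilon> > 0\<close>] by blast
    have \<delta>': "\<bar>\<phi> s' - \<phi> s\<bar> \<le> (K + \<epsilon>) * \<bar>s' - s\<bar>" if "s' \<in> {a..b}" "\<bar>s' - s\<bar> < \<delta>" for s'
      using \<delta>(2)[OF that] mult_right_mono[OF K, of "\<bar>s' - s\<bar>"] by simp
    have "P s"
    proof -
      obtain s' where s': "P s'" "s - \<delta> < s'" using s(2)[of "s - \<delta>"] \<delta>(1) by auto
      then have "s' \<le> s" "s' \<in> {a..b}" using s(1) by (auto simp: P_def)
      then have "\<bar>\<phi> s' - \<phi> s\<bar> \<le> (K + \<epsilon>) * (s - s')" using \<delta>'[of s'] s' by (simp add: abs_of_nonpos)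
      moreover have "\<bar>\<phi> s' - \<phi> a\<bar> \<le> (K + \<epsilon>) * (s' - a)" using s'(1) by (simp add: P_def)
      ultimately have "\<bar>\<phi> s - \<phi> a\<bar> \<le> (K + \<epsilon>) * (s - s') + (K + \<epsilon>) * (s' - a)" by linarith
      then show ?thesis using \<open>a \<le> s\<close> \<open>s \<le> b\<close> by (simp add: P_def algebra_simps)
    qed
    have "s = b"
    proof (rule ccontr)
      assume "s \<noteq> b"
      define s' where "s' = min b (s + \<delta> / 2)"
      have s': "s < s'" "s' \<le> b" "\<bar>s' - s\<bar> < \<delta>"
        using \<open>s \<noteq> b\<close> \<open>s \<le> b\<close> \<delta>(1) by (auto simp: s'_def min_def field_simps abs_if)
      then have "\<bar>\<phi> s' - \<phi> s\<bar> \<le> (K + \<epsilon>) * (s' - s)" using \<delta>'[of s'] \<open>a \<le> s\<close> by (simp add: abs_if)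
      moreover have "\<bar>\<phi> s - \<phi> a\<bar> \<le> (K + \<epsilon>) * (s - a)" using \<open>P s\<close> by (simp add: P_def)
      ultimately have "\<bar>\<phi> s' - \<phi> a\<bar> \<le> (K + \<epsilon>) * (s' - s) + (K + \<epsilon>) * (s - a)" by linarith
      then have "P s'" using \<open>a \<le> s\<close> s' by (simp add: P_def algebra_simps)
      then show False using s(1) s'(1) by force
    qed
    then show ?thesis using \<open>P s\<close> by (simp add: P_def)
  qed
  note * = this
  show ?thesis
  proof (cases "a = b")
    case False
    then have "b - a > 0" using \<open>a \<le> b\<close> by simp
    show ?thesis
    proof (rule field_le_epsilon)
      fix e :: 'a assume "e > 0"
      then have "\<bar>\<phi> b - \<phi> a\<bar> \<le> (K + e / (b - a)) * (b - a)" using \<open>b - a > 0\<close> by (intro *) simp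
      then show "\<bar>\<phi> b - \<phi> a\<bar> \<le> K * (b - a) + e" using \<open>b - a > 0\<close> by (simp add: distrib_right)
    qed
  qed simp
qed

text \<open>A sequence of successive derivatives on the unit interval whose first member is definable in a
  polynomially bounded structure \<open>S0\<close>, while all members are definable in \<open>S\<close>.\<close>

locale flat_setting =
  fixes S S0 :: "('f, 'r, 'a :: linordered_field) expansion" and \<phi> :: "nat \<Rightarrow> 'a \<Rightarrow> 'a"
  assumes dc: "definably_complete S" and pb: "polynomially_bounded S0"
    and def: "\<And>m. def_fun S (\<lambda>x. \<phi> m (x 0))" and def0: "def_fun S0 (\<lambda>x. \<phi> 0 (x 0))"
    and der: "\<And>m s. 0 \<le> s \<Longrightarrow> s \<le> 1 \<Longrightarrow> has_deriv (\<phi> m) (\<phi> (Suc m) s) s {0..1}"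
begin

text \<open>By the mean value inequality, a bound of order \<open>t\<^sup>k\<close> on the derivative gives one of order
  \<open>t\<^sup>k\<^sup>+\<^sup>1\<close> on the function.\<close>

lemma taylor_bound:
  assumes s: "0 \<le> s" "s < 1" "\<And>m. \<phi> m s = 0"
  shows "\<exists>C \<eta>. C \<ge> 0 \<and> \<eta> > 0 \<and> s + \<eta> \<le> 1 \<and> (\<forall>t. 0 \<le> t \<longrightarrow> t \<le> \<eta> \<longrightarrow> \<bar>\<phi> m (s + t)\<bar> \<le> C * t ^ k)"
proof (induction k arbitrary: m)
  case 0
  obtain \<delta> where \<delta>: "\<delta> > 0" "\<And>s'. s' \<in> {0..1} \<Longrightarrow> \<bar>s' - s\<bar> < \<delta> \<Longrightarrow> \<bar>\<phi> m s' - \<phi> m s\<bar> \<le> (\<bar>\<phi> (Suc m) s\<bar> + 1) * \<bar>s' - s\<bar>"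
    by (rule has_deriv_lipschitz[OF der[OF s(1) less_imp_le[OF s(2)], of m], of 1]) (simp, blast)
  define \<eta> where "\<eta> = min (1 - s) (\<delta> / 2)"
  have \<eta>: "\<eta> > 0" "\<eta> \<le> 1 - s" "\<eta> < \<delta>" using s \<delta>(1) by (auto simp: \<eta>_def min_def field_simps)
  have "\<bar>\<phi> m (s + t)\<bar> \<le> \<bar>\<phi> (Suc m) s\<bar> + 1" if "0 \<le> t" "t \<le> \<eta>" for t
  proof -
    have "\<bar>\<phi> m (s + t) - \<phi> m s\<bar> \<le> (\<bar>\<phi> (Suc m) s\<bar> + 1) * \<bar>s + t - s\<bar>"
      using that \<eta> s by (intro \<delta>(2)) auto
    also have "\<dots> \<le> (\<bar>\<phi> (Suc m) s\<bar> + 1) * 1"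
      using that \<eta> s by (intro mult_left_mono) auto
    finally show ?thesis using s(3) by simp
  qed
  then show ?case using \<eta> by (intro exI[of _ "\<bar>\<phi> (Suc m) s\<bar> + 1"] exI[of _ \<eta>]) auto
next
  case (Suc k)
  obtain C \<eta> where C: "C \<ge> 0" "\<eta> > 0" "s + \<eta> \<le> 1" "\<And>t. 0 \<le> t \<Longrightarrow> t \<le> \<eta> \<Longrightarrow> \<bar>\<phi> (Suc m) (s + t)\<bar> \<le> C * t ^ k"
    using Suc.IH[of "Suc m"] by blast
  have "\<bar>\<phi> m (s + t)\<bar> \<le> C * t ^ Suc k" if t: "0 \<le> t" "t \<le> \<eta>" for t
  proof -
    have "\<bar>\<phi> m (s + t) - \<phi> m s\<bar> \<le> (C * t ^ k) * (s + t - s)"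
    proof (rule mean_value_inequality[OF dc def])
      fix r assume r: "s \<le> r" "r \<le> s + t"
      show "has_deriv (\<phi> m) (\<phi> (Suc m) r) r {s..s + t}"
        using r s t C(3) by (intro has_deriv_subset[OF der]) auto
      have "\<bar>\<phi> (Suc m) r\<bar> \<le> C * (r - s) ^ k" using C(4)[of "r - s"] r t by simp
      also have "\<dots> \<le> C * t ^ k" using r C(1) by (intro mult_left_mono power_mono) auto
      finally show "\<bar>\<phi> (Suc m) r\<bar> \<le> C * t ^ k" .
    qed (use t in simp)
    then show ?thesis using s(3) by (simp add: mult_ac)
  qed
  then show ?case using C by blast
qed

text \<open>The polynomial bound \<open>x\<^sup>k\<close> on \<open>x \<mapsto> 1 / \<phi> (s + 1/x)\<close> says that \<open>\<phi> (s + t)\<close> is zero or of absolute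
  value at least \<open>t\<^sup>k\<close> for small \<open>t > 0\<close>, in contrast to the bound \<open>C t\<^sup>k\<^sup>+\<^sup>1\<close>. Since
  \<open>1 / 0 = 0\<close>, the bounded function is total.\<close>

lemma flat_imp_zero_right:
  assumes s: "0 \<le> s" "s < 1" "\<And>m. \<phi> m s = 0"
  shows "\<exists>\<eta>>0. s + \<eta> \<le> 1 \<and> (\<forall>t. 0 \<le> t \<longrightarrow> t < \<eta> \<longrightarrow> \<phi> 0 (s + t) = 0)"
proof -
  define h where "h x = inverse (\<phi> 0 (s + inverse x))" for x
  have "def_fun S0 (\<lambda>x. h (x 0))"
    unfolding h_def by (intro def_intros def_fun_inverse def_fun_comp1[OF def0])
  then obtain k b where kb: "\<And>x. x > b \<Longrightarrow> \<bar>h x\<bar> \<le> x ^ k"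
    using pb def_fun_imp_definable_fun unfolding polynomially_bounded_def by blast
  obtain C \<eta> where C: "C \<ge> 0" "\<eta> > 0" "s + \<eta> \<le> 1" "\<And>t. 0 \<le> t \<Longrightarrow> t \<le> \<eta> \<Longrightarrow> \<bar>\<phi> 0 (s + t)\<bar> \<le> C * t ^ Suc k"
    using taylor_bound[OF s] by blast
  \<comment> \<open>The three bounds on \<open>t\<close>: the Taylor bound holds, \<open>C t < 1\<close>, and \<open>1/t\<close> exceeds \<open>b\<close>.\<close>
  define \<eta>' where "\<eta>' = min \<eta> (min (inverse (C + 1)) (inverse (\<bar>b\<bar> + 1)))"
  have \<eta>': "\<eta>' > 0" "\<eta>' \<le> \<eta>" "\<eta>' \<le> inverse (C + 1)" "\<eta>' \<le> inverse (\<bar>b\<bar> + 1)"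
    using C by (auto simp: \<eta>'_def)
  have "\<phi> 0 (s + t) = 0" if t: "0 \<le> t" "t < \<eta>'" for t
  proof (cases "t = 0")
    case False
    then have "t > 0" using t by simp
    have "t < inverse (\<bar>b\<bar> + 1)" using t \<eta>'(4) by simp
    from less_imp_inverse_less[OF this \<open>t > 0\<close>] have "\<bar>b\<bar> + 1 < inverse t" by simp
    then have "\<bar>h (inverse t)\<bar> \<le> inverse t ^ k" by (intro kb) linarith
    then have 1: "inverse \<bar>\<phi> 0 (s + t)\<bar> \<le> inverse (t ^ k)" by (simp add: h_def power_inverse)
    have 2: "\<bar>\<phi> 0 (s + t)\<bar> \<le> C * t ^ Suc k" using t \<eta>' by (intro C(4)) auto
    have "t < inverse (C + 1)" using t \<eta>'(3) by simp
    then have "t * (C + 1) < 1" using C(1) by (simp add: field_simps)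
    then have 3: "C * t < 1" using \<open>t > 0\<close> by (simp add: field_simps)
    show ?thesis
    proof (rule ccontr)
      assume "\<phi> 0 (s + t) \<noteq> 0"
      then have "t ^ k \<le> \<bar>\<phi> 0 (s + t)\<bar>" using 1 \<open>t > 0\<close> by (simp add: field_simps)
      with 2 have "1 * t ^ k \<le> (C * t) * t ^ k" by (simp add: mult_ac)
      then have "1 \<le> C * t" by (rule mult_right_le_imp_le) (use \<open>t > 0\<close> in simp)
      with 3 show False by simp
    qed
  qed (use s in simp)
  then show ?thesis using \<eta>' C by (intro exI[of _ \<eta>']) auto
qed

text \<open>All derivatives vanish on the largest initial interval \<open>[0, s]\<close> on which the function vanishes, so
  if \<open>s < 1\<close> then the function is flat at \<open>s\<close> and vanishes further.\<close>

lemma flat_imp_zero: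
  assumes zero: "\<And>m. \<phi> m 0 = 0"
  shows "\<phi> 0 1 = 0"
proof -
  define P where "P s \<longleftrightarrow> 0 \<le> s \<and> s \<le> 1 \<and> (\<forall>r. 0 \<le> r \<longrightarrow> r \<le> s \<longrightarrow> \<phi> 0 r = 0)" for s
  have Pdef: "def_pred S (\<lambda>x. P (x 0))"
    unfolding P_def by (intro def_intros def_fun_comp1[OF def])
  have "P 0" using zero by (auto simp: P_def)
  obtain s where s: "\<And>a. P a \<Longrightarrow> a \<le> s" "\<And>u. u < s \<Longrightarrow> \<exists>a. P a \<and> u < a"
    by (rule definable_sup[OF dc Pdef \<open>P 0\<close>, of 1]) (auto simp: P_def)
  have "0 \<le> s" using s(1) \<open>P 0\<close> by blast
  have "s \<le> 1" by (rule ccontr) (use s(2)[of 1] in \<open>auto simp: P_def\<close>)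
  have below: "\<phi> 0 r = 0" if "0 \<le> r" "r < s" for r
    using s(2)[OF that(2)] that(1) by (auto simp: P_def)
  have at: "\<phi> m r = 0" if "0 \<le> r" "r \<le> s" for m r
  proof (cases "s = 0")
    case False
    then have "s > 0" using \<open>0 \<le> s\<close> by simp
    have near: "\<exists>r'\<in>{0..1}. r' \<noteq> r \<and> r' < s \<and> \<bar>r' - r\<bar> < \<delta>" if "\<delta> > 0" "0 \<le> r" "r \<le> s" for \<delta> r
    proof (cases "r = 0")
      case True
      then show ?thesis using that \<open>s > 0\<close> \<open>s \<le> 1\<close>
        by (intro bexI[of _ "min (s / 2) (\<delta> / 2)"]) (auto simp: min_def field_simps)
    next
      case False
      then show ?thesis using that \<open>s \<le> 1\<close>
        by (intro bexI[of _ "max 0 (r - \<delta> / 2)"]) (auto simp: max_def field_simps)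
    qed
    show ?thesis using that
    proof (induction m arbitrary: r)
      case 0
      then show ?case using near[of _ r] below \<open>s \<le> 1\<close> by (intro has_deriv_limit_zero[OF der]) force+
    next
      case (Suc m)
      then show ?case using near[of _ r] \<open>s \<le> 1\<close> by (intro has_deriv_eq_zero[OF der]) force+
    qed
  qed (use that zero in auto)
  have "s = 1"
  proof (rule ccontr)
    assume "s \<noteq> 1"
    then obtain \<eta> where \<eta>: "\<eta> > 0" "s + \<eta> \<le> 1" "\<And>t. 0 \<le> t \<Longrightarrow> t < \<eta> \<Longrightarrow> \<phi> 0 (s + t) = 0"
      using flat_imp_zero_right[of s] at \<open>0 \<le> s\<close> \<open>s \<le> 1\<close> by force
    have "\<phi> 0 r = 0" if "0 \<le> r" "r \<le> s + \<eta> / 2" for r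
    proof (cases "r \<le> s")
      case False
      moreover have "r - s < \<eta>" using that \<eta>(1) by (simp add: field_simps)
      ultimately show ?thesis using \<eta>(3)[of "r - s"] by simp
    qed (use at that in auto)
    moreover have "s + \<eta> / 2 \<le> 1" using \<eta>(1,2) by (simp add: field_simps)
    ultimately have "P (s + \<eta> / 2)" using \<open>0 \<le> s\<close> \<eta>(1) by (auto simp: P_def)
    then show False using s(1)[of "s + \<eta> / 2"] \<eta>(1) by simp
  qed
  then show ?thesis using at[of 1 0] by simp
qed

end

section \<open>Existence of minima\<close>

text \<open>A substitute for compactness. The values \<open>c 0, c 1, \<dots>\<close> are chosen in turn: \<open>c k\<close> is the lower limit of
  \<open>u k\<close> over the points of \<open>Z\<close> at which the earlier functions are close to their chosen
  values. The first one is thus an infimum.\<close>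

lemma cluster_values:
  fixes S :: "('f, 'r, 'a :: linordered_field) expansion" and k :: nat
  assumes dc: "definably_complete S" and Z: "def_pred S (\<lambda>x. restrict x {..<N} \<in> Z)" "Z \<subseteq> tuples N" "Z \<noteq> {}"
    and u: "\<And>j. j < k \<Longrightarrow> def_fun S (\<lambda>x. u j (restrict x {..<N}))"
    and bd: "\<And>x j. x \<in> Z \<Longrightarrow> j < k \<Longrightarrow> \<bar>u j x\<bar> \<le> L"
  shows "\<exists>c. (\<forall>\<epsilon>>0. \<exists>x\<in>Z. \<forall>j<k. \<bar>u j x - c j\<bar> < \<epsilon>) \<and> (0 < k \<longrightarrow> (\<forall>x\<in>Z. c 0 \<le> u 0 x))"
  using u bd
proof (induction k)
  case 0
  then show ?case using \<open>Z \<noteq> {}\<close> by auto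
next
  case (Suc k)
  have "\<exists>c. (\<forall>\<epsilon>>0. \<exists>x\<in>Z. \<forall>j<k. \<bar>u j x - c j\<bar> < \<epsilon>) \<and> (0 < k \<longrightarrow> (\<forall>x\<in>Z. c 0 \<le> u 0 x))"
    by (intro Suc.IH Suc.prems) auto
  then obtain c where c: "\<And>\<epsilon>. \<epsilon> > 0 \<Longrightarrow> \<exists>x\<in>Z. \<forall>j<k. \<bar>u j x - c j\<bar> < \<epsilon>" "0 < k \<Longrightarrow> \<forall>x\<in>Z. c 0 \<le> u 0 x" by blast
  define P where "P a \<longleftrightarrow> (\<exists>\<epsilon>. 0 < \<epsilon> \<and> (\<forall>y\<in>tuples N. y \<in> Z \<and> (\<forall>j<k. \<bar>u j y - c j\<bar> < \<epsilon>) \<longrightarrow> a \<le> u k y))" for a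
  have Pdef: "def_pred S (\<lambda>x. P (x 0))"
    unfolding P_def by (intro def_intros Z Suc.prems) auto
  have "P (- L)" unfolding P_def
  proof (intro exI[of _ 1] conjI ballI impI)
    fix y assume "y \<in> Z \<and> (\<forall>j<k. \<bar>u j y - c j\<bar> < 1)"
    then show "- L \<le> u k y" using Suc.prems(2)[of y k] by auto
  qed simp
  have PL: "a \<le> L" if a: "P a" for a
  proof -
    obtain \<epsilon> where \<epsilon>: "0 < \<epsilon>" "\<And>y. y \<in> Z \<Longrightarrow> \<forall>j<k. \<bar>u j y - c j\<bar> < \<epsilon> \<Longrightarrow> a \<le> u k y"
      using a Z(2) unfolding P_def by blast
    obtain x where "x \<in> Z" "a \<le> u k x" using c(1)[OF \<epsilon>(1)] \<epsilon>(2) by blast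
    then show ?thesis using Suc.prems(2)[of x k] by auto
  qed
  obtain s where s: "\<And>a. P a \<Longrightarrow> a \<le> s" "\<And>u. u < s \<Longrightarrow> \<exists>a. P a \<and> u < a"
    by (rule definable_sup[OF dc Pdef \<open>P (- L)\<close> PL]) blast+
  have near: "\<exists>x\<in>Z. \<forall>j<Suc k. \<bar>u j x - (c(k := s)) j\<bar> < \<epsilon>" if "\<epsilon> > 0" for \<epsilon>
  proof -
    obtain a where a: "P a" "s - \<epsilon> < a" using s(2)[of "s - \<epsilon>"] \<open>\<epsilon> > 0\<close> by auto
    then obtain \<epsilon>' where \<epsilon>': "0 < \<epsilon>'" "\<And>y. y \<in> Z \<Longrightarrow> \<forall>j<k. \<bar>u j y - c j\<bar> < \<epsilon>' \<Longrightarrow> a \<le> u k y"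
      using Z(2) unfolding P_def by blast
    have "\<not> P (s + \<epsilon>)" using s(1)[of "s + \<epsilon>"] that by auto
    moreover have "0 < min \<epsilon> \<epsilon>'" using that \<epsilon>'(1) by simp
    ultimately obtain y where y: "y \<in> Z" "\<forall>j<k. \<bar>u j y - c j\<bar> < min \<epsilon> \<epsilon>'" "u k y < s + \<epsilon>"
      unfolding P_def by (metis not_le)
    have "a \<le> u k y" using y by (intro \<epsilon>'(2)) auto
    then have "\<bar>u k y - s\<bar> < \<epsilon>" using a(2) y(3) by (auto simp: abs_if)
    then show ?thesis using y by (intro bexI[of _ y]) (auto simp: less_Suc_eq)
  qed
  have "\<forall>x\<in>Z. (c(k := s)) 0 \<le> u 0 x"
  proof (cases "k = 0")
    case True
    show ?thesis
    proof (rule ballI, rule ccontr)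
      fix x assume x: "x \<in> Z" "\<not> (c(k := s)) 0 \<le> u 0 x"
      then obtain a where "P a" "u 0 x < a" using s(2)[of "u 0 x"] True by auto
      then show False using x(1) Z(2) True unfolding P_def by force
    qed
  qed (use c(2) in auto)
  then show ?case using near by blast
qed

abbreviation close_to :: "nat \<Rightarrow> 'a :: linordered_field \<Rightarrow> (nat \<Rightarrow> 'a) \<Rightarrow> (nat \<Rightarrow> 'a) \<Rightarrow> bool" where
  "close_to N \<delta> x y \<equiv> \<forall>i<N. \<bar>y i - x i\<bar> < \<delta>"

text \<open>The cluster values of the function \<open>h\<close> followed by the coordinates form a point of \<open>Z\<close>, and the
  value of \<open>h\<close> at this point is the infimum.\<close>

lemma min_attained:
  fixes S :: "('f, 'r, 'a :: linordered_field) expansion"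
  assumes dc: "definably_complete S" and Z: "def_pred S (\<lambda>x. restrict x {..<N} \<in> Z)" "Z \<subseteq> tuples N" "Z \<noteq> {}"
    and h: "def_fun S (\<lambda>x. h (restrict x {..<N}))"
    and bd: "\<And>x j. x \<in> Z \<Longrightarrow> j < N \<Longrightarrow> \<bar>x j\<bar> \<le> L" "\<And>x. x \<in> Z \<Longrightarrow> \<bar>h x\<bar> \<le> L"
    and closed: "\<And>x. x \<in> tuples N \<Longrightarrow> (\<And>\<epsilon>. \<epsilon> > 0 \<Longrightarrow> \<exists>z\<in>Z. \<forall>i<N. \<bar>z i - x i\<bar> < \<epsilon>) \<Longrightarrow> x \<in> Z"
    and cont: "\<And>x \<epsilon>. x \<in> Z \<Longrightarrow> \<epsilon> > 0 \<Longrightarrow> \<exists>\<delta>>0. \<forall>z\<in>Z. close_to N \<delta> x z \<longrightarrow> \<bar>h z - h x\<bar> < \<epsilon>"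
  shows "\<exists>x\<in>Z. \<forall>z\<in>Z. h x \<le> h z"
proof -
  \<comment> \<open>\<open>h\<close> comes first, so that its cluster value is the infimum.\<close>
  define u where "u = case_nat h (\<lambda>j x. x j)"
  have "\<exists>c. (\<forall>\<epsilon>>0. \<exists>x\<in>Z. \<forall>j<Suc N. \<bar>u j x - c j\<bar> < \<epsilon>) \<and> (0 < Suc N \<longrightarrow> (\<forall>x\<in>Z. c 0 \<le> u 0 x))"
  proof (rule cluster_values[OF dc Z])
    fix j assume "j < Suc N"
    then show "def_fun S (\<lambda>x. u j (restrict x {..<N}))"
      by (cases j) (auto simp: u_def intro: h def_fun_coord)
  qed (use bd in \<open>auto simp: u_def split: nat.splits\<close>)
  then obtain c where c: "\<And>\<epsilon>. \<epsilon> > 0 \<Longrightarrow> \<exists>x\<in>Z. \<forall>j<Suc N. \<bar>u j x - c j\<bar> < \<epsilon>" "\<And>x. x \<in> Z \<Longrightarrow> c 0 \<le> h x"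
    by (auto simp: u_def)
  define p where "p = restrict (\<lambda>i. c (Suc i)) {..<N}"
  have near: "\<exists>z\<in>Z. \<bar>h z - c 0\<bar> < \<epsilon> \<and> close_to N \<epsilon> p z" if "\<epsilon> > 0" for \<epsilon>
    using c(1)[OF that] by (force simp: u_def p_def)
  have "p \<in> Z"
  proof (rule closed)
    show "p \<in> tuples N" by (simp add: p_def tuples_def)
  qed (use near in blast)
  have "h p \<le> c 0"
  proof (rule field_le_epsilon)
    fix e :: 'a assume "e > 0"
    then have "e / 2 > 0" by simp
    then obtain \<delta> where \<delta>: "\<delta> > 0" "\<forall>z\<in>Z. close_to N \<delta> p z \<longrightarrow> \<bar>h z - h p\<bar> < e / 2"
      using cont[OF \<open>p \<in> Z\<close>] by blast
    obtain z where z: "z \<in> Z" "\<bar>h z - c 0\<bar> < min \<delta> (e / 2)" "\<forall>i<N. \<bar>z i - p i\<bar> < min \<delta> (e / 2)"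
      using near[of "min \<delta> (e / 2)"] \<delta>(1) \<open>e > 0\<close> by auto
    then have "\<bar>h z - h p\<bar> < e / 2" "\<bar>h z - c 0\<bar> < e / 2" using \<delta>(2) by auto
    then have "h p - c 0 \<le> e / 2 + e / 2" by linarith
    then show "h p \<le> c 0 + e" by simp
  qed
  then show ?thesis using \<open>p \<in> Z\<close> c(2) by (meson order_trans)
qed

section \<open>Gradients\<close>

definition norm1 :: "nat \<Rightarrow> (nat \<Rightarrow> 'a :: linordered_field) \<Rightarrow> 'a" where
  "norm1 N v = (\<Sum>i<N. \<bar>v i\<bar>)"

abbreviation dist1 :: "nat \<Rightarrow> (nat \<Rightarrow> 'a :: linordered_field) \<Rightarrow> (nat \<Rightarrow> 'a) \<Rightarrow> 'a" where
  "dist1 N x y \<equiv> norm1 N (\<lambda>i. x i - y i)"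

lemma norm1_nonneg [simp]: "norm1 N v \<ge> 0"
  by (simp add: norm1_def sum_nonneg)

lemma abs_le_norm1: "i < N \<Longrightarrow> \<bar>v i\<bar> \<le> norm1 N v"
  unfolding norm1_def by (rule member_le_sum[where f = "\<lambda>i. \<bar>v i\<bar>"]) auto

lemma norm1_triangle: "norm1 N (\<lambda>i. u i + v i) \<le> norm1 N u + norm1 N v"
  unfolding norm1_def sum.distrib[symmetric] by (intro sum_mono abs_triangle_ineq)

lemma norm1_scale: "norm1 N (\<lambda>i. c * v i) = \<bar>c\<bar> * norm1 N v"
  by (simp add: norm1_def abs_mult sum_distrib_left)

lemma abs_sum_mult_le: "\<bar>\<Sum>i<N. D i * v i\<bar> \<le> norm1 N D * norm1 N v"
proof -
  have "\<bar>\<Sum>i<N. D i * v i\<bar> \<le> (\<Sum>i<N. \<bar>D i\<bar> * \<bar>v i\<bar>)"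
    by (rule order_trans[OF sum_abs]) (simp add: abs_mult)
  also have "\<dots> \<le> (\<Sum>i<N. \<bar>D i\<bar> * norm1 N v)"
    by (intro sum_mono mult_left_mono abs_le_norm1) auto
  finally show ?thesis by (simp add: norm1_def sum_distrib_right)
qed

lemma uniform_delta:
  fixes P :: "nat \<Rightarrow> 'a :: linordered_field \<Rightarrow> bool"
  assumes "\<And>i. i < N \<Longrightarrow> \<exists>\<delta>>0. P i \<delta>" "\<And>i \<delta> \<delta>'. P i \<delta> \<Longrightarrow> 0 < \<delta>' \<Longrightarrow> \<delta>' \<le> \<delta> \<Longrightarrow> P i \<delta>'"
  shows "\<exists>\<delta>>0. \<forall>i<N. P i \<delta>"
  using assms(1)
proof (induction N)
  case 0
  show ?case by (intro exI[of _ 1]) auto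
next
  case (Suc N)
  obtain \<delta> where \<delta>: "\<delta> > 0" "\<forall>i<N. P i \<delta>" using Suc.IH Suc.prems by auto
  obtain \<delta>' where \<delta>': "\<delta>' > 0" "P N \<delta>'" using Suc.prems by auto
  show ?case
    using \<delta> \<delta>' assms(2)[of _ \<delta> "min \<delta> \<delta>'"] assms(2)[of _ \<delta>' "min \<delta> \<delta>'"]
    by (intro exI[of _ "min \<delta> \<delta>'"]) (auto simp: less_Suc_eq)
qed

definition cont_at :: "nat \<Rightarrow> ((nat \<Rightarrow> 'a) \<Rightarrow> 'a :: linordered_field) \<Rightarrow> (nat \<Rightarrow> 'a) \<Rightarrow> bool" where
  "cont_at N g x \<longleftrightarrow> (\<forall>\<epsilon>>0. \<exists>\<delta>>0. \<forall>y \<in> tuples N. close_to N \<delta> x y \<longrightarrow> \<bar>g y - g x\<bar> < \<epsilon>)"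

abbreviation lin_error :: "nat \<Rightarrow> ((nat \<Rightarrow> 'a) \<Rightarrow> 'a :: linordered_field) \<Rightarrow> (nat \<Rightarrow> 'a) \<Rightarrow> (nat \<Rightarrow> 'a) \<Rightarrow> (nat \<Rightarrow> 'a) \<Rightarrow> 'a" where
  "lin_error N g x D y \<equiv> \<bar>g y - g x - (\<Sum>i<N. D i * (y i - x i))\<bar>"

text \<open>The derivative at a point with its matrix \<open>D\<close> as a parameter, to be computed by the usual rules and
  compared with the partial derivatives in \<open>partial_deriv_eq\<close>.\<close>

definition has_grad :: "nat \<Rightarrow> ((nat \<Rightarrow> 'a) \<Rightarrow> 'a :: linordered_field) \<Rightarrow> (nat \<Rightarrow> 'a) \<Rightarrow> (nat \<Rightarrow> 'a) \<Rightarrow> bool" where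
  "has_grad N g x D \<longleftrightarrow> (\<forall>\<epsilon>>0. \<exists>\<delta>>0. \<forall>y \<in> tuples N. close_to N \<delta> x y \<longrightarrow>
     lin_error N g x D y \<le> \<epsilon> * dist1 N y x)"

lemma has_gradD:
  assumes "has_grad N g x D" "\<epsilon> > 0"
  obtains \<delta> where "\<delta> > 0" "\<And>y. y \<in> tuples N \<Longrightarrow> close_to N \<delta> x y \<Longrightarrow>
     lin_error N g x D y \<le> \<epsilon> * dist1 N y x"
  using assms unfolding has_grad_def by meson

lemma has_grad_lipschitz:
  assumes "has_grad N g x D"
  obtains \<delta> where "\<delta> > 0" "\<And>y. y \<in> tuples N \<Longrightarrow> close_to N \<delta> x y \<Longrightarrow>
     \<bar>g y - g x\<bar> \<le> (norm1 N D + 1) * dist1 N y x"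
proof -
  obtain \<delta> where \<delta>: "\<delta> > 0" "\<And>y. y \<in> tuples N \<Longrightarrow> close_to N \<delta> x y \<Longrightarrow>
     lin_error N g x D y \<le> 1 * dist1 N y x"
    by (rule has_gradD[OF assms, of 1]) auto
  show ?thesis
  proof (rule that[OF \<delta>(1)])
    fix y assume y: "y \<in> tuples N" "close_to N \<delta> x y"
    from \<delta>(2)[OF this] abs_sum_mult_le[of D "\<lambda>i. y i - x i" N]
    show "\<bar>g y - g x\<bar> \<le> (norm1 N D + 1) * dist1 N y x"
      by (simp add: distrib_right)
  qed
qed

lemma norm1_le: "(\<And>i. i < N \<Longrightarrow> \<bar>v i\<bar> \<le> \<delta>) \<Longrightarrow> norm1 N v \<le> of_nat N * \<delta>"
  unfolding norm1_def using sum_bounded_above[of "{..<N}" "\<lambda>i. \<bar>v i\<bar>" \<delta>] by simp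

lemma has_grad_imp_cont: 
  assumes "has_grad N g x D" shows "cont_at N g x"
  unfolding cont_at_def
proof (intro allI impI)
  fix \<epsilon> :: 'a assume "\<epsilon> > 0"
  obtain \<delta> where \<delta>: "\<delta> > 0" "\<And>y. y \<in> tuples N \<Longrightarrow> close_to N \<delta> x y \<Longrightarrow>
     \<bar>g y - g x\<bar> \<le> (norm1 N D + 1) * dist1 N y x"
    using has_grad_lipschitz[OF assms] by blast
  define C where "C = (norm1 N D + 1) * (of_nat N + 1)"
  have "C > 0" unfolding C_def by (intro mult_pos_pos add_nonneg_pos) auto
  define \<delta>' where "\<delta>' = min \<delta> (\<epsilon> / C)"
  have \<delta>': "\<delta>' > 0" "\<delta>' \<le> \<delta>" "C * \<delta>' \<le> \<epsilon>"
    using \<delta>(1) \<open>\<epsilon> > 0\<close> \<open>C > 0\<close> by (auto simp: \<delta>'_def min_def field_simps)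
  show "\<exists>\<delta>>0. \<forall>y\<in>tuples N. close_to N \<delta> x y \<longrightarrow> \<bar>g y - g x\<bar> < \<epsilon>"
  proof (intro exI[of _ \<delta>'] conjI ballI impI)
    fix y assume y: "y \<in> tuples N" "close_to N \<delta>' x y"
    have "\<bar>g y - g x\<bar> \<le> (norm1 N D + 1) * dist1 N y x"
      using y \<delta>' by (intro \<delta>(2)) (auto intro: less_le_trans)
    also have "\<dots> \<le> (norm1 N D + 1) * (of_nat N * \<delta>')"
      using y by (intro mult_left_mono norm1_le) (auto intro: less_imp_le)
    also have "\<dots> < C * \<delta>'"
      using \<delta>'(1) by (simp add: C_def algebra_simps add_pos_nonneg add_nonneg_pos)
    finally show "\<bar>g y - g x\<bar> < \<epsilon>" using \<delta>'(3) by simp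
  qed (use \<delta>' in auto)
qed

text \<open>Without this, the limit in the definition of a partial derivative would not be determined.\<close>

lemma at_0_nontrivial: "at (0 :: 'a :: {linordered_field, linorder_topology}) \<noteq> bot"
proof
  assume "at (0 :: 'a) = bot"
  then have "open {0 :: 'a}" by (simp add: at_eq_bot_iff)
  from open_right[OF this, of 0 1] obtain b :: 'a where "0 < b" "{0..<b} \<subseteq> {0}" by auto
  moreover have "b / 2 \<in> {0..<b}" using \<open>0 < b\<close> by (simp add: field_simps)
  ultimately have "b / 2 \<in> {0}" by (metis subsetD)
  then show False using \<open>0 < b\<close> by simp
qed

lemma partial_deriv_eq:
  fixes g :: "(nat \<Rightarrow> 'a :: {linordered_field, linorder_topology}) \<Rightarrow> 'a"
  assumes g: "has_grad N g x D" and x: "x \<in> tuples N" and i: "i < N"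
  shows "partial_deriv (tuples N) i g x = D i"
proof -
  define q where "q h = (g (x(i := x i + h)) - g x) / h" for h
  have near: "\<exists>\<delta>>0. \<forall>h. h \<noteq> 0 \<longrightarrow> \<bar>h\<bar> < \<delta> \<longrightarrow> \<bar>q h - D i\<bar> \<le> \<epsilon>" if "\<epsilon> > 0" for \<epsilon>
  proof -
    obtain \<delta> where \<delta>: "\<delta> > 0" "\<And>y. y \<in> tuples N \<Longrightarrow> close_to N \<delta> x y \<Longrightarrow>
       lin_error N g x D y \<le> \<epsilon> * dist1 N y x"
      using has_gradD[OF g \<open>\<epsilon> > 0\<close>] by blast
    have "\<bar>q h - D i\<bar> \<le> \<epsilon>" if h: "h \<noteq> 0" "\<bar>h\<bar> < \<delta>" for h
    proof -
      let ?y = "x(i := x i + h)"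
      have y: "?y \<in> tuples N" using x i by (auto simp: tuples_def PiE_def extensional_def)
      have 1: "(\<Sum>j<N. D j * (?y j - x j)) = D i * h"
        using i by (subst sum.remove[of _ i]) auto
      have 2: "norm1 N (\<lambda>j. ?y j - x j) = \<bar>h\<bar>"
        unfolding norm1_def using i by (subst sum.remove[of _ i]) auto
      have "\<bar>g ?y - g x - D i * h\<bar> \<le> \<epsilon> * \<bar>h\<bar>"
        using \<delta>(2)[OF y] h \<delta>(1) unfolding 1 2 by auto
      moreover have "q h - D i = (g ?y - g x - D i * h) / h" using h by (simp add: q_def field_simps)
      ultimately show ?thesis using h by (simp add: abs_divide divide_le_eq)
    qed
    then show ?thesis using \<delta>(1) by blast
  qed
  have ev: "eventually (\<lambda>h. h \<noteq> 0 \<and> \<bar>h\<bar> < \<delta>) (at 0)" if "\<delta> > 0" for \<delta> :: 'a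
    unfolding eventually_at_topological
    by (intro exI[of _ "{-\<delta><..<\<delta>}"]) (use that in \<open>auto simp: abs_less_iff\<close>)
  have "(q \<longlongrightarrow> D i) (at 0)"
  proof (rule order_tendstoI)
    fix a assume "a < D i"
    then obtain \<delta> where \<delta>: "\<delta> > 0" "\<And>h. h \<noteq> 0 \<Longrightarrow> \<bar>h\<bar> < \<delta> \<Longrightarrow> \<bar>q h - D i\<bar> \<le> (D i - a) / 2"
      using near[of "(D i - a) / 2"] by auto
    show "\<forall>\<^sub>F h in at 0. a < q h"
    proof (rule eventually_mono[OF ev[OF \<delta>(1)]])
      fix h :: 'a assume "h \<noteq> 0 \<and> \<bar>h\<bar> < \<delta>"
      then have "\<bar>q h - D i\<bar> \<le> (D i - a) / 2" using \<delta>(2) by blast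
      then have "D i - q h \<le> (D i - a) / 2" by linarith
      also have "\<dots> < D i - a" using \<open>a < D i\<close> by (simp add: field_simps)
      finally show "a < q h" by simp
    qed
  next
    fix a assume "D i < a"
    then obtain \<delta> where \<delta>: "\<delta> > 0" "\<And>h. h \<noteq> 0 \<Longrightarrow> \<bar>h\<bar> < \<delta> \<Longrightarrow> \<bar>q h - D i\<bar> \<le> (a - D i) / 2"
      using near[of "(a - D i) / 2"] by auto
    show "\<forall>\<^sub>F h in at 0. q h < a"
    proof (rule eventually_mono[OF ev[OF \<delta>(1)]])
      fix h :: 'a assume "h \<noteq> 0 \<and> \<bar>h\<bar> < \<delta>"
      then have "\<bar>q h - D i\<bar> \<le> (a - D i) / 2" using \<delta>(2) by blast
      then have "q h - D i \<le> (a - D i) / 2" by linarith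
      also have "\<dots> < a - D i" using \<open>D i < a\<close> by (simp add: field_simps)
      finally show "q h < a" by simp
    qed
  qed
  then show ?thesis
    using tendsto_Lim[OF at_0_nontrivial] x by (simp add: partial_deriv_def q_def[abs_def])
qed

lemma has_grad_const: "has_grad N (\<lambda>x. c) x (\<lambda>_. 0)"
  unfolding has_grad_def by (auto intro!: exI[of _ 1])

lemma has_grad_coord: "i < N \<Longrightarrow> has_grad N (\<lambda>x. x i) x (\<lambda>j. if j = i then 1 else 0)"
  unfolding has_grad_def by (auto intro!: exI[of _ 1] simp: if_distrib[of "\<lambda>c. c * _"] cong: if_cong)

lemma has_grad_add:
  assumes "has_grad N g x D" "has_grad N h x E"
  shows "has_grad N (\<lambda>x. g x + h x) x (\<lambda>i. D i + E i)"
  unfolding has_grad_def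
proof (intro allI impI)
  fix \<epsilon> :: 'a assume "\<epsilon> > 0"
  then have e: "\<epsilon> / 2 > 0" by simp
  obtain \<delta> where \<delta>: "\<delta> > 0" "\<And>y. y \<in> tuples N \<Longrightarrow> close_to N \<delta> x y \<Longrightarrow>
       lin_error N g x D y \<le> \<epsilon> / 2 * dist1 N y x"
    using has_gradD[OF assms(1) e] by blast
  obtain \<delta>' where \<delta>': "\<delta>' > 0" "\<And>y. y \<in> tuples N \<Longrightarrow> close_to N \<delta>' x y \<Longrightarrow>
       lin_error N h x E y \<le> \<epsilon> / 2 * dist1 N y x"
    using has_gradD[OF assms(2) e] by blast
  show "\<exists>\<delta>>0. \<forall>y\<in>tuples N. close_to N \<delta> x y \<longrightarrow>
     \<bar>g y + h y - (g x + h x) - (\<Sum>i<N. (D i + E i) * (y i - x i))\<bar> \<le> \<epsilon> * dist1 N y x"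
  proof (intro exI[of _ "min \<delta> \<delta>'"] conjI ballI impI)
    fix y assume y: "y \<in> tuples N" "close_to N (min \<delta> \<delta>') x y"
    have "(\<Sum>i<N. (D i + E i) * (y i - x i)) = (\<Sum>i<N. D i * (y i - x i)) + (\<Sum>i<N. E i * (y i - x i))"
      by (simp add: distrib_right sum.distrib)
    then have "\<bar>g y + h y - (g x + h x) - (\<Sum>i<N. (D i + E i) * (y i - x i))\<bar> = 
       \<bar>(g y - g x - (\<Sum>i<N. D i * (y i - x i))) + (h y - h x - (\<Sum>i<N. E i * (y i - x i)))\<bar>"
      by simp
    also have "\<dots> \<le> lin_error N g x D y + lin_error N h x E y"
      by (rule abs_triangle_ineq)
    also have "\<dots> \<le> \<epsilon> / 2 * dist1 N y x + \<epsilon> / 2 * dist1 N y x"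
      using y by (intro add_mono \<delta>(2) \<delta>'(2)) auto
    finally show "\<bar>g y + h y - (g x + h x) - (\<Sum>i<N. (D i + E i) * (y i - x i))\<bar> \<le> \<epsilon> * dist1 N y x"
      by (simp add: distrib_right[symmetric])
  qed (use \<delta> \<delta>' in auto)
qed

lemma has_grad_mult:
  assumes g: "has_grad N g x D" and h: "has_grad N h x E"
  shows "has_grad N (\<lambda>x. g x * h x) x (\<lambda>i. D i * h x + g x * E i)"
  unfolding has_grad_def
proof (intro allI impI)
  fix \<epsilon> :: 'a assume "\<epsilon> > 0"
  define C where "C = \<bar>g x\<bar> + \<bar>h x\<bar> + norm1 N D + 1"
  have "C \<ge> 1" unfolding C_def by simp
  then have "C > 0" by (rule less_le_trans[rotated]) simp
  then have e: "\<epsilon> / (3 * C) > 0" using \<open>\<epsilon> > 0\<close> by simp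
  obtain \<delta>1 where \<delta>1: "\<delta>1 > 0" "\<And>y. y \<in> tuples N \<Longrightarrow> close_to N \<delta>1 x y \<Longrightarrow>
       lin_error N g x D y \<le> \<epsilon> / (3 * C) * dist1 N y x"
    using has_gradD[OF g e] by blast
  obtain \<delta>2 where \<delta>2: "\<delta>2 > 0" "\<And>y. y \<in> tuples N \<Longrightarrow> close_to N \<delta>2 x y \<Longrightarrow>
       lin_error N h x E y \<le> \<epsilon> / (3 * C) * dist1 N y x"
    using has_gradD[OF h e] by blast
  obtain \<delta>3 where \<delta>3: "\<delta>3 > 0" "\<And>y. y \<in> tuples N \<Longrightarrow> close_to N \<delta>3 x y \<Longrightarrow>
     \<bar>g y - g x\<bar> \<le> (norm1 N D + 1) * dist1 N y x"
    using has_grad_lipschitz[OF g] by blast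
  obtain \<delta>4 where \<delta>4: "\<delta>4 > 0" "\<And>y. y \<in> tuples N \<Longrightarrow> close_to N \<delta>4 x y \<Longrightarrow> \<bar>h y - h x\<bar> < \<epsilon> / (3 * C)"
    using has_grad_imp_cont[OF h] e unfolding cont_at_def by blast
  define \<delta> where "\<delta> = min (min \<delta>1 \<delta>2) (min \<delta>3 \<delta>4)"
  show "\<exists>\<delta>>0. \<forall>y\<in>tuples N. close_to N \<delta> x y \<longrightarrow>
     \<bar>g y * h y - g x * h x - (\<Sum>i<N. (D i * h x + g x * E i) * (y i - x i))\<bar> \<le> \<epsilon> * dist1 N y x"
  proof (intro exI[of _ \<delta>] conjI ballI impI)
    fix y assume y: "y \<in> tuples N" "close_to N \<delta> x y"
    define n where "n = dist1 N y x"
    have n: "n \<ge> 0" by (simp add: n_def)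
    define a where "a = g y - g x - (\<Sum>i<N. D i * (y i - x i))"
    define b where "b = h y - h x - (\<Sum>i<N. E i * (y i - x i))"
    have a: "\<bar>a\<bar> \<le> \<epsilon> / (3 * C) * n" unfolding a_def n_def using y by (intro \<delta>1(2)) (auto simp: \<delta>_def)
    have b: "\<bar>b\<bar> \<le> \<epsilon> / (3 * C) * n" unfolding b_def n_def using y by (intro \<delta>2(2)) (auto simp: \<delta>_def)
    have c: "\<bar>g y - g x\<bar> \<le> C * n"
    proof -
      have "\<bar>g y - g x\<bar> \<le> (norm1 N D + 1) * n" unfolding n_def using y by (intro \<delta>3(2)) (auto simp: \<delta>_def)
      also have "\<dots> \<le> C * n" using n by (intro mult_right_mono) (auto simp: C_def)
      finally show ?thesis .
    qed
    have d: "\<bar>h y - h x\<bar> \<le> \<epsilon> / (3 * C)"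
      by (rule less_imp_le, rule \<delta>4(2)[OF y(1)]) (use y in \<open>auto simp: \<delta>_def\<close>)
    have C: "\<bar>h x\<bar> \<le> C" "\<bar>g x\<bar> \<le> C" by (simp_all add: C_def)
    have "(\<Sum>i<N. (D i * h x + g x * E i) * (y i - x i)) =
       h x * (\<Sum>i<N. D i * (y i - x i)) + g x * (\<Sum>i<N. E i * (y i - x i))"
      unfolding sum_distrib_left sum.distrib[symmetric] by (intro sum.cong) (auto simp: algebra_simps)
    then have "g y * h y - g x * h x - (\<Sum>i<N. (D i * h x + g x * E i) * (y i - x i)) =
       h x * a + g x * b + (g y - g x) * (h y - h x)"
      by (simp add: a_def b_def algebra_simps)
    also have "\<bar>\<dots>\<bar> \<le> \<bar>h x\<bar> * \<bar>a\<bar> + \<bar>g x\<bar> * \<bar>b\<bar> + \<bar>g y - g x\<bar> * \<bar>h y - h x\<bar>"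
      unfolding abs_mult[symmetric] by linarith
    also have "\<dots> \<le> C * (\<epsilon> / (3 * C) * n) + C * (\<epsilon> / (3 * C) * n) + (C * n) * (\<epsilon> / (3 * C))"
      by (intro add_mono mult_mono a b c d C) (use \<open>C > 0\<close> n e in auto)
    also have "\<dots> = \<epsilon> * n" using \<open>C > 0\<close> by (simp add: field_simps)
    finally show "\<bar>g y * h y - g x * h x - (\<Sum>i<N. (D i * h x + g x * E i) * (y i - x i))\<bar> \<le> \<epsilon> * dist1 N y x"
      by (simp add: n_def)
  qed (use \<delta>1 \<delta>2 \<delta>3 \<delta>4 in \<open>auto simp: \<delta>_def\<close>)
qed

lemma has_grad_cmult: "has_grad N g x D \<Longrightarrow> has_grad N (\<lambda>x. c * g x) x (\<lambda>i. c * D i)"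
  using has_grad_mult[OF has_grad_const[of N c x]] by simp

lemma has_grad_sum:
  "(\<And>k. k \<in> I \<Longrightarrow> has_grad N (g k) x (D k)) \<Longrightarrow> has_grad N (\<lambda>x. \<Sum>k\<in>I. g k x) x (\<lambda>i. \<Sum>k\<in>I. D k i)"
  by (induction I rule: infinite_finite_induct) (auto intro: has_grad_const has_grad_add)

lemma has_grad_cong:
  assumes "has_grad N g x D" "x \<in> tuples N" "\<And>y. y \<in> tuples N \<Longrightarrow> h y = g y" "\<And>i. i < N \<Longrightarrow> E i = D i"
  shows "has_grad N h x E"
proof -
  have "(\<Sum>i<N. E i * (y i - x i)) = (\<Sum>i<N. D i * (y i - x i))" for y
    using assms(4) by (intro sum.cong) auto
  then show ?thesis using assms(1,2,3) unfolding has_grad_def by simp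
qed

lemma has_deriv_along:
  assumes g: "has_grad N g (\<gamma> s) D" and \<gamma>: "\<And>i. i < N \<Longrightarrow> has_deriv (\<lambda>s. \<gamma> s i) (w i) s X"
    and tup: "\<And>s'. s' \<in> X \<Longrightarrow> \<gamma> s' \<in> tuples N"
  shows "has_deriv (\<lambda>s. g (\<gamma> s)) (\<Sum>i<N. D i * w i) s X"
  unfolding has_deriv_def
proof (intro allI impI)
  fix \<epsilon> :: 'a assume "\<epsilon> > 0"
  define C where "C = norm1 N w + of_nat N + 1"
  have "C \<ge> 1" by (simp add: C_def)
  then have "C > 0" by (rule less_le_trans[rotated]) simp
  define \<epsilon>1 where "\<epsilon>1 = \<epsilon> / (2 * C)"
  have \<epsilon>1: "\<epsilon>1 > 0" using \<open>\<epsilon> > 0\<close> \<open>C > 0\<close> by (simp add: \<epsilon>1_def)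
  define K where "K = norm1 N D + 1"
  have "K > 0" unfolding K_def by (simp add: add_nonneg_pos)
  define \<epsilon>2 where "\<epsilon>2 = \<epsilon> / (2 * K)"
  have \<epsilon>2: "\<epsilon>2 > 0" using \<open>\<epsilon> > 0\<close> \<open>K > 0\<close> by (simp add: \<epsilon>2_def)
  obtain \<delta>1 where \<delta>1: "\<delta>1 > 0" "\<And>y. y \<in> tuples N \<Longrightarrow> close_to N \<delta>1 (\<gamma> s) y \<Longrightarrow>
       lin_error N g (\<gamma> s) D y \<le> \<epsilon>1 * dist1 N y (\<gamma> s)"
    using has_gradD[OF g \<epsilon>1] by blast
  have "\<exists>\<delta>>0. \<forall>i<N. \<forall>s'\<in>X. \<bar>s' - s\<bar> < \<delta> \<longrightarrow> \<bar>\<gamma> s' i - \<gamma> s i\<bar> \<le> (\<bar>w i\<bar> + 1) * \<bar>s' - s\<bar>"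
  proof (rule uniform_delta)
    fix i assume "i < N"
    show "\<exists>\<delta>>0. \<forall>s'\<in>X. \<bar>s' - s\<bar> < \<delta> \<longrightarrow> \<bar>\<gamma> s' i - \<gamma> s i\<bar> \<le> (\<bar>w i\<bar> + 1) * \<bar>s' - s\<bar>"
      by (rule has_deriv_lipschitz[OF \<gamma>[OF \<open>i < N\<close>], of 1]) auto
  qed auto
  then obtain \<delta>2 where \<delta>2: "\<delta>2 > 0"
    "\<And>i s'. i < N \<Longrightarrow> s' \<in> X \<Longrightarrow> \<bar>s' - s\<bar> < \<delta>2 \<Longrightarrow> \<bar>\<gamma> s' i - \<gamma> s i\<bar> \<le> (\<bar>w i\<bar> + 1) * \<bar>s' - s\<bar>" by blast
  have "\<exists>\<delta>>0. \<forall>i<N. \<forall>s'\<in>X. \<bar>s' - s\<bar> < \<delta> \<longrightarrow> \<bar>\<gamma> s' i - \<gamma> s i - w i * (s' - s)\<bar> \<le> \<epsilon>2 * \<bar>s' - s\<bar>"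
    by (rule uniform_delta) (use \<gamma> \<epsilon>2 in \<open>auto simp: has_deriv_def\<close>)
  then obtain \<delta>3 where \<delta>3: "\<delta>3 > 0"
    "\<And>i s'. i < N \<Longrightarrow> s' \<in> X \<Longrightarrow> \<bar>s' - s\<bar> < \<delta>3 \<Longrightarrow> \<bar>\<gamma> s' i - \<gamma> s i - w i * (s' - s)\<bar> \<le> \<epsilon>2 * \<bar>s' - s\<bar>" by blast
  define \<delta> where "\<delta> = min (min \<delta>2 \<delta>3) (\<delta>1 / C)"
  have \<delta>: "\<delta> > 0" "\<delta> \<le> \<delta>2" "\<delta> \<le> \<delta>3" "\<delta> \<le> \<delta>1 / C"
    using \<delta>1 \<delta>2 \<delta>3 \<open>C > 0\<close> by (auto simp: \<delta>_def)
  show "\<exists>\<delta>>0. \<forall>s'\<in>X. \<bar>s' - s\<bar> < \<delta> \<longrightarrow> \<bar>g (\<gamma> s') - g (\<gamma> s) - (\<Sum>i<N. D i * w i) * (s' - s)\<bar> \<le> \<epsilon> * \<bar>s' - s\<bar>"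
  proof (intro exI[of _ \<delta>] conjI ballI impI \<delta>(1))
    fix s' assume s': "s' \<in> X" "\<bar>s' - s\<bar> < \<delta>"
    let ?d = "\<bar>s' - s\<bar>"
    have lip: "\<bar>\<gamma> s' i - \<gamma> s i\<bar> \<le> (\<bar>w i\<bar> + 1) * ?d" if "i < N" for i
      using s' \<delta> that by (intro \<delta>2) auto
    have n: "dist1 N (\<gamma> s') (\<gamma> s) \<le> C * ?d"
    proof -
      have "dist1 N (\<gamma> s') (\<gamma> s) \<le> (\<Sum>i<N. (\<bar>w i\<bar> + 1) * ?d)"
        unfolding norm1_def using lip by (intro sum_mono) auto
      also have "\<dots> = (norm1 N w + of_nat N) * ?d"
        by (simp add: norm1_def sum.distrib distrib_right sum_distrib_right)
      also have "\<dots> \<le> C * ?d" by (intro mult_right_mono) (auto simp: C_def)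
      finally show ?thesis .
    qed
    have "?d < \<delta>1 / C" using s'(2) \<delta>(4) by simp
    then have "C * ?d < \<delta>1" using \<open>C > 0\<close> by (simp add: field_simps)
    then have close: "\<bar>\<gamma> s' i - \<gamma> s i\<bar> < \<delta>1" if "i < N" for i
      using abs_le_norm1[OF that, of "\<lambda>i. \<gamma> s' i - \<gamma> s i"] n by simp
    define e where "e i = \<gamma> s' i - \<gamma> s i - w i * (s' - s)" for i
    have e: "\<bar>e i\<bar> \<le> \<epsilon>2 * ?d" if "i < N" for i
      unfolding e_def using s' \<delta> that by (intro \<delta>3) auto
    have "(\<Sum>i<N. D i * (\<gamma> s' i - \<gamma> s i)) = (\<Sum>i<N. D i * w i) * (s' - s) + (\<Sum>i<N. D i * e i)"
      unfolding sum_distrib_right sum.distrib[symmetric]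
      by (intro sum.cong) (auto simp: e_def algebra_simps)
    then have split: "g (\<gamma> s') - g (\<gamma> s) - (\<Sum>i<N. D i * w i) * (s' - s) =
      (g (\<gamma> s') - g (\<gamma> s) - (\<Sum>i<N. D i * (\<gamma> s' i - \<gamma> s i))) + (\<Sum>i<N. D i * e i)" by simp
    have 1: "\<bar>g (\<gamma> s') - g (\<gamma> s) - (\<Sum>i<N. D i * (\<gamma> s' i - \<gamma> s i))\<bar> \<le> \<epsilon>1 * (C * ?d)"
    proof (rule order_trans)
      show "\<bar>g (\<gamma> s') - g (\<gamma> s) - (\<Sum>i<N. D i * (\<gamma> s' i - \<gamma> s i))\<bar> \<le> \<epsilon>1 * dist1 N (\<gamma> s') (\<gamma> s)"
        using close tup s' by (intro \<delta>1) auto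
      show "\<epsilon>1 * dist1 N (\<gamma> s') (\<gamma> s) \<le> \<epsilon>1 * (C * ?d)"
        using n \<epsilon>1 by (intro mult_left_mono) auto
    qed
    have 2: "\<bar>\<Sum>i<N. D i * e i\<bar> \<le> K * (\<epsilon>2 * ?d)"
    proof -
      have "\<bar>\<Sum>i<N. D i * e i\<bar> \<le> (\<Sum>i<N. \<bar>D i\<bar> * (\<epsilon>2 * ?d))"
        using e by (intro order_trans[OF sum_abs] sum_mono) (auto simp: abs_mult intro: mult_left_mono)
      also have "\<dots> = norm1 N D * (\<epsilon>2 * ?d)" by (simp add: norm1_def sum_distrib_right)
      also have "\<dots> \<le> K * (\<epsilon>2 * ?d)" using \<epsilon>2 by (intro mult_right_mono) (auto simp: K_def)
      finally show ?thesis .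
    qed
    have 3: "\<epsilon>1 * (C * ?d) + K * (\<epsilon>2 * ?d) = \<epsilon> * ?d"
      using \<open>C > 0\<close> \<open>K > 0\<close> by (simp add: \<epsilon>1_def \<epsilon>2_def)
    show "\<bar>g (\<gamma> s') - g (\<gamma> s) - (\<Sum>i<N. D i * w i) * (s' - s)\<bar> \<le> \<epsilon> * ?d"
      unfolding split using order_trans[OF abs_triangle_ineq add_mono[OF 1 2]] 3 by simp
  qed
qed

text \<open>The mean value inequality for one variable, along the segment from \<open>x\<close> to \<open>y\<close>.\<close>

lemma mean_value_inequality_box:
  fixes S :: "('f, 'r, 'a :: linordered_field) expansion"
  assumes dc: "definably_complete S" and g: "def_fun S (\<lambda>x. g (restrict x {..<N}))"
    and grad: "\<And>z. z \<in> tuples N \<Longrightarrow> (\<And>i. i < N \<Longrightarrow> \<bar>z i - p i\<bar> \<le> \<rho>) \<Longrightarrow> has_grad N g z (D z)"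
    and bound: "\<And>z i. z \<in> tuples N \<Longrightarrow> (\<And>i. i < N \<Longrightarrow> \<bar>z i - p i\<bar> \<le> \<rho>) \<Longrightarrow> i < N \<Longrightarrow> \<bar>D z i\<bar> \<le> K"
    and x: "x \<in> tuples N" "\<And>i. i < N \<Longrightarrow> \<bar>x i - p i\<bar> \<le> \<rho>"
    and y: "y \<in> tuples N" "\<And>i. i < N \<Longrightarrow> \<bar>y i - p i\<bar> \<le> \<rho>"
  shows "\<bar>g y - g x\<bar> \<le> K * dist1 N y x"
proof -
  define \<gamma> where "\<gamma> s = restrict (\<lambda>i. x i + s * (y i - x i)) {..<N}" for s
  have tup: "\<gamma> s \<in> tuples N" for s by (simp add: \<gamma>_def tuples_def)
  have ends: "\<gamma> 0 = x" "\<gamma> 1 = y"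
    using x(1) y(1) by (auto simp: \<gamma>_def tuples_def fun_eq_iff PiE_def extensional_def)
  have box: "\<bar>\<gamma> s i - p i\<bar> \<le> \<rho>" if "0 \<le> s" "s \<le> 1" "i < N" for s i
  proof -
    have "\<gamma> s i - p i = (1 - s) * (x i - p i) + s * (y i - p i)"
      using that by (simp add: \<gamma>_def algebra_simps)
    also have "\<bar>\<dots>\<bar> \<le> (1 - s) * \<bar>x i - p i\<bar> + s * \<bar>y i - p i\<bar>"
      using that by (intro order_trans[OF abs_triangle_ineq]) (simp add: abs_mult)
    also have "\<dots> \<le> (1 - s) * \<rho> + s * \<rho>"
      using that x(2) y(2) by (intro add_mono mult_left_mono) auto
    finally show ?thesis by (simp add: algebra_simps)
  qed
  have "\<bar>g (\<gamma> 1) - g (\<gamma> 0)\<bar> \<le> (K * dist1 N y x) * (1 - 0)"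
  proof (rule mean_value_inequality[OF dc, where \<phi> = "\<lambda>s. g (\<gamma> s)" and d = "\<lambda>s. \<Sum>i<N. D (\<gamma> s) i * (y i - x i)"])
    show "def_fun S (\<lambda>x. g (\<gamma> (x 0)))"
      unfolding \<gamma>_def by (intro def_fun_comp[OF g] def_intros)
  next
    fix s :: 'a assume s: "0 \<le> s" "s \<le> 1"
    show "has_deriv (\<lambda>s. g (\<gamma> s)) (\<Sum>i<N. D (\<gamma> s) i * (y i - x i)) s {0..1}"
    proof (rule has_deriv_along[where N = N and g = g and \<gamma> = \<gamma> and D = "D (\<gamma> s)" and w = "\<lambda>i. y i - x i"])
      show "has_grad N g (\<gamma> s) (D (\<gamma> s))" using tup box s by (intro grad) auto
      fix i assume "i < N"
      then show "has_deriv (\<lambda>s. \<gamma> s i) (y i - x i) s {0..1}"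
        by (auto simp: has_deriv_def \<gamma>_def algebra_simps intro!: exI[of _ 1])
    qed (rule tup)
    have "\<bar>\<Sum>i<N. D (\<gamma> s) i * (y i - x i)\<bar> \<le> (\<Sum>i<N. K * \<bar>y i - x i\<bar>)"
      using bound[OF tup, of s] box[OF s]
      by (intro order_trans[OF sum_abs] sum_mono) (auto simp: abs_mult intro: mult_right_mono)
    then show "\<bar>\<Sum>i<N. D (\<gamma> s) i * (y i - x i)\<bar> \<le> K * dist1 N y x"
      by (simp add: norm1_def sum_distrib_left)
  qed auto
  then show ?thesis by (simp add: ends)
qed

lemma has_deriv_cong:
  assumes "has_deriv \<phi> d s X" "s \<in> X" "\<And>s'. s' \<in> X \<Longrightarrow> \<psi> s' = \<phi> s'"
  shows "has_deriv \<psi> d s X"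
  using assms unfolding has_deriv_def by simp

text \<open>The chain rule for the linear form \<open>a x + b y\<close> along the plane curve \<open>(\<phi>, \<psi>)\<close>.\<close>

lemma has_deriv_lincomb:
  assumes "has_deriv \<phi> d s X" "has_deriv \<psi> e s X"
  shows "has_deriv (\<lambda>s. a * \<phi> s + b * \<psi> s) (a * d + b * e) s X"
proof -
  let ?\<gamma> = "\<lambda>s. (\<lambda>i\<in>{..<2::nat}. if i = 0 then \<phi> s else \<psi> s)"
  have grad: "has_grad 2 (\<lambda>x. a * x 0 + b * x 1) (?\<gamma> s)
      (\<lambda>i. a * (if i = 0 then 1 else 0) + b * (if i = 1 then 1 else 0))"
    by (intro has_grad_add has_grad_cmult has_grad_coord) simp_all
  have "has_deriv (\<lambda>s. (\<lambda>x. a * x 0 + b * x 1) (?\<gamma> s)) (\<Sum>i<2::nat. (a * (if i = 0 then 1 else 0) +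
      b * (if i = 1 then 1 else 0)) * (if i = 0 then d else e)) s X"
    by (rule has_deriv_along[where g = "\<lambda>x. a * x 0 + b * x 1" and \<gamma> = ?\<gamma>, OF grad]) (use assms in \<open>auto simp: tuples_def\<close>)
  then show ?thesis by (simp add: numeral_2_eq_2)
qed

lemma has_deriv_nonneg_at_min:
  fixes \<phi> :: "'a :: linordered_field \<Rightarrow> 'a"
  assumes "has_deriv \<phi> d 0 {0..1}" "\<eta> > 0" "\<And>s. 0 \<le> s \<Longrightarrow> s \<le> 1 \<Longrightarrow> s < \<eta> \<Longrightarrow> \<phi> 0 \<le> \<phi> s"
  shows "d \<ge> 0"
proof (rule ccontr)
  assume "\<not> d \<ge> 0"
  then have "- d / 2 > 0" by simp
  then obtain \<delta> where \<delta>: "\<delta> > 0" "\<forall>s\<in>{0..1}. \<bar>s - 0\<bar> < \<delta> \<longrightarrow> \<bar>\<phi> s - \<phi> 0 - d * (s - 0)\<bar> \<le> - d / 2 * \<bar>s - 0\<bar>"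
    using assms(1) unfolding has_deriv_def by blast
  define s where "s = min 1 (min (\<delta> / 2) (\<eta> / 2))"
  have s: "0 < s" "s \<le> 1" "s < \<delta>" "s < \<eta>"
    using \<delta>(1) assms(2) by (auto simp: s_def min_less_iff_disj)
  have "\<bar>\<phi> s - \<phi> 0 - d * s\<bar> \<le> - d / 2 * s" using \<delta>(2) s by auto
  moreover have "\<phi> 0 \<le> \<phi> s" using assms(3) s by auto
  ultimately have "- (d * s) \<le> - d / 2 * s" by linarith
  then show False using s(1) \<open>\<not> d \<ge> 0\<close> by (simp add: field_simps)
qed

section \<open>The inverse function theorem\<close>

definition cube :: "nat \<Rightarrow> (nat \<Rightarrow> 'a :: linordered_field) \<Rightarrow> 'a \<Rightarrow> (nat \<Rightarrow> 'a) set" where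
  "cube N p \<rho> = {x \<in> tuples N. \<forall>i<N. \<bar>x i - p i\<bar> \<le> \<rho>}"

lemma norm1_cong: "(\<And>i. i < N \<Longrightarrow> u i = v i) \<Longrightarrow> norm1 N u = norm1 N v"
  by (simp add: norm1_def)

lemma norm1_minus: "dist1 N u v = dist1 N v u"
  by (simp add: norm1_def abs_minus_commute)

lemma norm1_triangle_diff: "dist1 N u w \<le> dist1 N u v + dist1 N v w"
  using norm1_triangle[of N "\<lambda>i. u i - v i" "\<lambda>i. v i - w i"] by simp

lemma norm1_diff: "\<bar>norm1 N u - norm1 N v\<bar> \<le> dist1 N u v"
  using norm1_triangle[of N "\<lambda>i. u i - v i" v] norm1_triangle[of N "\<lambda>i. v i - u i" u]
  by (simp add: norm1_minus[of N u v] abs_le_iff)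

lemma norm1_eq_0: "norm1 N v = 0 \<longleftrightarrow> (\<forall>i<N. v i = 0)"
  by (auto simp: norm1_def sum_nonneg_eq_0_iff)

lemma tuples_eqI: "x \<in> tuples N \<Longrightarrow> y \<in> tuples N \<Longrightarrow> (\<And>i. i < N \<Longrightarrow> x i = y i) \<Longrightarrow> x = y"
  unfolding tuples_def by (rule PiE_ext) auto

lemma restrict_tuple [simp]: "x \<in> tuples N \<Longrightarrow> restrict x {..<N} = x"
  unfolding tuples_def by (simp add: PiE_restrict)

lemma restrict_in_tuples [simp]: "restrict x {..<N} \<in> tuples N"
  by (simp add: tuples_def)

lemma near_identity_lipschitz:
  assumes "norm1 N (\<lambda>l. \<Psi> l x - \<Psi> l x' - (x l - x' l)) \<le> dist1 N x x' / 2"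
  shows "dist1 N x x' \<le> 2 * norm1 N (\<lambda>l. \<Psi> l x - \<Psi> l x')"
    and "norm1 N (\<lambda>l. \<Psi> l x - \<Psi> l x') \<le> 2 * dist1 N x x'"
proof -
  have "dist1 N x x' - norm1 N (\<lambda>l. \<Psi> l x - \<Psi> l x') \<le> dist1 N x x' / 2"
    using norm1_triangle[of N "\<lambda>l. \<Psi> l x - \<Psi> l x'" "\<lambda>l. (x l - x' l) - (\<Psi> l x - \<Psi> l x')"] assms
      norm1_minus[of N "\<lambda>l. x l - x' l" "\<lambda>l. \<Psi> l x - \<Psi> l x'"] by simp
  then show "dist1 N x x' \<le> 2 * norm1 N (\<lambda>l. \<Psi> l x - \<Psi> l x')"
    by (simp add: field_simps)
  have "norm1 N (\<lambda>l. \<Psi> l x - \<Psi> l x') \<le> dist1 N x x' / 2 + dist1 N x x'"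
    using norm1_triangle[of N "\<lambda>l. \<Psi> l x - \<Psi> l x' - (x l - x' l)" "\<lambda>l. x l - x' l"] assms by simp
  also have "\<dots> \<le> 2 * dist1 N x x'"
    using norm1_nonneg[of N "\<lambda>l. x l - x' l"] by (simp add: field_simps)
  finally show "norm1 N (\<lambda>l. \<Psi> l x - \<Psi> l x') \<le> 2 * dist1 N x x'" .
qed

text \<open>Minimise \<open>\<nu>\<close>, the distance from \<open>\<Psi> x\<close> to the target \<open>y\<close>, over the cube. The starting value is so small that the
  minimum lies in the interior. If it were positive, then a small step from \<open>x\<close> against \<open>\<Psi> x - y\<close>
  would decrease it, because \<open>\<Psi>\<close> moves almost like the identity.\<close>

lemma near_identity_surj:
  fixes S :: "('f, 'r, 'a :: linordered_field) expansion"
  assumes dc: "definably_complete S" and "\<rho> > 0" and p: "p \<in> tuples N"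
    and def: "\<And>l. l < N \<Longrightarrow> def_fun S (\<lambda>x. \<Psi> l (restrict x {..<N}))"
    and near: "\<And>x x'. x \<in> cube N p \<rho> \<Longrightarrow> x' \<in> cube N p \<rho> \<Longrightarrow>
      norm1 N (\<lambda>l. \<Psi> l x - \<Psi> l x' - (x l - x' l)) \<le> dist1 N x x' / 2"
    and y: "norm1 N (\<lambda>l. \<Psi> l p - y l) < \<rho> / 4"
  shows "\<exists>x \<in> cube N p \<rho>. \<forall>l<N. \<Psi> l x = y l"
proof -
  let ?Q = "cube N p \<rho>"
  define \<nu> where "\<nu> x = norm1 N (\<lambda>l. \<Psi> l x - y l)" for x
  have pQ: "p \<in> ?Q" using p \<open>\<rho> > 0\<close> by (simp add: cube_def)
  have lip: "\<bar>\<nu> z - \<nu> x\<bar> \<le> 2 * dist1 N z x" if "x \<in> ?Q" "z \<in> ?Q" for x z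
  proof -
    have "\<bar>\<nu> z - \<nu> x\<bar> \<le> norm1 N (\<lambda>l. \<Psi> l z - \<Psi> l x)"
      unfolding \<nu>_def using norm1_diff[of N "\<lambda>l. \<Psi> l z - y l" "\<lambda>l. \<Psi> l x - y l"] by simp
    then show ?thesis using near_identity_lipschitz(2)[OF near[OF that(2,1)]] by simp
  qed
  have "\<exists>x\<in>?Q. \<forall>z\<in>?Q. \<nu> x \<le> \<nu> z"
  proof (rule min_attained[OF dc])
    have "def_pred S (\<lambda>x. \<forall>i<N. \<bar>restrict x {..<N} i - p i\<bar> \<le> \<rho>)"
      by (intro def_intros)
    then show "def_pred S (\<lambda>x. restrict x {..<N} \<in> ?Q)"
      by (simp add: cube_def)
    show "def_fun S (\<lambda>x. \<nu> (restrict x {..<N}))"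
      unfolding \<nu>_def norm1_def by (intro def_intros def) auto
    show "?Q \<subseteq> tuples N" "?Q \<noteq> {}" using pQ by (auto simp: cube_def)
    fix x assume x: "x \<in> ?Q"
    let ?L = "\<rho> + norm1 N p + (\<nu> p + 2 * (of_nat N * \<rho>))"
    have pos: "0 \<le> \<nu> p" "0 \<le> of_nat N * \<rho>" "0 \<le> norm1 N p" using \<open>\<rho> > 0\<close> by (auto simp: \<nu>_def)
    show "\<bar>x j\<bar> \<le> ?L" if "j < N" for j
    proof -
      have "\<bar>x j\<bar> \<le> \<bar>x j - p j\<bar> + \<bar>p j\<bar>" by linarith
      also have "\<dots> \<le> \<rho> + norm1 N p" using x that by (intro add_mono abs_le_norm1) (auto simp: cube_def)
      finally show ?thesis using pos by simp
    qed
    have "dist1 N x p \<le> of_nat N * \<rho>" by (rule norm1_le) (use x in \<open>auto simp: cube_def\<close>)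
    then have "\<bar>\<nu> x - \<nu> p\<bar> \<le> 2 * (of_nat N * \<rho>)" using lip[OF pQ x] by simp
    then have "\<bar>\<nu> x\<bar> \<le> \<nu> p + 2 * (of_nat N * \<rho>)" using pos by linarith
    then show "\<bar>\<nu> x\<bar> \<le> ?L" using pos \<open>\<rho> > 0\<close> by linarith
    fix \<epsilon> :: 'a assume "\<epsilon> > 0"
    have N1: "(0::'a) < 2 * of_nat N + 1" by (simp add: add_nonneg_pos)
    show "\<exists>\<delta>>0. \<forall>z\<in>?Q. close_to N \<delta> x z \<longrightarrow> \<bar>\<nu> z - \<nu> x\<bar> < \<epsilon>"
    proof (intro exI[of _ "\<epsilon> / (2 * of_nat N + 1)"] conjI ballI impI)
      fix z assume z: "z \<in> ?Q" "\<forall>i<N. \<bar>z i - x i\<bar> < \<epsilon> / (2 * of_nat N + 1)"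
      have "dist1 N z x \<le> of_nat N * (\<epsilon> / (2 * of_nat N + 1))"
        by (rule norm1_le) (use z in auto)
      then have "\<bar>\<nu> z - \<nu> x\<bar> \<le> 2 * (of_nat N * (\<epsilon> / (2 * of_nat N + 1)))" using lip[OF x z(1)] by simp
      also have "\<dots> < \<epsilon>" using N1 \<open>\<epsilon> > 0\<close> by (simp add: field_simps)
      finally show "\<bar>\<nu> z - \<nu> x\<bar> < \<epsilon>" .
    qed (use N1 \<open>\<epsilon> > 0\<close> in auto)
  next
    fix x :: "nat \<Rightarrow> 'a" assume x: "x \<in> tuples N" "\<And>\<epsilon>. \<epsilon> > 0 \<Longrightarrow> \<exists>z\<in>?Q. close_to N \<epsilon> x z"
    have "\<bar>x i - p i\<bar> \<le> \<rho>" if "i < N" for i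
    proof (rule field_le_epsilon)
      fix e :: 'a assume "e > 0"
      then obtain z where "z \<in> ?Q" "\<bar>z i - x i\<bar> < e" using x(2)[of e] \<open>i < N\<close> by blast
      then have "\<bar>z i - p i\<bar> \<le> \<rho>" "\<bar>z i - x i\<bar> < e" using \<open>i < N\<close> by (auto simp: cube_def)
      then show "\<bar>x i - p i\<bar> \<le> \<rho> + e" by linarith
    qed
    then show "x \<in> ?Q" using x(1) by (simp add: cube_def)
  qed
  then obtain x where x: "x \<in> ?Q" "\<And>z. z \<in> ?Q \<Longrightarrow> \<nu> x \<le> \<nu> z" by blast
  have "dist1 N x p < \<rho>"
  proof -
    have "norm1 N (\<lambda>l. \<Psi> l x - \<Psi> l p) \<le> \<nu> x + \<nu> p"
      unfolding \<nu>_def using norm1_triangle_diff[of N "\<lambda>l. \<Psi> l x" "\<lambda>l. \<Psi> l p" y] norm1_minus[of N y "\<lambda>l. \<Psi> l p"] by simp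
    moreover have "\<nu> x \<le> \<nu> p" "\<nu> p < \<rho> / 4" using x(2)[OF pQ] y by (auto simp: \<nu>_def)
    ultimately have "norm1 N (\<lambda>l. \<Psi> l x - \<Psi> l p) < \<rho> / 4 + \<rho> / 4" by linarith
    then have "2 * norm1 N (\<lambda>l. \<Psi> l x - \<Psi> l p) < \<rho>" by (simp add: field_simps)
    then show ?thesis using near_identity_lipschitz(1)[OF near[OF x(1) pQ]] by simp
  qed
  define m where "m = \<rho> - dist1 N x p"
  have "m > 0" using \<open>dist1 N x p < \<rho>\<close> by (simp add: m_def)
  have "\<nu> x = 0"
  proof (rule ccontr)
    assume "\<nu> x \<noteq> 0"
    then have "\<nu> x > 0" unfolding \<nu>_def using norm1_nonneg[of N "\<lambda>l. \<Psi> l x - y l"] by linarith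
    define \<tau> where "\<tau> = min 1 (m / \<nu> x)"
    have \<tau>: "0 < \<tau>" "\<tau> \<le> 1" "\<tau> * \<nu> x \<le> m"
      using \<open>m > 0\<close> \<open>\<nu> x > 0\<close> by (auto simp: \<tau>_def min_def field_simps)
    define x' where "x' = restrict (\<lambda>l. x l - \<tau> * (\<Psi> l x - y l)) {..<N}"
    have d: "dist1 N x' x = \<tau> * \<nu> x"
    proof -
      have "dist1 N x' x = norm1 N (\<lambda>l. (- \<tau>) * (\<Psi> l x - y l))"
        by (rule norm1_cong) (simp add: x'_def)
      then show ?thesis unfolding norm1_scale using \<tau> by (simp add: \<nu>_def)
    qed
    have "x' \<in> ?Q"
      unfolding cube_def
    proof (intro CollectI conjI allI impI)
      fix i assume i: "i < N"
      have "\<bar>x' i - p i\<bar> \<le> dist1 N x' p" using abs_le_norm1[OF i, of "\<lambda>l. x' l - p l"] .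
      also have "\<dots> \<le> dist1 N x' x + dist1 N x p" by (rule norm1_triangle_diff)
      also have "\<dots> \<le> m + dist1 N x p" using \<tau> by (simp add: d)
      finally show "\<bar>x' i - p i\<bar> \<le> \<rho>" by (simp add: m_def)
    qed (simp add: x'_def)
    have "\<nu> x' = norm1 N (\<lambda>l. (\<Psi> l x' - \<Psi> l x - (x' l - x l)) + (1 - \<tau>) * (\<Psi> l x - y l))"
      unfolding \<nu>_def by (rule norm1_cong) (simp add: x'_def algebra_simps)
    also have "\<dots> \<le> norm1 N (\<lambda>l. \<Psi> l x' - \<Psi> l x - (x' l - x l)) + norm1 N (\<lambda>l. (1 - \<tau>) * (\<Psi> l x - y l))"
      by (rule norm1_triangle)
    also have "\<dots> \<le> (\<tau> * \<nu> x) / 2 + (1 - \<tau>) * \<nu> x"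
      using near[OF \<open>x' \<in> ?Q\<close> x(1)] \<tau> unfolding norm1_scale d by (simp add: \<nu>_def)
    also have "\<dots> < \<nu> x" using \<tau>(1) \<open>\<nu> x > 0\<close> by (simp add: field_simps)
    finally show False using x(2)[OF \<open>x' \<in> ?Q\<close>] by simp
  qed
  then have "\<forall>l<N. \<Psi> l x = y l" by (simp add: \<nu>_def norm1_eq_0)
  then show ?thesis using x(1) by blast
qed

text \<open>Multiplying \<open>F\<close> by the inverse \<open>B\<close> of its Jacobian at \<open>p\<close> gives a map \<open>\<Psi>\<close> with derivative 1 at
  \<open>p\<close>. By continuity of the derivative and the mean value inequality, \<open>\<Psi>\<close> minus the identity
  has Lipschitz constant 1/2 near \<open>p\<close>.\<close>

lemma local_inverse:
  fixes S :: "('f, 'r, 'a :: linordered_field) expansion"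
  assumes dc: "definably_complete S" and "r > 0" and p: "p \<in> tuples N"
    and def: "\<And>k. k < N \<Longrightarrow> def_fun S (\<lambda>x. F k (restrict x {..<N}))"
    and grad: "\<And>k z. k < N \<Longrightarrow> z \<in> tuples N \<Longrightarrow> has_grad N (F k) z (\<lambda>i. J k i z)"
    and cont: "\<And>k i. k < N \<Longrightarrow> i < N \<Longrightarrow> cont_at N (J k i) p"
    and BA: "\<And>l i. l < N \<Longrightarrow> i < N \<Longrightarrow> (\<Sum>k<N. B l k * J k i p) = (if l = i then 1 else 0)"
    and AB: "\<And>k k'. k < N \<Longrightarrow> k' < N \<Longrightarrow> (\<Sum>l<N. J k l p * B l k') = (if k = k' then 1 else 0)"
  obtains \<rho> C \<sigma> where "0 < \<rho>" "\<rho> \<le> r" "0 < C" "0 < \<sigma>"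
    "\<And>x x'. x \<in> cube N p \<rho> \<Longrightarrow> x' \<in> cube N p \<rho> \<Longrightarrow> dist1 N x x' \<le> C * norm1 N (\<lambda>k. F k x - F k x')"
    "\<And>v. (\<And>k. k < N \<Longrightarrow> \<bar>v k\<bar> \<le> \<sigma>) \<Longrightarrow> \<exists>x\<in>cube N p \<rho>. \<forall>k<N. F k x = F k p + v k"
proof -
  define \<Psi> where "\<Psi> l x = (\<Sum>k<N. B l k * F k x)" for l x
  define \<beta> where "\<beta> = (\<Sum>l<N. norm1 N (B l)) + 1"
  have "\<beta> \<ge> 1" by (simp add: \<beta>_def sum_nonneg)
  then have "\<beta> > 0" by (rule less_le_trans[rotated]) simp
  define \<epsilon> where "\<epsilon> = 1 / (2 * \<beta>)"
  have \<epsilon>: "\<epsilon> > 0" "\<beta> * \<epsilon> = 1 / 2" using \<open>\<beta> > 0\<close> by (auto simp: \<epsilon>_def)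
  have "\<exists>\<delta>>0. \<forall>k<N. \<forall>i<N. \<forall>z\<in>tuples N. (\<forall>j<N. \<bar>z j - p j\<bar> < \<delta>) \<longrightarrow> \<bar>J k i z - J k i p\<bar> < \<epsilon>"
  proof (rule uniform_delta)
    fix k assume k: "k < N"
    show "\<exists>\<delta>>0. \<forall>i<N. \<forall>z\<in>tuples N. (\<forall>j<N. \<bar>z j - p j\<bar> < \<delta>) \<longrightarrow> \<bar>J k i z - J k i p\<bar> < \<epsilon>"
    proof (rule uniform_delta)
      fix i assume i: "i < N"
      show "\<exists>\<delta>>0. \<forall>z\<in>tuples N. (\<forall>j<N. \<bar>z j - p j\<bar> < \<delta>) \<longrightarrow> \<bar>J k i z - J k i p\<bar> < \<epsilon>"
        using cont[OF k i] \<epsilon>(1) unfolding cont_at_def by blast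
    qed (meson less_le_trans)
  qed (meson less_le_trans)
  then obtain \<delta> where \<delta>: "\<delta> > 0" "\<And>k i z. k < N \<Longrightarrow> i < N \<Longrightarrow> z \<in> tuples N \<Longrightarrow> (\<And>j. j < N \<Longrightarrow> \<bar>z j - p j\<bar> < \<delta>) \<Longrightarrow> \<bar>J k i z - J k i p\<bar> < \<epsilon>"
    by blast
  define \<rho> where "\<rho> = min r (\<delta> / 2)"
  have \<rho>: "\<rho> > 0" "\<rho> \<le> r" "\<rho> < \<delta>" using \<delta>(1) \<open>r > 0\<close> by (auto simp: \<rho>_def min_less_iff_disj)
  have near: "norm1 N (\<lambda>l. \<Psi> l x - \<Psi> l x' - (x l - x' l)) \<le> dist1 N x x' / 2"
    if x: "x \<in> cube N p \<rho>" and x': "x' \<in> cube N p \<rho>" for x x'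
  proof -
    have "\<bar>\<Psi> l x - \<Psi> l x' - (x l - x' l)\<bar> \<le> (norm1 N (B l) * \<epsilon>) * dist1 N x x'" if l: "l < N" for l
    proof -
      define D where "D z i = (\<Sum>k<N. B l k * J k i z) + (-1) * (if i = l then 1 else 0)" for z i
      have "\<bar>(\<Psi> l x + (-1) * x l) - (\<Psi> l x' + (-1) * x' l)\<bar> \<le> (norm1 N (B l) * \<epsilon>) * dist1 N x x'"
      proof (rule mean_value_inequality_box[OF dc])
        show "def_fun S (\<lambda>x. \<Psi> l (restrict x {..<N}) + (-1) * restrict x {..<N} l)"
          unfolding \<Psi>_def by (intro def_intros def) auto
        fix z assume z: "z \<in> tuples N" "\<And>i. i < N \<Longrightarrow> \<bar>z i - p i\<bar> \<le> \<rho>"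
        show "has_grad N (\<lambda>x. \<Psi> l x + (-1) * x l) z (D z)"
          unfolding \<Psi>_def D_def
          by (intro has_grad_add has_grad_sum has_grad_cmult has_grad_coord grad) (use l z in auto)
        fix i assume i: "i < N"
        have "D z i = (\<Sum>k<N. B l k * (J k i z - J k i p))"
          using BA[OF l i] by (simp add: D_def right_diff_distrib sum_subtractf)
        also have "\<bar>\<dots>\<bar> \<le> (\<Sum>k<N. \<bar>B l k\<bar> * \<epsilon>)"
        proof (intro order_trans[OF sum_abs] sum_mono)
          fix k assume "k \<in> {..<N}"
          then have "\<bar>J k i z - J k i p\<bar> < \<epsilon>" using z \<rho>(3) i by (intro \<delta>(2)) (auto intro: le_less_trans)
          then show "\<bar>B l k * (J k i z - J k i p)\<bar> \<le> \<bar>B l k\<bar> * \<epsilon>"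
            unfolding abs_mult by (intro mult_left_mono) auto
        qed
        finally show "\<bar>D z i\<bar> \<le> norm1 N (B l) * \<epsilon>" by (simp add: norm1_def sum_distrib_right)
      qed (use x x' in \<open>auto simp: cube_def\<close>)
      then show ?thesis by (simp add: algebra_simps)
    qed
    then have "norm1 N (\<lambda>l. \<Psi> l x - \<Psi> l x' - (x l - x' l)) \<le> (\<Sum>l<N. (norm1 N (B l) * \<epsilon>) * dist1 N x x')"
      unfolding norm1_def[of N "\<lambda>l. \<Psi> l x - \<Psi> l x' - (x l - x' l)"] by (intro sum_mono) auto
    also have "\<dots> = ((\<Sum>l<N. norm1 N (B l)) * \<epsilon>) * dist1 N x x'"
      by (simp add: sum_distrib_right)
    also have "\<dots> \<le> (\<beta> * \<epsilon>) * dist1 N x x'"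
      using \<epsilon>(1) by (intro mult_right_mono) (auto simp: \<beta>_def)
    finally show ?thesis by (simp add: \<epsilon>(2))
  qed
  have \<Psi>_lip: "norm1 N (\<lambda>l. \<Sum>k<N. B l k * v k) \<le> \<beta> * norm1 N v" for v
  proof -
    have "norm1 N (\<lambda>l. \<Sum>k<N. B l k * v k) \<le> (\<Sum>l<N. norm1 N (B l) * norm1 N v)"
      unfolding norm1_def[of N "\<lambda>l. \<Sum>k<N. B l k * v k"] by (intro sum_mono abs_sum_mult_le)
    also have "\<dots> = (\<Sum>l<N. norm1 N (B l)) * norm1 N v" by (simp add: sum_distrib_right)
    also have "\<dots> \<le> \<beta> * norm1 N v" by (intro mult_right_mono) (auto simp: \<beta>_def)
    finally show ?thesis .
  qed
  \<comment> \<open>Targets whose coordinates differ from those of \<open>F p\<close> by at most \<open>\<sigma>\<close> satisfy the smallness condition \<open>\<rho> / 4\<close> for \<open>\<Psi>\<close>.\<close>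
  define \<sigma> where "\<sigma> = \<rho> / (8 * \<beta> * (of_nat N + 1))"
  have N1: "(0::'a) < of_nat N + 1" by (simp add: add_nonneg_pos)
  have "\<sigma> > 0" using \<rho>(1) \<open>\<beta> > 0\<close> N1 by (simp add: \<sigma>_def)
  have \<sigma>_eq: "\<beta> * (of_nat N * \<sigma>) < \<rho> / 4"
  proof -
    have "\<beta> * (of_nat N * \<sigma>) \<le> \<beta> * ((of_nat N + 1) * \<sigma>)"
      using \<open>\<sigma> > 0\<close> \<open>\<beta> > 0\<close> by (intro mult_left_mono mult_right_mono) auto
    also have "\<dots> = \<rho> / 8" using \<open>\<beta> > 0\<close> N1 by (simp add: \<sigma>_def)
    also have "\<dots> < \<rho> / 4" using \<rho>(1) by simp
    finally show ?thesis .
  qed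
  show ?thesis
  proof (rule that[of \<rho> "2 * \<beta>" \<sigma>])
    fix x x' assume x: "x \<in> cube N p \<rho>" "x' \<in> cube N p \<rho>"
    have "norm1 N (\<lambda>l. \<Psi> l x - \<Psi> l x') = norm1 N (\<lambda>l. \<Sum>k<N. B l k * (F k x - F k x'))"
      by (simp add: \<Psi>_def right_diff_distrib sum_subtractf)
    then show "dist1 N x x' \<le> 2 * \<beta> * norm1 N (\<lambda>k. F k x - F k x')"
      using near_identity_lipschitz(1)[OF near[OF x]] \<Psi>_lip[of "\<lambda>k. F k x - F k x'"] by simp
  next
    fix v assume v: "\<And>k. k < N \<Longrightarrow> \<bar>v k\<bar> \<le> \<sigma>"
    define y where "y l = (\<Sum>k<N. B l k * (F k p + v k))" for l
    have "\<exists>x\<in>cube N p \<rho>. \<forall>l<N. \<Psi> l x = y l"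
    proof (rule near_identity_surj[OF dc \<rho>(1) p, where \<Psi> = \<Psi>])
      show "def_fun S (\<lambda>x. \<Psi> l (restrict x {..<N}))" if "l < N" for l
        unfolding \<Psi>_def by (intro def_intros def) auto
      have "norm1 N (\<lambda>l. \<Psi> l p - y l) = norm1 N (\<lambda>l. \<Sum>k<N. B l k * (- v k))"
        unfolding \<Psi>_def y_def sum_subtractf[symmetric] by (simp add: algebra_simps)
      also have "\<dots> \<le> \<beta> * norm1 N (\<lambda>k. - v k)" by (rule \<Psi>_lip)
      also have "\<dots> \<le> \<beta> * (of_nat N * \<sigma>)"
        using v \<open>\<beta> > 0\<close> by (intro mult_left_mono norm1_le) auto
      also note \<sigma>_eq
      finally show "norm1 N (\<lambda>l. \<Psi> l p - y l) < \<rho> / 4" .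
    qed (rule near)
    then obtain x where x: "x \<in> cube N p \<rho>" "\<And>l. l < N \<Longrightarrow> \<Psi> l x = y l" by blast
    have inv: "(\<Sum>l<N. J k l p * (\<Sum>k'<N. B l k' * w k')) = w k" if "k < N" for k w
    proof -
      have "(\<Sum>l<N. J k l p * (\<Sum>k'<N. B l k' * w k')) = (\<Sum>k'<N. (\<Sum>l<N. J k l p * B l k') * w k')"
        unfolding sum_distrib_left sum_distrib_right by (subst sum.swap) (simp add: mult.assoc)
      also have "\<dots> = (\<Sum>k'<N. (if k = k' then 1 else 0) * w k')"
        using AB that by (intro sum.cong) auto
      also have "\<dots> = w k" using that by (simp add: if_distrib[of "\<lambda>c. c * _"] cong: if_cong)
      finally show ?thesis .
    qed
    have "F k x = F k p + v k" if "k < N" for k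
    proof -
      have "F k x = (\<Sum>l<N. J k l p * \<Psi> l x)" using inv[OF that, of "\<lambda>k. F k x"] by (simp add: \<Psi>_def)
      also have "\<dots> = (\<Sum>l<N. J k l p * y l)" using x(2) by simp
      also have "\<dots> = F k p + v k" using inv[OF that, of "\<lambda>k. F k p + v k"] by (simp add: y_def)
      finally show ?thesis .
    qed
    then show "\<exists>x\<in>cube N p \<rho>. \<forall>k<N. F k x = F k p + v k" using x(1) by blast
  qed (use \<rho> \<open>\<beta> > 0\<close> \<open>\<sigma> > 0\<close> in auto)
qed

text \<open>The path \<open>\<gamma>\<close> is the preimage under \<open>F\<close>, in a cube on which \<open>F\<close> has a Lipschitz inverse, of the segment from
  \<open>F p\<close> in the direction \<open>v\<close>.\<close>

locale solution_path =
  fixes N :: nat and F :: "nat \<Rightarrow> (nat \<Rightarrow> 'a) \<Rightarrow> 'a :: linordered_field" and p :: "nat \<Rightarrow> 'a" and \<rho> C :: 'a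
    and v :: "nat \<Rightarrow> 'a" and \<gamma> :: "'a \<Rightarrow> nat \<Rightarrow> 'a"
  assumes C: "C > 0"
    and lip: "\<And>x x'. x \<in> cube N p \<rho> \<Longrightarrow> x' \<in> cube N p \<rho> \<Longrightarrow> dist1 N x x' \<le> C * norm1 N (\<lambda>k. F k x - F k x')"
    and cube: "\<And>s. 0 \<le> s \<Longrightarrow> s \<le> 1 \<Longrightarrow> \<gamma> s \<in> cube N p \<rho>"
    and F: "\<And>s k. 0 \<le> s \<Longrightarrow> s \<le> 1 \<Longrightarrow> k < N \<Longrightarrow> F k (\<gamma> s) = F k p + s * v k"
begin

lemma unique: 
  assumes "0 \<le> s" "s \<le> 1" "x \<in> cube N p \<rho>" "\<And>k. k < N \<Longrightarrow> F k x = F k p + s * v k"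
  shows "x = \<gamma> s"
proof -
  have "norm1 N (\<lambda>k. F k x - F k (\<gamma> s)) = 0" using assms F by (simp add: norm1_eq_0)
  then have "dist1 N x (\<gamma> s) = 0"
    using lip[OF assms(3) cube[OF assms(1,2)]] norm1_nonneg[of N "\<lambda>i. x i - \<gamma> s i"] by simp
  then show ?thesis using assms(3) cube[OF assms(1,2)]
    by (intro tuples_eqI[of _ N]) (auto simp: cube_def norm1_eq_0)
qed

lemma deriv:
  assumes s: "0 \<le> s" "s \<le> 1"
    and grad: "\<And>k. k < N \<Longrightarrow> has_grad N (F k) (\<gamma> s) (J k)"
    and inv: "\<And>i j. i < N \<Longrightarrow> j < N \<Longrightarrow> (\<Sum>k<N. B i k * J k j) = (if i = j then 1 else 0)"
    and i: "i < N"
  shows "has_deriv (\<lambda>s. \<gamma> s i) (\<Sum>k<N. B i k * v k) s {0..1}"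
  unfolding has_deriv_def
proof (intro allI impI)
  fix \<epsilon> :: 'a assume "\<epsilon> > 0"
  define V where "V = C * norm1 N v + 1"
  have V: "V > 0" using C by (simp add: V_def add_nonneg_pos)
  define K where "K = norm1 N (B i) + 1"
  have K: "K > 0" by (simp add: K_def add_nonneg_pos)
  define \<epsilon>1 where "\<epsilon>1 = \<epsilon> / (K * V)"
  have \<epsilon>1: "\<epsilon>1 > 0" using \<open>\<epsilon> > 0\<close> K V by (simp add: \<epsilon>1_def)
  have "\<exists>\<delta>>0. \<forall>k<N. \<forall>y\<in>tuples N. close_to N \<delta> (\<gamma> s) y \<longrightarrow> 
     lin_error N (F k) (\<gamma> s) (J k) y \<le> \<epsilon>1 * dist1 N y (\<gamma> s)"
  proof (rule uniform_delta)
    fix k assume "k < N"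
    then show "\<exists>\<delta>>0. \<forall>y\<in>tuples N. close_to N \<delta> (\<gamma> s) y \<longrightarrow> 
     lin_error N (F k) (\<gamma> s) (J k) y \<le> \<epsilon>1 * dist1 N y (\<gamma> s)"
      using grad \<epsilon>1 unfolding has_grad_def by blast
  qed (meson less_le_trans)
  then obtain \<delta> where \<delta>: "\<delta> > 0" "\<And>k y. k < N \<Longrightarrow> y \<in> tuples N \<Longrightarrow> close_to N \<delta> (\<gamma> s) y \<Longrightarrow>
     lin_error N (F k) (\<gamma> s) (J k) y \<le> \<epsilon>1 * dist1 N y (\<gamma> s)" by blast
  show "\<exists>\<delta>>0. \<forall>s'\<in>{0..1}. \<bar>s' - s\<bar> < \<delta> \<longrightarrow> \<bar>\<gamma> s' i - \<gamma> s i - (\<Sum>k<N. B i k * v k) * (s' - s)\<bar> \<le> \<epsilon> * \<bar>s' - s\<bar>"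
  proof (intro exI[of _ "\<delta> / V"] conjI ballI impI)
    fix s' assume s': "s' \<in> {0..1}" "\<bar>s' - s\<bar> < \<delta> / V"
    have Fd: "F k (\<gamma> s') - F k (\<gamma> s) = (s' - s) * v k" if "k < N" for k
      using F[OF _ _ that, of s'] F[OF s that] s' by (simp add: left_diff_distrib)
    have n: "dist1 N (\<gamma> s') (\<gamma> s) \<le> V * \<bar>s' - s\<bar>"
    proof -
      have "dist1 N (\<gamma> s') (\<gamma> s) \<le> C * norm1 N (\<lambda>k. F k (\<gamma> s') - F k (\<gamma> s))"
        using s s' by (intro lip cube) auto
      also have "norm1 N (\<lambda>k. F k (\<gamma> s') - F k (\<gamma> s)) = norm1 N (\<lambda>k. (s' - s) * v k)"
        by (rule norm1_cong) (rule Fd)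
      also have "C * \<dots> = (C * norm1 N v) * \<bar>s' - s\<bar>" unfolding norm1_scale by (simp add: mult_ac)
      also have "\<dots> \<le> V * \<bar>s' - s\<bar>" by (intro mult_right_mono) (auto simp: V_def)
      finally show ?thesis .
    qed
    have "V * \<bar>s' - s\<bar> < \<delta>" using s'(2) V by (simp add: field_simps)
    then have close: "\<bar>\<gamma> s' j - \<gamma> s j\<bar> < \<delta>" if "j < N" for j
      using abs_le_norm1[OF that, of "\<lambda>i. \<gamma> s' i - \<gamma> s i"] n by simp
    define e where "e k = (s' - s) * v k - (\<Sum>j<N. J k j * (\<gamma> s' j - \<gamma> s j))" for k
    have e: "\<bar>e k\<bar> \<le> \<epsilon>1 * (V * \<bar>s' - s\<bar>)" if "k < N" for k
    proof -
      have "\<bar>F k (\<gamma> s') - F k (\<gamma> s) - (\<Sum>i<N. J k i * (\<gamma> s' i - \<gamma> s i))\<bar> \<le> \<epsilon>1 * dist1 N (\<gamma> s') (\<gamma> s)"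
        using that close cube[of s'] s' by (intro \<delta>(2)) (auto simp: cube_def)
      also have "\<dots> \<le> \<epsilon>1 * (V * \<bar>s' - s\<bar>)" using n \<epsilon>1 by (intro mult_left_mono) auto
      finally show ?thesis by (simp add: Fd[OF that] e_def)
    qed
    have "(\<Sum>k<N. B i k * (\<Sum>j<N. J k j * (\<gamma> s' j - \<gamma> s j))) = (\<Sum>j<N. (\<Sum>k<N. B i k * J k j) * (\<gamma> s' j - \<gamma> s j))"
      unfolding sum_distrib_left sum_distrib_right by (subst sum.swap) (simp add: mult.assoc)
    also have "\<dots> = (\<Sum>j<N. (if i = j then 1 else 0) * (\<gamma> s' j - \<gamma> s j))"
      using inv i by (intro sum.cong) auto
    also have "\<dots> = \<gamma> s' i - \<gamma> s i" using i by (simp add: if_distrib[of "\<lambda>c. c * _"] cong: if_cong)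
    finally have *: "(\<Sum>k<N. B i k * (\<Sum>j<N. J k j * (\<gamma> s' j - \<gamma> s j))) = \<gamma> s' i - \<gamma> s i" .
    have "(\<Sum>k<N. B i k * e k) = (\<Sum>k<N. B i k * v k) * (s' - s) - (\<gamma> s' i - \<gamma> s i)"
      unfolding e_def right_diff_distrib[of "B i _"] sum_subtractf * sum_distrib_right by (simp add: mult_ac)
    then have "\<bar>\<gamma> s' i - \<gamma> s i - (\<Sum>k<N. B i k * v k) * (s' - s)\<bar> = \<bar>\<Sum>k<N. B i k * e k\<bar>"
      by (simp add: abs_minus_commute)
    also have "\<dots> \<le> (\<Sum>k<N. \<bar>B i k\<bar> * (\<epsilon>1 * (V * \<bar>s' - s\<bar>)))"
      using e by (intro order_trans[OF sum_abs] sum_mono) (auto simp: abs_mult intro: mult_left_mono)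
    also have "\<dots> = norm1 N (B i) * (\<epsilon>1 * (V * \<bar>s' - s\<bar>))" by (simp add: norm1_def sum_distrib_right)
    also have "\<dots> \<le> K * (\<epsilon>1 * (V * \<bar>s' - s\<bar>))" using \<epsilon>1 V by (intro mult_right_mono) (auto simp: K_def)
    also have "\<dots> = \<epsilon> * \<bar>s' - s\<bar>" using K V by (simp add: \<epsilon>1_def)
    finally show "\<bar>\<gamma> s' i - \<gamma> s i - (\<Sum>k<N. B i k * v k) * (s' - s)\<bar> \<le> \<epsilon> * \<bar>s' - s\<bar>" .
  qed (use \<delta>(1) V in auto)
qed

text \<open>As \<open>\<gamma> s\<close> is the only solution of its equations in the cube, the path is definable in every
  structure in which \<open>F\<close> is, at least on a set \<open>B\<close> that contains the cube. This applies to the given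
  structure and to its reduct.\<close>

lemma def_fun_along:
  fixes T :: "('f, 'r, 'a) expansion"
  assumes B: "cube N p \<rho> \<subseteq> B"
    and F_def: "\<And>k. k < N \<Longrightarrow> def_fun T (\<lambda>x. cutoff B (F k) (restrict x {..<N}))"
    and u: "def_fun T (\<lambda>x. cutoff B u (restrict x {..<N}))"
  shows "def_fun T (\<lambda>x. if 0 \<le> x 0 \<and> x 0 \<le> 1 then u (\<gamma> (x 0)) else 0)"
  unfolding def_fun_def
proof (rule def_pred_cong)
  show "def_pred T (\<lambda>z. (0 \<le> z 1 \<and> z 1 \<le> 1 \<and> (\<exists>x\<in>tuples N. (\<forall>i<N. \<bar>x i - p i\<bar> \<le> \<rho>) \<and>
     (\<forall>k<N. cutoff B (F k) x = F k p + z 1 * v k) \<and> z 0 = cutoff B u x)) \<or> (\<not> (0 \<le> z 1 \<and> z 1 \<le> 1) \<and> z 0 = 0))"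
    by (intro def_intros F_def u)
next
  fix z :: "nat \<Rightarrow> 'a"
  show "z 0 = (if 0 \<le> z (Suc 0) \<and> z (Suc 0) \<le> 1 then u (\<gamma> (z (Suc 0))) else 0) \<longleftrightarrow>
    ((0 \<le> z 1 \<and> z 1 \<le> 1 \<and> (\<exists>x\<in>tuples N. (\<forall>i<N. \<bar>x i - p i\<bar> \<le> \<rho>) \<and>
     (\<forall>k<N. cutoff B (F k) x = F k p + z 1 * v k) \<and> z 0 = cutoff B u x)) \<or> (\<not> (0 \<le> z 1 \<and> z 1 \<le> 1) \<and> z 0 = 0))"
  proof (cases "0 \<le> z 1 \<and> z 1 \<le> 1")
    case True
    have "(\<exists>x\<in>tuples N. (\<forall>i<N. \<bar>x i - p i\<bar> \<le> \<rho>) \<and>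
     (\<forall>k<N. cutoff B (F k) x = F k p + z 1 * v k) \<and> z 0 = cutoff B u x) \<longleftrightarrow> z 0 = u (\<gamma> (z 1))" (is "?L \<longleftrightarrow> ?R")
    proof
      assume ?L
      then obtain x where x: "x \<in> cube N p \<rho>" "\<forall>k<N. cutoff B (F k) x = F k p + z 1 * v k" "z 0 = cutoff B u x"
        unfolding cube_def by blast
      then have "x \<in> B" using B by blast
      then have "x = \<gamma> (z 1)" using x True by (intro unique) (auto simp: cutoff_def)
      then show ?R using x(3) \<open>x \<in> B\<close> by (simp add: cutoff_def)
    next
      assume ?R
      have "\<gamma> (z 1) \<in> cube N p \<rho>" using cube True by blast
      moreover from this have "\<gamma> (z 1) \<in> B" using B by blast
      ultimately show ?L using \<open>?R\<close> F True by (intro bexI[of _ "\<gamma> (z 1)"]) (auto simp: cutoff_def cube_def)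
    qed
    then show ?thesis using True by simp
  qed auto
qed

end

section \<open>The rings of functions\<close>

definition is_inverse :: "nat \<Rightarrow> (nat \<Rightarrow> nat \<Rightarrow> 'a :: field) \<Rightarrow> (nat \<Rightarrow> nat \<Rightarrow> 'a) \<Rightarrow> bool" where
  "is_inverse N A B \<longleftrightarrow> (\<forall>i<N. \<forall>j<N. (\<Sum>k<N. A i k * B k j) = (if i = j then 1 else 0) \<and>
     (\<Sum>k<N. B i k * A k j) = (if i = j then 1 else 0))"

lemma mult_mat_index:
  "i < N \<Longrightarrow> j < N \<Longrightarrow> (Matrix.mat N N (\<lambda>(i, j). A i j) * Matrix.mat N N (\<lambda>(i, j). B i j)) $$ (i, j) = (\<Sum>k<N. A i k * B k j)"
  by (auto simp: scalar_prod_def lessThan_atLeast0)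

lemma right_inverse_imp_inverse:
  fixes A B :: "nat \<Rightarrow> nat \<Rightarrow> 'a :: field"
  assumes "\<And>i j. i < N \<Longrightarrow> j < N \<Longrightarrow> (\<Sum>k<N. A i k * B k j) = (if i = j then 1 else 0)"
  shows "is_inverse N A B"
proof -
  let ?A = "Matrix.mat N N (\<lambda>(i, j). A i j)" and ?B = "Matrix.mat N N (\<lambda>(i, j). B i j)"
  have "?A * ?B = 1\<^sub>m N"
    by (rule eq_matI) (simp_all add: mult_mat_index assms del: index_mult_mat(1))
  then have "?B * ?A = 1\<^sub>m N" by (rule mat_mult_left_right_inverse[rotated 2]) auto
  then have "(?B * ?A) $$ (i, j) = (if i = j then 1 else 0)" if "i < N" "j < N" for i j
    using that by simp
  then show ?thesis using assms by (simp add: is_inverse_def mult_mat_index del: index_mult_mat(1))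
qed

text \<open>The coefficient of the old row \<open>k0\<close> in the expansion of the new row \<open>r\<close> in terms of the rows of \<open>A\<close> is
  \<open>\<Sum>i<N. r i * B i k0\<close>. As it is not zero, the exchange preserves invertibility.\<close>

lemma inverse_replace_row:
  fixes A B :: "nat \<Rightarrow> nat \<Rightarrow> 'a :: field"
  assumes inv: "is_inverse N A B" and k0: "k0 < N" and c: "(\<Sum>i<N. r i * B i k0) \<noteq> 0"
  shows "\<exists>B'. is_inverse N (A(k0 := r)) B'"
proof -
  define a where "a k = (\<Sum>i<N. r i * B i k)" for k
  \<comment> \<open>Column operations on \<open>B\<close> that turn the row \<open>a = r B\<close> into the unit vector \<open>k0\<close>.\<close>
  define B' where "B' i k = (if k = k0 then B i k0 / a k0 else B i k - B i k0 * (a k / a k0))" for i k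
  have AB: "(\<Sum>i<N. A l i * B i k) = (if l = k then 1 else 0)" if "l < N" "k < N" for l k
    using inv that by (simp add: is_inverse_def)
  have split: "(\<Sum>i<N. z i * B' i k) = (if k = k0 then (\<Sum>i<N. z i * B i k0) / a k0
     else (\<Sum>i<N. z i * B i k) - (\<Sum>i<N. z i * B i k0) * (a k / a k0))" for z k
    by (simp add: B'_def sum_divide_distrib sum_distrib_right right_diff_distrib sum_subtractf mult.assoc)
  have "is_inverse N (A(k0 := r)) B'"
  proof (rule right_inverse_imp_inverse)
    fix l k assume "l < N" "k < N"
    then show "(\<Sum>i<N. (A(k0 := r)) l i * B' i k) = (if l = k then 1 else 0)"
      using c k0 by (auto simp: split AB a_def[symmetric])
  qed
  then show ?thesis by blast
qed

lemma has_grad_more_vars: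
  assumes "has_grad N g (restrict x {..<N}) D" "x \<in> tuples (Suc N)"
  shows "has_grad (Suc N) (more_vars N (Suc N) g) x (\<lambda>i. if i < N then D i else 0)"
  unfolding has_grad_def
proof (intro allI impI)
  fix \<epsilon> :: 'a assume "\<epsilon> > 0"
  then obtain \<delta> where \<delta>: "\<delta> > 0" "\<And>y. y \<in> tuples N \<Longrightarrow> (\<And>i. i < N \<Longrightarrow> \<bar>y i - restrict x {..<N} i\<bar> < \<delta>) \<Longrightarrow>
     lin_error N g (restrict x {..<N}) D y \<le> \<epsilon> * dist1 N y (restrict x {..<N})"
    using has_gradD[OF assms(1)] by blast
  show "\<exists>\<delta>>0. \<forall>y\<in>tuples (Suc N). (\<forall>i<Suc N. \<bar>y i - x i\<bar> < \<delta>) \<longrightarrow>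
      \<bar>more_vars N (Suc N) g y - more_vars N (Suc N) g x - (\<Sum>i<Suc N. (if i < N then D i else 0) * (y i - x i))\<bar>
       \<le> \<epsilon> * norm1 (Suc N) (\<lambda>i. y i - x i)"
  proof (intro exI[of _ \<delta>] conjI ballI impI \<delta>(1))
    fix y assume y: "y \<in> tuples (Suc N)" "\<forall>i<Suc N. \<bar>y i - x i\<bar> < \<delta>"
    have 1: "(\<Sum>i<N. D i * (restrict y {..<N} i - restrict x {..<N} i)) = (\<Sum>i<Suc N. (if i < N then D i else 0) * (y i - x i))"
      by simp
    have "dist1 N (restrict y {..<N}) (restrict x {..<N}) \<le> norm1 (Suc N) (\<lambda>i. y i - x i)"
      by (simp add: norm1_def)
    then have 2: "\<epsilon> * dist1 N (restrict y {..<N}) (restrict x {..<N}) \<le> \<epsilon> * norm1 (Suc N) (\<lambda>i. y i - x i)"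
      using \<open>\<epsilon> > 0\<close> by (intro mult_left_mono) auto
    have "\<bar>g (restrict y {..<N}) - g (restrict x {..<N}) - (\<Sum>i<N. D i * (restrict y {..<N} i - restrict x {..<N} i))\<bar> \<le> \<epsilon> * dist1 N (restrict y {..<N}) (restrict x {..<N})"
      by (rule \<delta>(2)) (use y in auto)
    then show "\<bar>more_vars N (Suc N) g y - more_vars N (Suc N) g x - (\<Sum>i<Suc N. (if i < N then D i else 0) * (y i - x i))\<bar>
       \<le> \<epsilon> * norm1 (Suc N) (\<lambda>i. y i - x i)"
      using 2 y(1) assms(2) unfolding 1 more_vars_def by simp
  qed
qed

lemma closure_subset_tuples: "tuple_topology N closure_of B \<subseteq> tuples N"
  using closure_of_subset_topspace[of "tuple_topology N" B] by (simp add: tuple_topology_def tuples_def)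

abbreviation pd :: "nat \<Rightarrow> nat \<Rightarrow> ((nat \<Rightarrow> 'a :: {linordered_field, linorder_topology}) \<Rightarrow> 'a) \<Rightarrow> (nat \<Rightarrow> 'a) \<Rightarrow> 'a" where
  "pd N \<equiv> partial_deriv (tuples N)"

locale tame_ring_setting =
  fixes S S0 :: "('f, 'r, 'a :: {linordered_field, linorder_topology}) expansion"
    and R :: "nat \<Rightarrow> ((nat \<Rightarrow> 'a) \<Rightarrow> 'a) set"
  assumes dc: "definably_complete S" and pb: "polynomially_bounded S0" and rings: "tame_rings S S0 R"
begin

text \<open>Elements of \<open>R N\<close> are extensional. This predicate ignores values outside \<open>tuples N\<close> and so can be proved
  for functions in ordinary notation.\<close>

definition in_ring :: "nat \<Rightarrow> ((nat \<Rightarrow> 'a) \<Rightarrow> 'a) \<Rightarrow> bool" where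
  "in_ring N g \<longleftrightarrow> restrict g (tuples N) \<in> R N"

lemma subalgebra: "N \<ge> 1 \<Longrightarrow> rat_subalgebra N (R N)"
  using rings by (simp add: tame_rings_def)

lemma ring_extensional: "N \<ge> 1 \<Longrightarrow> g \<in> R N \<Longrightarrow> g \<in> extensional (tuples N)"
  using subalgebra[of N] by (auto simp: rat_subalgebra_def)

lemma more_vars_Suc_in_R: "N \<ge> 1 \<Longrightarrow> g \<in> R N \<Longrightarrow> more_vars N (Suc N) g \<in> R (Suc N)"
  using rings by (auto simp: tame_rings_def)

lemma in_ringI: "N \<ge> 1 \<Longrightarrow> g \<in> R N \<Longrightarrow> in_ring N g"
  using ring_extensional[of N g] by (simp add: in_ring_def extensional_restrict)

lemma in_ring_cong: "in_ring N g \<Longrightarrow> (\<And>x. x \<in> tuples N \<Longrightarrow> h x = g x) \<Longrightarrow> in_ring N h"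
  unfolding in_ring_def by (metis (no_types, lifting) restrict_ext)

lemma in_ring_one: "N \<ge> 1 \<Longrightarrow> in_ring N (\<lambda>_. 1)"
  using rings by (simp add: tame_rings_def rat_subalgebra_def in_ring_def)

lemma
  assumes "N \<ge> 1" "g \<in> R N" "h \<in> R N"
  shows ring_add: "(\<lambda>x\<in>tuples N. g x + h x) \<in> R N"
    and ring_mult: "(\<lambda>x\<in>tuples N. g x * h x) \<in> R N"
    and ring_scale: "(\<lambda>x\<in>tuples N. of_rat q * g x) \<in> R N"
  using subalgebra[OF assms(1)] assms(2,3) unfolding rat_subalgebra_def by blast+

lemma in_ring_add: "N \<ge> 1 \<Longrightarrow> in_ring N g \<Longrightarrow> in_ring N h \<Longrightarrow> in_ring N (\<lambda>x. g x + h x)"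
  unfolding in_ring_def
  using ring_add[of N "restrict g (tuples N)" "restrict h (tuples N)"] by (simp cong: restrict_cong)

lemma in_ring_mult: "N \<ge> 1 \<Longrightarrow> in_ring N g \<Longrightarrow> in_ring N h \<Longrightarrow> in_ring N (\<lambda>x. g x * h x)"
  unfolding in_ring_def
  using ring_mult[of N "restrict g (tuples N)" "restrict h (tuples N)"] by (simp cong: restrict_cong)

lemma in_ring_rat: "N \<ge> 1 \<Longrightarrow> in_ring N (\<lambda>x. of_rat q)"
  using in_ring_one[of N] ring_scale[of N "\<lambda>x\<in>tuples N. 1" "\<lambda>x\<in>tuples N. 1" q]
  unfolding in_ring_def by (simp cong: restrict_cong)

lemma in_ring_minus_one: "N \<ge> 1 \<Longrightarrow> in_ring N (\<lambda>x. - 1)"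
  using in_ring_rat[of N "- 1"] by simp

lemma in_ring_zero: "N \<ge> 1 \<Longrightarrow> in_ring N (\<lambda>x. 0)"
  using in_ring_rat[of N 0] by simp

lemma in_ring_if:
  "(c \<Longrightarrow> in_ring N g) \<Longrightarrow> (\<not> c \<Longrightarrow> in_ring N h) \<Longrightarrow> in_ring N (\<lambda>x. if c then g x else h x)"
  by (cases c) auto

lemma in_ring_sum: "N \<ge> 1 \<Longrightarrow> (\<And>i. i \<in> I \<Longrightarrow> in_ring N (g i)) \<Longrightarrow> in_ring N (\<lambda>x. \<Sum>i\<in>I. g i x)"
  by (induction I rule: infinite_finite_induct) (auto intro: in_ring_zero in_ring_add)

lemma in_ring_prod: "N \<ge> 1 \<Longrightarrow> (\<And>i. i \<in> I \<Longrightarrow> in_ring N (g i)) \<Longrightarrow> in_ring N (\<lambda>x. \<Prod>i\<in>I. g i x)"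
  by (induction I rule: infinite_finite_induct) (auto intro: in_ring_one in_ring_mult)

lemma in_ring_coord:
  assumes "i < N" shows "in_ring N (\<lambda>x. x i)"
proof -
  define \<alpha> where "\<alpha> = (\<lambda>j. if j = i then 1 else 0 :: nat)"
  have "restrict (\<lambda>x :: nat \<Rightarrow> 'a. \<Sum>\<beta>\<in>{\<alpha>}. of_rat ((\<lambda>_. 1) \<beta>) * (\<Prod>j<N. x j ^ \<beta> j)) (tuples N) \<in> rat_polys N"
    unfolding rat_polys_def by (intro CollectI exI[of _ "{\<alpha>}"] exI[of _ "\<lambda>_. 1"]) auto
  moreover have "(\<Prod>j<N. x j ^ \<alpha> j) = x i" for x :: "nat \<Rightarrow> 'a"
    using assms by (simp add: \<alpha>_def if_distrib[of "\<lambda>k. _ ^ k"] prod.delta cong: if_cong)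
  ultimately have "restrict (\<lambda>x :: nat \<Rightarrow> 'a. x i) (tuples N) \<in> rat_polys N" by simp
  moreover have "rat_polys N \<subseteq> R N" using rings assms by (simp add: tame_rings_def)
  ultimately show ?thesis by (auto simp: in_ring_def)
qed

lemma in_ring_pd: "N \<ge> 1 \<Longrightarrow> g \<in> R N \<Longrightarrow> i < N \<Longrightarrow> in_ring N (pd N i g)"
  using rings by (intro in_ringI) (auto simp: tame_rings_def)

lemma in_ring_more_vars:
  assumes "N \<ge> 1" "in_ring N g" shows "in_ring (Suc N) (\<lambda>x. g (restrict x {..<N}))"
proof -
  have "more_vars N (Suc N) (restrict g (tuples N)) \<in> R (Suc N)"
    using assms more_vars_Suc_in_R by (simp add: in_ring_def)
  then show ?thesis by (simp add: in_ring_def more_vars_def)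
qed

lemma more_vars_Suc:
  fixes g :: "(nat \<Rightarrow> 'a) \<Rightarrow> 'a"
  assumes "n \<le> N" shows "more_vars n (Suc N) g = more_vars N (Suc N) (more_vars n N g)"
proof
  fix x :: "nat \<Rightarrow> 'a"
  have *: "restrict (restrict x {..<N}) {..<n} = restrict x {..<n}"
    using assms by (auto simp: fun_eq_iff)
  show "more_vars n (Suc N) g x = more_vars N (Suc N) (more_vars n N g) x"
  proof (cases "x \<in> tuples (Suc N)")
    case True
    then show ?thesis
      by (simp only: more_vars_def restrict_apply'[OF True] restrict_apply'[OF restrict_in_tuples] *)
  qed (simp add: more_vars_def)
qed

lemma more_vars_in_R:
  assumes "n \<ge> 1" "n \<le> N" "g \<in> R n" shows "more_vars n N g \<in> R N"
  using assms(2)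
proof (induction N rule: dec_induct)
  case base
  have "g \<in> extensional (tuples n)" using ring_extensional assms by blast
  then have "more_vars n n g = g" by (auto simp: more_vars_def fun_eq_iff extensional_def)
  then show ?case using assms by simp
next
  case (step N)
  then show ?case using assms(1) unfolding more_vars_Suc[OF step(1)]
    by (intro more_vars_Suc_in_R) auto
qed

lemma ring_has_grad:
  assumes "N \<ge> 1" "g \<in> R N" "x \<in> tuples N"
  shows "has_grad N g x (\<lambda>i. pd N i g x)"
proof -
  have "smooth N (tuples N) g"
    using rings assms by (simp add: tame_rings_def locally_tame_def)
  then have "times_differentiable N (tuples N) (Suc 0) g" by (simp only: smooth_def)
  then have "differentiable_at N (tuples N) g x" using assms by simp
  then obtain D where D: "has_grad N g x D"
    unfolding differentiable_at_def has_grad_def norm1_def by blast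
  show ?thesis by (rule has_grad_cong[OF D]) (use assms partial_deriv_eq[OF D] in auto)
qed

lemma ring_cont: "N \<ge> 1 \<Longrightarrow> g \<in> R N \<Longrightarrow> x \<in> tuples N \<Longrightarrow> cont_at N g x"
  using ring_has_grad has_grad_imp_cont by blast

lemma ring_def_fun:
  assumes "N \<ge> 1" "g \<in> R N" shows "def_fun S (\<lambda>x. g (restrict x {..<N}))"
proof -
  have "definable_fun S N (tuples N) g"
    using rings assms by (simp add: tame_rings_def locally_tame_def)
  from definable_fun_imp_def_fun(1)[OF this] show ?thesis by (simp add: cutoff_def)
qed

lemma ring_def_fun_box:
  assumes "N \<ge> 1" "g \<in> R N" "\<And>i. i < N \<Longrightarrow> a i < b i" "\<And>i. i < N \<Longrightarrow> b i - a i \<le> 1"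
  shows "def_fun S0 (\<lambda>x. cutoff (\<Pi>\<^sub>E i\<in>{..<N}. {a i<..<b i}) g (restrict x {..<N}))"
proof -
  have "locally_tame S S0 N (tuples N) g"
    using rings assms by (simp add: tame_rings_def)
  then have "definable_fun S0 N (\<Pi>\<^sub>E i\<in>{..<N}. {a i<..<b i}) g"
    using assms(3,4) closure_subset_tuples unfolding locally_tame_def Let_def by blast
  then show ?thesis by (rule definable_fun_imp_def_fun)
qed

lemma in_ring_det:
  assumes "N \<ge> 1" "\<And>i j. i < m \<Longrightarrow> j < m \<Longrightarrow> in_ring N (a i j)"
  shows "in_ring N (\<lambda>x. Determinant.det (Matrix.mat m m (\<lambda>(i, j). a i j x)))"
proof -
  have "in_ring N (\<lambda>x. \<Sum>p\<in>{p. p permutes {0..<m}}. signof p * (\<Prod>i = 0..<m. a i (p i) x))"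
  proof (intro in_ring_sum in_ring_mult in_ring_prod assms)
    show "in_ring N (\<lambda>x. signof p)" for p
      using assms(1) by (auto simp: sign_def intro: in_ring_one in_ring_minus_one)
  qed (auto simp: permutes_in_image)
  then show ?thesis
    by (rule in_ring_cong) (auto simp: Determinant.det_def permutes_in_image intro!: sum.cong prod.cong)
qed

text \<open>Determinant and adjugate are polynomials with integer coefficients in the entries of a matrix, so
  they stay in the ring.\<close>

lemma ring_adjugate:
  assumes N: "N \<ge> 1" and a: "\<And>i j. i < m \<Longrightarrow> j < m \<Longrightarrow> in_ring N (a i j)"
  shows "\<exists>\<delta> C. in_ring N \<delta> \<and> (\<forall>i<m. \<forall>j<m. in_ring N (C i j)) \<and>
    (\<forall>x. \<forall>i<m. \<forall>j<m. (\<Sum>k<m. a i k x * C k j x) = (if i = j then \<delta> x else 0)) \<and>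
    (\<forall>x B. is_inverse m (\<lambda>i j. a i j x) B \<longrightarrow> \<delta> x \<noteq> 0)"
proof -
  define A where "A x = Matrix.mat m m (\<lambda>(i, j). a i j x)" for x
  have A: "A x \<in> carrier_mat m m" for x by (simp add: A_def)
  define \<delta> where "\<delta> x = Determinant.det (A x)" for x
  define C where "C i j x = adj_mat (A x) $$ (i, j)" for i j x
  have C: "in_ring N (C i j)" if "i < m" "j < m" for i j
  proof -
    let ?minor = "\<lambda>x. Matrix.mat (m - 1) (m - 1)
       (\<lambda>(i', j'). a (if i' < j then i' else Suc i') (if j' < i then j' else Suc j') x)"
    have "in_ring N (\<lambda>x. Determinant.det (?minor x))"
      by (intro in_ring_det a N) auto
    moreover have "in_ring N (\<lambda>x. (- 1) ^ (j + i))"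
      using N by (cases "even (j + i)") (auto intro: in_ring_one in_ring_minus_one)
    ultimately have "in_ring N (\<lambda>x. (- 1) ^ (j + i) * Determinant.det (?minor x))"
      by (intro in_ring_mult N)
    then show ?thesis
    proof (rule in_ring_cong)
      fix x
      have "mat_delete (A x) j i = ?minor x"
        by (rule eq_matI) (auto simp: mat_delete_def A_def)
      then show "C i j x = (- 1) ^ (j + i) * Determinant.det (?minor x)"
        using that by (simp add: C_def adj_mat_def cofactor_def A_def)
    qed
  qed
  have AC: "(\<Sum>k<m. a i k x * C k j x) = (if i = j then \<delta> x else 0)" if "i < m" "j < m" for i j x
  proof -
    have "(A x * adj_mat (A x)) $$ (i, j) = (\<Sum>k<m. a i k x * C k j x)"
      using that adj_mat(1)[OF A[of x]] by (auto simp: scalar_prod_def A_def C_def lessThan_atLeast0)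
    moreover have "(A x * adj_mat (A x)) $$ (i, j) = (if i = j then \<delta> x else 0)"
      using that unfolding adj_mat(2)[OF A[of x]] by (simp add: \<delta>_def)
    ultimately show ?thesis by simp
  qed
  have nz: "\<delta> x \<noteq> 0" if B: "is_inverse m (\<lambda>i j. a i j x) B" for x B
  proof -
    let ?B = "Matrix.mat m m (\<lambda>(i, j). B i j)"
    have "A x * ?B = 1\<^sub>m m"
      using B unfolding A_def by (intro eq_matI) (simp_all add: mult_mat_index is_inverse_def del: index_mult_mat(1))
    then have "\<delta> x * Determinant.det ?B = 1"
      using det_mult[OF A[of x], of ?B] by (simp add: \<delta>_def)
    then show ?thesis by auto
  qed
  have "in_ring N \<delta>" unfolding \<delta>_def A_def by (intro in_ring_det a N) auto
  then show ?thesis using C AC nz by blast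
qed

text \<open>The new variable \<open>t\<close> is constrained by \<open>t \<delta> = 1\<close>, where \<open>\<delta>\<close> is the Jacobian determinant. Wherever
  this holds, the Jacobian of the extended system is invertible, being block triangular with
  diagonal blocks the old Jacobian and \<open>\<delta>\<close>, and its inverse is polynomial in \<open>t\<close>, the adjugate and
  the derivatives of \<open>\<delta>\<close>.\<close>

lemma regularise:
  assumes N: "N \<ge> 1" and F: "\<And>k. k < N \<Longrightarrow> F k \<in> R N" and p: "p \<in> tuples N"
    and inv: "is_inverse N (\<lambda>k i. pd N i (F k) p) B"
  shows "\<exists>F' W q. (\<forall>k<Suc N. F' k \<in> R (Suc N)) \<and> (\<forall>k<N. F' k = more_vars N (Suc N) (F k)) \<and>
    (\<forall>i<Suc N. \<forall>k<Suc N. W i k \<in> R (Suc N)) \<and>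
    q \<in> tuples (Suc N) \<and> restrict q {..<N} = p \<and> F' N q = 0 \<and>
    (\<forall>x \<in> tuples (Suc N). F' N x = 0 \<longrightarrow> is_inverse (Suc N) (\<lambda>k i. pd (Suc N) i (F' k) x) (\<lambda>i k. W i k x))"
proof -
  have "\<exists>\<delta> C. in_ring N \<delta> \<and> (\<forall>i<N. \<forall>j<N. in_ring N (C i j)) \<and>
    (\<forall>x. \<forall>k<N. \<forall>j<N. (\<Sum>i<N. pd N i (F k) x * C i j x) = (if k = j then \<delta> x else 0)) \<and>
    (\<forall>x B. is_inverse N (\<lambda>k i. pd N i (F k) x) B \<longrightarrow> \<delta> x \<noteq> 0)"
    by (rule ring_adjugate[OF N]) (intro in_ring_pd N F)
  then obtain \<delta>' C where \<delta>': "in_ring N \<delta>'" "\<And>x B. is_inverse N (\<lambda>k i. pd N i (F k) x) B \<Longrightarrow> \<delta>' x \<noteq> 0"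
    and C: "\<And>i j. i < N \<Longrightarrow> j < N \<Longrightarrow> in_ring N (C i j)"
      "\<And>x k j. k < N \<Longrightarrow> j < N \<Longrightarrow> (\<Sum>i<N. pd N i (F k) x * C i j x) = (if k = j then \<delta>' x else 0)"
    by blast
  define \<delta> where "\<delta> = restrict \<delta>' (tuples N)"
  have \<delta>: "\<delta> \<in> R N" using \<delta>'(1) by (simp add: \<delta>_def in_ring_def)
  let ?N = "Suc N"
  have N': "?N \<ge> 1" by simp
  let ?r = "\<lambda>x::nat \<Rightarrow> 'a. restrict x {..<N}"
  define G where "G = restrict (\<lambda>x. x N * \<delta> (?r x) + (- 1)) (tuples ?N)"
  define F' where "F' k = (if k < N then more_vars N ?N (F k) else G)" for k
  \<comment> \<open>The inverse in block form: \<open>t C\<close> and \<open>t\<close> on the diagonal, \<open>- t\<^sup>3 (\<nabla>\<delta>) C\<close> below, where \<open>C\<close> is the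
  adjugate and \<open>t = 1 / \<delta>\<close>.\<close>
  define W0 where "W0 i k x = (if i < N then (if k < N then x N * C i k (?r x) else 0) else
     (if k < N then (- 1) * (x N * (x N * (x N * (\<Sum>j<N. pd N j \<delta> (?r x) * C j k (?r x))))) else x N))" for i k x
  define W where "W i k = restrict (W0 i k) (tuples ?N)" for i k
  define q where "q = (\<lambda>i\<in>{..<?N}. if i < N then p i else inverse (\<delta> p))"
  have q: "q \<in> tuples ?N" "?r q = p" "q N = inverse (\<delta> p)"
    using p by (auto simp: q_def tuples_def fun_eq_iff PiE_def extensional_def)
  have "\<delta> p \<noteq> 0" using \<delta>'(2)[OF inv] p by (simp add: \<delta>_def)
  have G: "G \<in> R ?N"
  proof -
    have "in_ring ?N (\<lambda>x. x N * \<delta> (?r x) + (- 1))"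
      by (intro in_ring_add in_ring_mult in_ring_coord in_ring_more_vars in_ring_minus_one in_ringI N N' \<delta>) simp
    then show ?thesis by (simp add: G_def in_ring_def)
  qed
  have F': "F' k \<in> R ?N" for k
    using N F G more_vars_Suc_in_R by (auto simp: F'_def)
  have W: "W i k \<in> R ?N" if "i < ?N" "k < ?N" for i k
  proof -
    have "in_ring N (\<lambda>x. \<Sum>j<N. pd N j \<delta> x * C j k x)" if "k < N"
      by (intro in_ring_sum in_ring_mult in_ring_pd C N \<delta> that) auto
    then have "in_ring ?N (W0 i k)"
      unfolding W0_def by (intro in_ring_if in_ring_mult in_ring_coord in_ring_minus_one in_ring_zero
          in_ring_more_vars[OF N] C N') auto
    then show ?thesis by (simp add: W_def in_ring_def)
  qed
  have inverse: "is_inverse ?N (\<lambda>k i. pd ?N i (F' k) x) (\<lambda>i k. W i k x)"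
    if x: "x \<in> tuples ?N" "F' N x = 0" for x
  proof (rule right_inverse_imp_inverse)
    fix l k assume lk: "l < ?N" "k < ?N"
    have t: "x N * \<delta> (?r x) = 1" using x by (simp add: F'_def G_def)
    have grad_F: "pd ?N i (F' l) x = (if i < N then pd N i (F l) (?r x) else 0)" if "l < N" "i < ?N" for l i
    proof -
      have "has_grad ?N (F' l) x (\<lambda>i. if i < N then pd N i (F l) (?r x) else 0)"
        using has_grad_more_vars[OF ring_has_grad[OF N F[OF that(1)]] x(1)] that by (simp add: F'_def)
      from partial_deriv_eq[OF this x(1) that(2)] show ?thesis .
    qed
    have grad_G: "pd ?N i (F' N) x = (if i < N then x N * pd N i \<delta> (?r x) else \<delta> (?r x))" if "i < ?N" for i
    proof -
      let ?m = "more_vars N ?N \<delta>"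
      have m: "has_grad ?N ?m x (\<lambda>i. if i < N then pd N i \<delta> (?r x) else 0)"
        using has_grad_more_vars[OF ring_has_grad[OF N \<delta>] x(1)] by simp
      have "has_grad ?N (\<lambda>x. x N * ?m x + (- 1)) x
         (\<lambda>i. (if i = N then 1 else 0) * ?m x + x N * (if i < N then pd N i \<delta> (?r x) else 0) + 0)"
        by (intro has_grad_add has_grad_mult has_grad_coord has_grad_const m) simp
      then have "has_grad ?N (F' N) x (\<lambda>i. if i < N then x N * pd N i \<delta> (?r x) else \<delta> (?r x))"
        by (rule has_grad_cong) (use x in \<open>auto simp: F'_def G_def more_vars_def\<close>)
      from partial_deriv_eq[OF this x(1) that] show ?thesis .
    qed
    have \<delta>r: "\<delta>' (?r x) = \<delta> (?r x)" by (simp add: \<delta>_def)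
    have Wx: "W i k x = W0 i k x" for i k using x(1) by (simp add: W_def)
    show "(\<Sum>i<?N. pd ?N i (F' l) x * W i k x) = (if l = k then 1 else 0)"
    proof (cases "l < N")
      case True
      have "(\<Sum>i<?N. pd ?N i (F' l) x * W i k x) = (\<Sum>i<N. pd N i (F l) (?r x) * W0 i k x)"
        using True by (simp add: grad_F Wx)
      also have "\<dots> = (if k < N then x N * (\<Sum>i<N. pd N i (F l) (?r x) * C i k (?r x)) else 0)"
        by (simp add: W0_def sum_distrib_left mult_ac)
      also have "\<dots> = (if l = k then 1 else 0)"
        using C(2)[OF True, of k "?r x"] t True by (auto simp: \<delta>r)
      finally show ?thesis .
    next
      case False
      then have [simp]: "l = N" using lk by simp
      have "(\<Sum>i<?N. pd ?N i (F' l) x * W i k x) =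
        (\<Sum>i<N. x N * pd N i \<delta> (?r x) * W0 i k x) + \<delta> (?r x) * W0 N k x"
        by (simp add: grad_G Wx)
      also have "\<dots> = (if l = k then 1 else 0)"
      proof (cases "k < N")
        case True
        define s where "s = (\<Sum>i<N. pd N i \<delta> (?r x) * C i k (?r x))"
        have "(\<Sum>i<N. x N * pd N i \<delta> (?r x) * W0 i k x) = x N * x N * s"
          using True by (simp add: W0_def s_def sum_distrib_left mult_ac)
        moreover have "\<delta> (?r x) * W0 N k x = - (x N * \<delta> (?r x)) * (x N * x N * s)"
          using True by (simp add: W0_def s_def mult_ac)
        ultimately show ?thesis using True t by simp
      next
        case False
        then have "k = N" using lk by simp
        then show ?thesis using t by (simp add: W0_def mult.commute)
      qed
      finally show ?thesis .
    qed
  qed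
  have "F' N q = 0" using q \<open>\<delta> p \<noteq> 0\<close> by (simp add: F'_def G_def)
  moreover have "F' k = more_vars N ?N (F k)" if "k < N" for k using that by (simp add: F'_def)
  ultimately show ?thesis using F' W q inverse by (intro exI[of _ F'] exI[of _ W] exI[of _ q]) blast
qed

end

section \<open>Charts with a minimal number of free indices\<close>

text \<open>The situation after \<open>regularise\<close>. The matrix \<open>W\<close>, with entries in the ring, inverts the Jacobian of
  \<open>F\<close> on the whole zero set of the \<open>F k\<close> with \<open>k\<close> not free, and the last assumption is what minimality
  of the number of free indices amounts to.\<close>

locale regular_chart = tame_ring_setting S S0 R
  for S S0 :: "('f, 'r, 'a :: {linordered_field, linorder_topology}) expansion" and R +
  fixes N :: nat and F :: "nat \<Rightarrow> (nat \<Rightarrow> 'a) \<Rightarrow> 'a" and W :: "nat \<Rightarrow> nat \<Rightarrow> (nat \<Rightarrow> 'a) \<Rightarrow> 'a"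
    and K :: "nat set" and f :: "(nat \<Rightarrow> 'a) \<Rightarrow> 'a"
  assumes N: "N \<ge> 1" and K: "K \<subseteq> {..<N}" and f_R: "f \<in> R N"
    and F_R: "\<And>k. k < N \<Longrightarrow> F k \<in> R N" and W_R: "\<And>i k. i < N \<Longrightarrow> k < N \<Longrightarrow> W i k \<in> R N"
    and regular: "\<And>x. x \<in> tuples N \<Longrightarrow> (\<And>k. k < N \<Longrightarrow> k \<notin> K \<Longrightarrow> F k x = 0) \<Longrightarrow>
      is_inverse N (\<lambda>k i. pd N i (F k) x) (\<lambda>i k. W i k x)"
    and minimal: "\<And>x g k. x \<in> tuples N \<Longrightarrow> (\<And>k. k < N \<Longrightarrow> k \<notin> K \<Longrightarrow> F k x = 0) \<Longrightarrow> f x = 0 \<Longrightarrow>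
      g \<in> R N \<Longrightarrow> g x = 0 \<Longrightarrow> k \<in> K \<Longrightarrow> (\<Sum>i<N. pd N i g x * W i k x) = 0"
begin

definition M :: "(nat \<Rightarrow> 'a) set" where
  "M = {x \<in> tuples N. \<forall>k<N. k \<notin> K \<longrightarrow> F k x = 0}"

text \<open>The derivative along the vector field given by column \<open>k\<close> of \<open>W\<close>. It maps \<open>F k\<close> to 1 and all other
  \<open>F j\<close> to 0 on \<open>M\<close>.\<close>

definition D :: "nat \<Rightarrow> ((nat \<Rightarrow> 'a) \<Rightarrow> 'a) \<Rightarrow> (nat \<Rightarrow> 'a) \<Rightarrow> 'a" where
  "D k g = (\<lambda>x\<in>tuples N. \<Sum>i<N. pd N i g x * W i k x)"

lemma finite_K: "finite K" using K finite_subset by blast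

lemma D_R: "g \<in> R N \<Longrightarrow> k \<in> K \<Longrightarrow> D k g \<in> R N"
proof -
  assume "g \<in> R N" "k \<in> K"
  then have "in_ring N (\<lambda>x. \<Sum>i<N. pd N i g x * W i k x)"
    using K by (intro in_ring_sum in_ring_mult in_ring_pd in_ringI W_R N) auto
  then show ?thesis by (simp add: D_def in_ring_def)
qed

lemma D_vanishes: "x \<in> M \<Longrightarrow> f x = 0 \<Longrightarrow> g \<in> R N \<Longrightarrow> g x = 0 \<Longrightarrow> k \<in> K \<Longrightarrow> D k g x = 0"
  using minimal[of x g k] by (auto simp: M_def D_def)

lemma pd_R: "g \<in> R N \<Longrightarrow> i < N \<Longrightarrow> pd N i g \<in> R N"
  using rings N by (simp add: tame_rings_def)

text \<open>The bound 1/4 keeps the cube within an open box with sides of length 1, on which the elements of the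
  ring are definable in the reduct.\<close>

lemma local_paths:
  assumes P: "P \<in> M"
  obtains \<rho> C \<sigma> where "0 < \<rho>" "\<rho> \<le> 1 / 4" "0 < C" "0 < \<sigma>"
    "\<And>v. (\<And>k. k < N \<Longrightarrow> \<bar>v k\<bar> \<le> \<sigma>) \<Longrightarrow> \<exists>\<gamma>. solution_path N F P \<rho> C v \<gamma>"
proof -
  have inv: "is_inverse N (\<lambda>k i. pd N i (F k) P) (\<lambda>i k. W i k P)"
    using P by (intro regular) (auto simp: M_def)
  show ?thesis
  proof (rule local_inverse[OF dc, where N = N and p = P and F = F and r = "1/4"
        and J = "\<lambda>k i. pd N i (F k)" and B = "\<lambda>i k. W i k P"])
    show "P \<in> tuples N" using P by (simp add: M_def)
    then show "cont_at N (pd N i (F k)) P" if "k < N" "i < N" for k i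
      using that by (intro ring_cont N pd_R F_R)
    show "(\<Sum>k<N. W l k P * pd N i (F k) P) = (if l = i then 1 else 0)" if "l < N" "i < N" for l i
      using inv that by (simp add: is_inverse_def)
    show "(\<Sum>l<N. pd N l (F k) P * W l k' P) = (if k = k' then 1 else 0)" if "k < N" "k' < N" for k k'
      using inv that by (simp add: is_inverse_def)
    fix \<rho> C \<sigma>
    assume *: "0 < \<rho>" "\<rho> \<le> 1/4" "0 < C" "0 < \<sigma>"
      "\<And>x x'. x \<in> cube N P \<rho> \<Longrightarrow> x' \<in> cube N P \<rho> \<Longrightarrow> dist1 N x x' \<le> C * norm1 N (\<lambda>k. F k x - F k x')"
      "\<And>v. (\<And>k. k < N \<Longrightarrow> \<bar>v k\<bar> \<le> \<sigma>) \<Longrightarrow> \<exists>x\<in>cube N P \<rho>. \<forall>k<N. F k x = F k P + v k"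
    show thesis
    proof (rule that[OF *(1-4)])
      fix v :: "nat \<Rightarrow> 'a" assume v: "\<And>k. k < N \<Longrightarrow> \<bar>v k\<bar> \<le> \<sigma>"
      have "\<exists>x\<in>cube N P \<rho>. \<forall>k<N. F k x = F k P + s * v k" if s: "0 \<le> s \<and> s \<le> 1" for s
      proof (rule *(6))
        fix k assume k: "k < N"
        have "\<bar>s * v k\<bar> \<le> 1 * \<bar>v k\<bar>" unfolding abs_mult using s by (intro mult_right_mono) auto
        then show "\<bar>s * v k\<bar> \<le> \<sigma>" using v[OF k] by simp
      qed
      then obtain \<gamma> where "\<forall>s. 0 \<le> s \<and> s \<le> 1 \<longrightarrow> \<gamma> s \<in> cube N P \<rho> \<and> (\<forall>k<N. F k (\<gamma> s) = F k P + s * v k)" by metis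
      then have "solution_path N F P \<rho> C v \<gamma>"
        using *(3,5) by unfold_locales auto
      then show "\<exists>\<gamma>. solution_path N F P \<rho> C v \<gamma>" by blast
    qed
  qed (use ring_def_fun ring_has_grad F_R N in auto)
qed

context
  fixes P :: "nat \<Rightarrow> 'a" and \<rho> C :: 'a and v :: "nat \<Rightarrow> 'a" and \<gamma> :: "'a \<Rightarrow> nat \<Rightarrow> 'a"
  assumes P: "P \<in> M" and \<rho>: "0 < \<rho>" "\<rho> \<le> 1 / 4" and path: "solution_path N F P \<rho> C v \<gamma>"
    and v: "\<And>k. k < N \<Longrightarrow> k \<notin> K \<Longrightarrow> v k = 0"
begin

interpretation solution_path N F P \<rho> C v \<gamma> by (rule path)

lemma path_start: "\<gamma> 0 = P"
  using unique[of 0 P] P \<rho> by (simp add: M_def cube_def)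

lemma path_in_M: "0 \<le> s \<Longrightarrow> s \<le> 1 \<Longrightarrow> \<gamma> s \<in> M"
  using cube[of s] F[of s] P v by (simp add: M_def cube_def)

text \<open>The path moves with velocity \<open>\<Sum>k\<in>K. v k * W i k\<close>, as its image under \<open>F\<close> moves with velocity \<open>v\<close>.\<close>

lemma path_deriv:
  assumes g: "g \<in> R N" and s: "0 \<le> s" "s \<le> 1"
  shows "has_deriv (\<lambda>s. g (\<gamma> s)) (\<Sum>k\<in>K. v k * D k g (\<gamma> s)) s {0..1}"
proof -
  let ?x = "\<gamma> s"
  have x: "?x \<in> M" "?x \<in> tuples N" using path_in_M[OF s] by (auto simp: M_def)
  have inv: "is_inverse N (\<lambda>k i. pd N i (F k) ?x) (\<lambda>i k. W i k ?x)"
    using x by (intro regular) (auto simp: M_def)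
  have "has_deriv (\<lambda>s. g (\<gamma> s)) (\<Sum>i<N. pd N i g ?x * (\<Sum>k<N. W i k ?x * v k)) s {0..1}"
  proof (rule has_deriv_along[where N = N and g = g and \<gamma> = \<gamma> and D = "\<lambda>i. pd N i g ?x"])
    show "has_grad N g ?x (\<lambda>i. pd N i g ?x)" using g x N by (intro ring_has_grad)
    show "has_deriv (\<lambda>s. \<gamma> s i) (\<Sum>k<N. W i k ?x * v k) s {0..1}" if "i < N" for i
      using s x inv that
      by (intro deriv[where J = "\<lambda>k i. pd N i (F k) ?x"] ring_has_grad N F_R) (auto simp: is_inverse_def)
    show "\<gamma> s' \<in> tuples N" if "s' \<in> {0..1}" for s'
      using path_in_M[of s'] that by (auto simp: M_def)
  qed
  moreover have "(\<Sum>i<N. pd N i g ?x * (\<Sum>k<N. W i k ?x * v k)) = (\<Sum>k\<in>K. v k * D k g ?x)"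
  proof -
    have "(\<Sum>i<N. pd N i g ?x * (\<Sum>k<N. W i k ?x * v k)) = (\<Sum>k<N. v k * D k g ?x)"
      using x unfolding sum_distrib_left D_def by (subst sum.swap) (simp add: sum_distrib_left mult_ac)
    also have "\<dots> = (\<Sum>k\<in>K. v k * D k g ?x)"
      using K v by (intro sum.mono_neutral_right) auto
    finally show ?thesis .
  qed
  ultimately show ?thesis by simp
qed

text \<open>The linear span, over the whole field, of the ring elements that vanish at \<open>P\<close>. By minimality it is
  closed under differentiation along the path, unlike the set of these elements, since the
  coefficients \<open>v\<close> need not be rational.\<close>

inductive_set vanishing_span :: "((nat \<Rightarrow> 'a) \<Rightarrow> 'a) set" where
  base: "g \<in> R N \<Longrightarrow> g P = 0 \<Longrightarrow> g \<in> vanishing_span"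
| comb: "u \<in> vanishing_span \<Longrightarrow> w \<in> vanishing_span \<Longrightarrow> (\<lambda>x. a * u x + b * w x) \<in> vanishing_span"

lemma vanishing_span_zero: "u \<in> vanishing_span \<Longrightarrow> u P = 0"
  by (induction rule: vanishing_span.induct) auto

lemma vanishing_span_def_fun: "u \<in> vanishing_span \<Longrightarrow> def_fun S (\<lambda>x. u (restrict x {..<N}))"
proof (induction rule: vanishing_span.induct)
  case (base g)
  then show ?case by (intro ring_def_fun N)
qed (intro def_fun_add def_fun_mult def_fun_const; assumption)

lemma vanishing_span_sum:
  assumes "finite I" "I \<noteq> {}" "\<And>k. k \<in> I \<Longrightarrow> u k \<in> vanishing_span"
  shows "(\<lambda>x. \<Sum>k\<in>I. c k * u k x) \<in> vanishing_span"
  using assms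
proof (induction I rule: finite_ne_induct)
  case (singleton k)
  then show ?case using vanishing_span.comb[of "u k" "u k" "c k" 0] by simp
next
  case (insert k I)
  have "(\<lambda>x. c k * u k x + 1 * (\<Sum>k\<in>I. c k * u k x)) \<in> vanishing_span"
    by (intro vanishing_span.comb insert.IH insert.prems) auto
  then show ?case using insert.hyps by simp
qed

abbreviation derives :: "((nat \<Rightarrow> 'a) \<Rightarrow> 'a) \<Rightarrow> ((nat \<Rightarrow> 'a) \<Rightarrow> 'a) \<Rightarrow> bool" where
  "derives u w \<equiv> (\<forall>s. 0 \<le> s \<longrightarrow> s \<le> 1 \<longrightarrow> has_deriv (\<lambda>s. u (\<gamma> s)) (w (\<gamma> s)) s {0..1})"

lemma vanishing_span_deriv:
  assumes "u \<in> vanishing_span" "f P = 0" "K \<noteq> {}"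
  shows "\<exists>w. w \<in> vanishing_span \<and> derives u w"
  using assms(1)
proof (induction rule: vanishing_span.induct)
  case (base g)
  have "(\<lambda>x. \<Sum>k\<in>K. v k * D k g x) \<in> vanishing_span"
    using base P assms by (intro vanishing_span_sum finite_K vanishing_span.base D_R D_vanishes)
  moreover have "derives g (\<lambda>x. \<Sum>k\<in>K. v k * D k g x)"
    by (intro allI impI path_deriv base(1))
  ultimately show ?case by (intro exI conjI)
next
  case (comb u w a b)
  from comb.IH(1) obtain u' where u': "u' \<in> vanishing_span" "derives u u'" by (elim exE conjE)
  from comb.IH(2) obtain w' where w': "w' \<in> vanishing_span" "derives w w'" by (elim exE conjE)
  have "derives (\<lambda>x. a * u x + b * w x) (\<lambda>x. a * u' x + b * w' x)"
    using u'(2) w'(2) by (intro allI impI has_deriv_lincomb) simp_all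
  then show ?case using vanishing_span.comb[OF u'(1) w'(1)] by (intro exI conjI)
qed

text \<open>All derivatives of \<open>g \<circ> \<gamma>\<close> at 0 vanish, and \<open>g \<circ> \<gamma>\<close> is definable in the reduct.\<close>

lemma vanishes_at_end:
  assumes g: "g \<in> R N" "g P = 0" and "f P = 0" "K \<noteq> {}"
  shows "g (\<gamma> 1) = 0"
proof -
  have "\<exists>d. \<forall>u\<in>vanishing_span. d u \<in> vanishing_span \<and> derives u (d u)"
    using vanishing_span_deriv[OF _ assms(3,4)] by (intro bchoice ballI)
  then obtain d where d': "\<forall>u\<in>vanishing_span. d u \<in> vanishing_span \<and> derives u (d u)" by (rule exE)
  have d: "d u \<in> vanishing_span" "derives u (d u)" if "u \<in> vanishing_span" for u
    using bspec[OF d' that] by simp_all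
  define U where "U m = (d ^^ m) g" for m
  have U: "U m \<in> vanishing_span" for m
    by (induction m) (auto simp: U_def intro: d vanishing_span.base g)
  define \<phi> where "\<phi> m s = (if 0 \<le> s \<and> s \<le> 1 then U m (\<gamma> s) else 0)" for m s
  interpret flat_setting S S0 \<phi>
  proof
    show "definably_complete S" "polynomially_bounded S0" by (rule dc pb)+
    fix m
    show "def_fun S (\<lambda>x. \<phi> m (x 0))"
      unfolding \<phi>_def
      by (rule def_fun_along[where B = "tuples N"])
         (use ring_def_fun N F_R vanishing_span_def_fun[OF U[of m]] in \<open>auto simp: cutoff_def cube_def\<close>)
    let ?B = "\<Pi>\<^sub>E i\<in>{..<N}. {P i - 1/2<..<P i + 1/2}"
    show "def_fun S0 (\<lambda>x. \<phi> 0 (x 0))"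
      unfolding \<phi>_def
    proof (rule def_fun_along[where B = ?B])
      show "cube N P \<rho> \<subseteq> ?B"
      proof
        fix x assume x: "x \<in> cube N P \<rho>"
        have "\<bar>x i - P i\<bar> < 1/2" if "i < N" for i
        proof -
          have "\<bar>x i - P i\<bar> \<le> 1/4" using x that \<rho>(2) by (force simp: cube_def)
          also have "(1/4 :: 'a) < 1/2" by simp
          finally show ?thesis .
        qed
        then have "P i - 1/2 < x i \<and> x i < P i + 1/2" if "i < N" for i
          using that by (smt (verit) abs_less_iff add.commute diff_less_eq less_diff_eq minus_diff_eq)
        then show "x \<in> ?B" using x by (auto simp: cube_def tuples_def PiE_iff)
      qed
      have box: "def_fun S0 (\<lambda>x. cutoff ?B h (restrict x {..<N}))" if "h \<in> R N" for h
        using that N by (intro ring_def_fun_box) auto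
      show "def_fun S0 (\<lambda>x. cutoff ?B (F k) (restrict x {..<N}))" if "k < N" for k
        using box F_R that by blast
      show "def_fun S0 (\<lambda>x. cutoff ?B (U 0) (restrict x {..<N}))"
        using box g by (simp add: U_def)
    qed
    fix s :: 'a assume s: "0 \<le> s" "s \<le> 1"
    have "has_deriv (\<lambda>s. U m (\<gamma> s)) (U (Suc m) (\<gamma> s)) s {0..1}"
      using d(2)[OF U[of m]] s by (simp add: U_def)
    then have "has_deriv (\<phi> m) (U (Suc m) (\<gamma> s)) s {0..1}"
      by (rule has_deriv_cong) (use s in \<open>auto simp: \<phi>_def\<close>)
    then show "has_deriv (\<phi> m) (\<phi> (Suc m) s) s {0..1}" using s by (simp add: \<phi>_def)
  qed
  have "\<phi> 0 1 = 0"
    by (rule flat_imp_zero) (simp add: \<phi>_def path_start vanishing_span_zero[OF U])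
  then show ?thesis by (simp add: \<phi>_def U_def)
qed

end

text \<open>Every point of \<open>M\<close> near \<open>P\<close> is the end of a path in \<open>M\<close> that starts at \<open>P\<close>.\<close>

lemma vanishes_nearby:
  assumes P: "P \<in> M" "f P = 0" and g: "g \<in> R N" "g P = 0" and "K \<noteq> {}"
  shows "\<exists>\<epsilon>>0. \<forall>x\<in>M. close_to N \<epsilon> P x \<longrightarrow> g x = 0"
proof -
  obtain \<rho> C \<sigma> where *: "0 < \<rho>" "\<rho> \<le> 1 / 4" "0 < C" "0 < \<sigma>"
    "\<And>v. (\<And>k. k < N \<Longrightarrow> \<bar>v k\<bar> \<le> \<sigma>) \<Longrightarrow> \<exists>\<gamma>. solution_path N F P \<rho> C v \<gamma>"
    by (rule local_paths[OF P(1)]) blast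
  have "\<exists>\<delta>>0. \<forall>k<N. \<forall>x\<in>tuples N. close_to N \<delta> P x \<longrightarrow> \<bar>F k x - F k P\<bar> < \<sigma>"
  proof (rule uniform_delta)
    show "\<exists>\<delta>>0. \<forall>x\<in>tuples N. close_to N \<delta> P x \<longrightarrow> \<bar>F k x - F k P\<bar> < \<sigma>" if "k < N" for k
      using ring_cont[OF N F_R[OF that], of P] P \<open>0 < \<sigma>\<close> unfolding cont_at_def M_def by blast
  qed (meson less_le_trans)
  then obtain \<delta> where \<delta>: "\<delta> > 0" "\<And>k x. k < N \<Longrightarrow> x \<in> tuples N \<Longrightarrow> close_to N \<delta> P x \<Longrightarrow> \<bar>F k x - F k P\<bar> < \<sigma>"
    by blast
  have "g x = 0" if x: "x \<in> M" "close_to N (min \<delta> \<rho>) P x" for x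
  proof -
    have tup: "x \<in> tuples N" using x by (simp add: M_def)
    define v where "v k = F k x - F k P" for k
    have "\<bar>v k\<bar> \<le> \<sigma>" if "k < N" for k
      unfolding v_def by (rule less_imp_le, rule \<delta>(2)) (use x tup that in auto)
    then obtain \<gamma> where \<gamma>: "solution_path N F P \<rho> C v \<gamma>" using *(5)[of v] by blast
    have v0: "v k = 0" if "k < N" "k \<notin> K" for k using that x P by (simp add: v_def M_def)
    have "x = \<gamma> 1"
      by (rule solution_path.unique[OF \<gamma>]) (use x tup in \<open>auto simp: v_def cube_def intro: less_imp_le\<close>)
    then show ?thesis
      using vanishes_at_end[OF P(1) *(1,2) \<gamma> v0 g P(2) \<open>K \<noteq> {}\<close>] by simp
  qed
  then show ?thesis using \<delta>(1) *(1) by (intro exI[of _ "min \<delta> \<rho>"]) auto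
qed

lemma vanish_nearby:
  assumes "P \<in> M" "f P = 0" "K \<noteq> {}" "finite G" "G \<subseteq> R N" "\<And>g. g \<in> G \<Longrightarrow> g P = 0"
  shows "\<exists>\<epsilon>>0. \<forall>x\<in>M. close_to N \<epsilon> P x \<longrightarrow> (\<forall>g\<in>G. g x = 0)"
  using assms(4,5,6)
proof (induction G rule: finite_induct)
  case empty
  show ?case by (intro exI[of _ 1]) auto
next
  case (insert g G)
  then obtain \<epsilon> where \<epsilon>: "\<epsilon> > 0" "\<forall>x\<in>M. close_to N \<epsilon> P x \<longrightarrow> (\<forall>g\<in>G. g x = 0)" by auto
  obtain \<epsilon>' where \<epsilon>': "\<epsilon>' > 0" "\<forall>x\<in>M. close_to N \<epsilon>' P x \<longrightarrow> g x = 0"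
    using vanishes_nearby[OF assms(1,2) _ _ assms(3), of g] insert.prems by auto
  show ?case
    using \<epsilon> \<epsilon>' by (intro exI[of _ "min \<epsilon> \<epsilon>'"]) auto
qed

text \<open>The paths with directions \<open>\<sigma> e\<^sub>k\<close> and \<open>- \<sigma> e\<^sub>k\<close> stay in \<open>M\<close>, and \<open>h\<close> cannot decrease along either.\<close>

lemma D_zero_at_local_min:
  assumes P: "P \<in> M" and h: "h \<in> R N" and k: "k \<in> K"
    and min: "\<epsilon> > 0" "\<And>x. x \<in> M \<Longrightarrow> close_to N \<epsilon> P x \<Longrightarrow> h P \<le> h x"
  shows "D k h P = 0"
proof -
  obtain \<rho> C \<sigma> where *: "0 < \<rho>" "\<rho> \<le> 1 / 4" "0 < C" "0 < \<sigma>"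
    "\<And>v. (\<And>k. k < N \<Longrightarrow> \<bar>v k\<bar> \<le> \<sigma>) \<Longrightarrow> \<exists>\<gamma>. solution_path N F P \<rho> C v \<gamma>"
    by (rule local_paths[OF P(1)]) blast
  have "c * D k h P \<ge> 0" if c: "\<bar>c\<bar> \<le> \<sigma>" for c
  proof -
    define v where "v j = (if j = k then c else 0)" for j
    have "\<exists>\<gamma>. solution_path N F P \<rho> C v \<gamma>" using c *(4) by (intro *(5)) (auto simp: v_def)
    then obtain \<gamma> where \<gamma>: "solution_path N F P \<rho> C v \<gamma>" by blast
    interpret solution_path N F P \<rho> C v \<gamma> by (rule \<gamma>)
    have v0: "v j = 0" if "j < N" "j \<notin> K" for j using that k by (auto simp: v_def)
    note path = P *(1,2) \<gamma> v0
    have start: "\<gamma> 0 = P" by (rule path_start[OF path])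
    have "(\<Sum>j\<in>K. v j * D j h (\<gamma> 0)) = c * D k h P"
      using k finite_K by (simp add: v_def start if_distrib[of "\<lambda>c. c * _"] sum.delta cong: if_cong)
    then have der: "has_deriv (\<lambda>s. h (\<gamma> s)) (c * D k h P) 0 {0..1}"
      using path_deriv[OF path h, of 0] by simp
    define L where "L = C * norm1 N v + 1"
    have "L > 0" using *(3) by (simp add: L_def add_nonneg_pos)
    show ?thesis
    proof (rule has_deriv_nonneg_at_min[OF der])
      show "\<epsilon> / L > 0" using min(1) \<open>L > 0\<close> by simp
      fix s :: 'a assume s: "0 \<le> s" "s \<le> 1" "s < \<epsilon> / L"
      have "norm1 N (\<lambda>i. \<gamma> s i - P i) \<le> C * norm1 N (\<lambda>j. F j (\<gamma> s) - F j P)"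
        using lip[OF cube cube, of s 0] s by (simp add: start)
      also have "norm1 N (\<lambda>j. F j (\<gamma> s) - F j P) = norm1 N (\<lambda>j. s * v j)"
        by (rule norm1_cong) (use F s in simp)
      also have "C * \<dots> = (C * norm1 N v) * s" unfolding norm1_scale using s by simp
      also have "\<dots> \<le> L * s" using s by (intro mult_right_mono) (auto simp: L_def)
      also have "\<dots> < \<epsilon>" using s(3) \<open>L > 0\<close> by (simp add: field_simps)
      finally have "\<bar>\<gamma> s i - P i\<bar> < \<epsilon>" if "i < N" for i
        using abs_le_norm1[OF that, of "\<lambda>i. \<gamma> s i - P i"] by simp
      then show "h (\<gamma> 0) \<le> h (\<gamma> s)" unfolding start
        using s path_in_M[OF path] by (intro min(2)) auto
    qed
  qed
  from this[of \<sigma>] this[of "- \<sigma>"] show ?thesis using *(4) by (auto simp: zero_le_mult_iff mult_le_0_iff)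
qed

lemma zero_set_closed:
  assumes g: "g \<in> R N" and x: "x \<in> tuples N" and Z: "Z \<subseteq> tuples N" "\<And>z. z \<in> Z \<Longrightarrow> g z = 0"
    and near: "\<And>\<epsilon>. \<epsilon> > 0 \<Longrightarrow> \<exists>z\<in>Z. close_to N \<epsilon> x z"
  shows "g x = 0"
proof (rule ccontr)
  assume "g x \<noteq> 0"
  then obtain \<delta> where "\<delta> > 0" "\<forall>z\<in>tuples N. close_to N \<delta> x z \<longrightarrow> \<bar>g z - g x\<bar> < \<bar>g x\<bar>"
    using ring_cont[OF N g x] unfolding cont_at_def by (meson zero_less_abs_iff)
  with near[of \<delta>] Z show False by fastforce
qed

text \<open>Written with addition, so that the rules for gradients apply verbatim.\<close>

definition sqdist :: "(nat \<Rightarrow> 'a) \<Rightarrow> (nat \<Rightarrow> 'a) \<Rightarrow> 'a" where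
  "sqdist a = (\<lambda>x\<in>tuples N. \<Sum>i<N. (x i + (- a i)) * (x i + (- a i)))"

lemma sqdist_nonneg: "x \<in> tuples N \<Longrightarrow> 0 \<le> sqdist a x"
  by (auto simp: sqdist_def intro: sum_nonneg)

lemma sqdist_bound:
  assumes "x \<in> tuples N" "i < N" shows "\<bar>x i\<bar> \<le> sqdist a x + 1 + norm1 N a"
proof -
  have "(x i - a i) * (x i - a i) \<le> sqdist a x"
    using member_le_sum[of i "{..<N}" "\<lambda>i. (x i - a i) * (x i - a i)"] assms by (simp add: sqdist_def)
  moreover have "\<bar>t\<bar> \<le> t * t + 1" for t :: 'a
  proof (cases "\<bar>t\<bar> \<le> 1")
    case False
    then have "\<bar>t\<bar> * 1 \<le> \<bar>t\<bar> * \<bar>t\<bar>" by (intro mult_left_mono) auto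
    then show ?thesis by (simp add: abs_mult[symmetric])
  qed (simp add: add_increasing)
  ultimately have "\<bar>x i - a i\<bar> \<le> sqdist a x + 1" by (meson add_right_mono order_trans)
  moreover have "\<bar>a i\<bar> \<le> norm1 N a" using assms(2) by (rule abs_le_norm1)
  ultimately show ?thesis by linarith
qed

text \<open>The minimum is taken over a sublevel set, which is bounded. It is a local minimum on \<open>M\<close> because all
  the equations that define the set persist on \<open>M\<close> near it.\<close>

lemma min_critical:
  assumes G: "finite G" "G \<subseteq> R N" and p: "p \<in> M" "f p = 0" "\<And>g. g \<in> G \<Longrightarrow> g p = 0"
    and a: "sqdist a \<in> R N" and "K \<noteq> {}"
  shows "\<exists>P\<in>M. f P = 0 \<and> (\<forall>g\<in>G. g P = 0) \<and> (\<forall>k\<in>K. D k (sqdist a) P = 0)"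
proof -
  let ?h = "sqdist a"
  define Z where "Z = {x \<in> M. f x = 0 \<and> (\<forall>g\<in>G. g x = 0)}"
  define Z' where "Z' = {x \<in> Z. ?h x \<le> ?h p}"
  have Z'_tup: "Z' \<subseteq> tuples N" by (auto simp: Z'_def Z_def M_def)
  have "\<exists>x\<in>Z'. \<forall>z\<in>Z'. ?h x \<le> ?h z"
  proof (rule min_attained[OF dc _ Z'_tup])
    have "def_pred S (\<lambda>x. (\<forall>k<N. k \<notin> K \<longrightarrow> F k (restrict x {..<N}) = 0) \<and> f (restrict x {..<N}) = 0 \<and>
       (\<forall>g\<in>G. g (restrict x {..<N}) = 0) \<and> ?h (restrict x {..<N}) \<le> ?h p)"
      by (intro def_pred_conj def_pred_all_less def_pred_imp def_pred_true def_pred_eq def_pred_le def_pred_ball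
            ring_def_fun N F_R f_R a def_fun_const G(1)) (use G in auto)
    then show "def_pred S (\<lambda>x. restrict x {..<N} \<in> Z')"
      by (simp add: Z'_def Z_def M_def conj_ac)
    show "Z' \<noteq> {}" using p by (auto simp: Z'_def Z_def)
    show "def_fun S (\<lambda>x. ?h (restrict x {..<N}))" by (rule ring_def_fun[OF N a])
    fix x assume x: "x \<in> Z'"
    then have tup: "x \<in> tuples N" using Z'_tup by blast
    have h: "0 \<le> ?h x" "?h x \<le> ?h p" using x sqdist_nonneg[OF tup] by (auto simp: Z'_def)
    show "\<bar>x j\<bar> \<le> ?h p + 1 + norm1 N a" if "j < N" for j
      using sqdist_bound[OF tup that, of a] h by simp
    show "\<bar>?h x\<bar> \<le> ?h p + 1 + norm1 N a" using h by (simp add: add_increasing2)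
    fix \<epsilon> :: 'a assume "\<epsilon> > 0"
    then show "\<exists>\<delta>>0. \<forall>z\<in>Z'. close_to N \<delta> x z \<longrightarrow> \<bar>?h z - ?h x\<bar> < \<epsilon>"
      using ring_cont[OF N a tup] Z'_tup unfolding cont_at_def by (meson subsetD)
  next
    fix x :: "nat \<Rightarrow> 'a" assume x: "x \<in> tuples N" "\<And>\<epsilon>. \<epsilon> > 0 \<Longrightarrow> \<exists>z\<in>Z'. close_to N \<epsilon> x z"
    have zero: "g x = 0" if "g \<in> R N" "\<And>z. z \<in> Z' \<Longrightarrow> g z = 0" for g
      using zero_set_closed[OF that(1) x(1) Z'_tup that(2) x(2)] .
    have "F k x = 0" if "k < N" "k \<notin> K" for k
      by (rule zero[OF F_R]) (use that in \<open>auto simp: Z'_def Z_def M_def\<close>)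
    moreover have "f x = 0" by (rule zero[OF f_R]) (auto simp: Z'_def Z_def)
    moreover have "g x = 0" if "g \<in> G" for g
      by (rule zero) (use that G(2) in \<open>auto simp: Z'_def Z_def\<close>)
    moreover have "?h x \<le> ?h p"
    proof (rule field_le_epsilon)
      fix e :: 'a assume "e > 0"
      then obtain \<delta> where "\<delta> > 0" "\<forall>z\<in>tuples N. close_to N \<delta> x z \<longrightarrow> \<bar>?h z - ?h x\<bar> < e"
        using ring_cont[OF N a x(1)] unfolding cont_at_def by meson
      moreover obtain z where "z \<in> Z'" "close_to N \<delta> x z" using x(2) \<open>\<delta> > 0\<close> by blast
      ultimately have "\<bar>?h z - ?h x\<bar> < e" "?h z \<le> ?h p" using Z'_tup by (auto simp: Z'_def)
      then show "?h x \<le> ?h p + e" by linarith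
    qed
    ultimately show "x \<in> Z'" using x(1) by (auto simp: Z'_def Z_def M_def)
  qed
  then obtain P where P: "P \<in> Z'" "\<And>z. z \<in> Z' \<Longrightarrow> ?h P \<le> ?h z" by blast
  then have PM: "P \<in> M" "f P = 0" "\<And>g. g \<in> G \<Longrightarrow> g P = 0" and hP: "?h P \<le> ?h p" by (auto simp: Z'_def Z_def)
  have "\<exists>\<epsilon>>0. \<forall>x\<in>M. close_to N \<epsilon> P x \<longrightarrow> (\<forall>g\<in>insert f G. g x = 0)"
    by (rule vanish_nearby) (use PM G f_R \<open>K \<noteq> {}\<close> in auto)
  then obtain \<epsilon> where \<epsilon>: "\<epsilon> > 0" "\<And>x. x \<in> M \<Longrightarrow> close_to N \<epsilon> P x \<Longrightarrow> (\<forall>g\<in>insert f G. g x = 0)"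
    by blast
  have "?h P \<le> ?h x" if "x \<in> M" "close_to N \<epsilon> P x" for x
  proof (cases "?h x \<le> ?h p")
    case True
    then have "x \<in> Z'" using \<epsilon>(2)[OF that] that(1) by (simp add: Z'_def Z_def)
    then show ?thesis by (rule P(2))
  qed (use hP in simp)
  then have "D k ?h P = 0" if "k \<in> K" for k
    using D_zero_at_local_min[OF PM(1) a that \<epsilon>(1)] by blast
  then show ?thesis using PM by blast
qed

end

context regular_chart begin

lemma sqdist_R:
  assumes "\<And>i. i < N \<Longrightarrow> a i = 0 \<or> a i = 1" shows "sqdist a \<in> R N"
proof -
  have "in_ring N (\<lambda>x. - a i)" if "i < N" for i
    using assms[OF that] in_ring_zero[OF N] in_ring_minus_one[OF N] by auto
  then have "in_ring N (\<lambda>x. \<Sum>i<N. (x i + (- a i)) * (x i + (- a i)))"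
    by (intro in_ring_sum in_ring_mult in_ring_add in_ring_coord N) auto
  then show ?thesis by (simp add: sqdist_def in_ring_def)
qed

lemma pd_sqdist:
  assumes x: "x \<in> tuples N" and i: "i < N"
  shows "pd N i (sqdist a) x = 2 * (x i - a i)"
proof -
  have "has_grad N (\<lambda>x. \<Sum>i<N. (x i + (- a i)) * (x i + (- a i))) x
      (\<lambda>j. \<Sum>i<N. ((if j = i then 1 else 0) + 0) * (x i + (- a i)) + (x i + (- a i)) * ((if j = i then 1 else 0) + 0))"
    by (intro has_grad_sum has_grad_mult has_grad_add has_grad_coord has_grad_const) auto
  then have "has_grad N (sqdist a) x
      (\<lambda>j. \<Sum>i<N. ((if j = i then 1 else 0) + 0) * (x i + (- a i)) + (x i + (- a i)) * ((if j = i then 1 else 0) + 0))"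
    by (rule has_grad_cong) (use x in \<open>auto simp: sqdist_def\<close>)
  from partial_deriv_eq[OF this x i] show ?thesis
    using i by (simp add: sum.distrib if_distrib[of "\<lambda>c. c * _"] if_distrib[of "\<lambda>c. _ * c"] cong: if_cong)
qed

text \<open>The conditions of \<open>min_critical\<close> are collected in \<open>G\<close> for the centres \<open>c 0 = 0\<close> and \<open>c (Suc j)\<close>, the unit
  vector \<open>j\<close>. The squared distances from \<open>c 0\<close> and \<open>c (Suc j)\<close> differ by \<open>2 x\<^sub>j - 1\<close>, so in the end
  \<open>D k\<close> annihilates each coordinate function.\<close>

lemma no_free_index:
  assumes p: "p \<in> M" "f p = 0"
  shows "K = {}"
proof (rule ccontr)
  assume "K \<noteq> {}"
  define c where "c j = (\<lambda>i. if Suc i = j then 1 else 0 :: 'a)" for j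
  have c_R: "sqdist (c j) \<in> R N" for j by (rule sqdist_R) (auto simp: c_def)
  have "\<exists>P\<in>M. f P = 0 \<and> (\<forall>j<m. \<forall>k\<in>K. D k (sqdist (c j)) P = 0)" for m
  proof (induction m)
    case 0
    show ?case using p by auto
  next
    case (Suc m)
    then obtain P where P: "P \<in> M" "f P = 0" "\<And>j k. j < m \<Longrightarrow> k \<in> K \<Longrightarrow> D k (sqdist (c j)) P = 0" by blast
    define G where "G = (\<lambda>(j, k). D k (sqdist (c j))) ` ({..<m} \<times> K)"
    have "\<exists>Q\<in>M. f Q = 0 \<and> (\<forall>g\<in>G. g Q = 0) \<and> (\<forall>k\<in>K. D k (sqdist (c m)) Q = 0)"
    proof (rule min_critical[OF _ _ P(1,2)])
      show "finite G" using finite_K by (simp add: G_def)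
      show "G \<subseteq> R N" using D_R c_R by (auto simp: G_def)
    qed (use P(3) c_R \<open>K \<noteq> {}\<close> in \<open>auto simp: G_def\<close>)
    then obtain Q where Q: "Q \<in> M" "f Q = 0" "\<forall>g\<in>G. g Q = 0" "\<forall>k\<in>K. D k (sqdist (c m)) Q = 0" by blast
    have "D k (sqdist (c j)) Q = 0" if "j < Suc m" "k \<in> K" for j k
      using that Q(3,4) by (cases "j = m") (auto simp: G_def)
    then show ?case using Q by blast
  qed
  then obtain P where P: "P \<in> M" "\<And>j k. j < Suc N \<Longrightarrow> k \<in> K \<Longrightarrow> D k (sqdist (c j)) P = 0" by blast
  have tup: "P \<in> tuples N" using P by (simp add: M_def)
  obtain k where k: "k \<in> K" "k < N" using \<open>K \<noteq> {}\<close> K by auto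
  have Dsq: "D k (sqdist a) P = (\<Sum>i<N. 2 * (P i - a i) * W i k P)" for a
    using tup by (simp add: D_def pd_sqdist)
  have "W j k P = 0" if j: "j < N" for j
  proof -
    have "(\<Sum>i<N. 2 * (P i - c 0 i) * W i k P) - (\<Sum>i<N. 2 * (P i - c (Suc j) i) * W i k P) = 0"
      using P(2)[of 0 k] P(2)[of "Suc j" k] j k by (simp add: Dsq)
    moreover have "(\<Sum>i<N. 2 * (P i - c 0 i) * W i k P) - (\<Sum>i<N. 2 * (P i - c (Suc j) i) * W i k P) = 
      (\<Sum>i<N. (if i = j then 2 * W j k P else 0))"
      unfolding sum_subtractf[symmetric] by (intro sum.cong) (auto simp: c_def algebra_simps)
    ultimately show ?thesis using j by simp
  qed
  then have "(\<Sum>i<N. pd N i (F k) P * W i k P) = 0" by simp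
  moreover have "is_inverse N (\<lambda>k i. pd N i (F k) P) (\<lambda>i k. W i k P)"
    using P by (intro regular) (auto simp: M_def)
  ultimately show False using k by (auto simp: is_inverse_def)
qed

end

context tame_ring_setting begin

text \<open>A point above \<open>V(f)\<close> that is a nonsingular zero of the functions \<open>F k\<close> with \<open>k \<notin> K\<close>. The
  others only complete the gradients to a basis, which makes linear independence a statement about
  square matrices.\<close>

definition chart :: "nat \<Rightarrow> ((nat \<Rightarrow> 'a) \<Rightarrow> 'a) \<Rightarrow> nat \<Rightarrow> (nat \<Rightarrow> (nat \<Rightarrow> 'a) \<Rightarrow> 'a) \<Rightarrow> nat set \<Rightarrow> (nat \<Rightarrow> 'a) \<Rightarrow> bool" where
  "chart n f N F K p \<longleftrightarrow> n \<le> N \<and> (\<forall>k<N. F k \<in> R N) \<and> K \<subseteq> {..<N} \<and> p \<in> tuples N \<and>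
     (\<forall>k<N. k \<notin> K \<longrightarrow> F k p = 0) \<and> more_vars n N f p = 0 \<and>
     (\<exists>B. is_inverse N (\<lambda>k i. pd N i (F k) p) B)"

lemma chart_coordinates:
  assumes "n \<ge> 1" "f \<in> R n" "p \<in> V n [f]"
  shows "chart n f n (\<lambda>k. \<lambda>x\<in>tuples n. x k) {..<n} p"
proof -
  have p: "p \<in> tuples n" "f p = 0" using assms(3) by (auto simp: V_def)
  have pd: "pd n i (\<lambda>x\<in>tuples n. x k) p = (if k = i then 1 else 0)" if "i < n" "k < n" for i k
  proof -
    have "has_grad n (\<lambda>x\<in>tuples n. x k) p (\<lambda>j. if j = k then 1 else 0)"
      by (rule has_grad_cong[OF has_grad_coord[OF that(2)] p(1)]) auto
    from partial_deriv_eq[OF this p(1) that(1)] show ?thesis by auto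
  qed
  have "is_inverse n (\<lambda>k i. pd n i (\<lambda>x\<in>tuples n. x k) p) (\<lambda>i k. if i = k then 1 else 0)"
    by (auto simp: is_inverse_def pd if_distrib[of "\<lambda>c. c * _"] cong: if_cong)
  moreover have "(\<lambda>x\<in>tuples n. x k) \<in> R n" if "k < n" for k
    using in_ring_coord[OF that] by (simp add: in_ring_def)
  ultimately show ?thesis
    using p by (auto simp: chart_def more_vars_def)
qed

lemma chart_exchange:
  assumes c: "chart n f N F K p" and g: "g \<in> R N" "g p = 0" and k: "k \<in> K"
    and B: "is_inverse N (\<lambda>k i. pd N i (F k) p) B" and nz: "(\<Sum>i<N. pd N i g p * B i k) \<noteq> 0"
  shows "chart n f N (F(k := g)) (K - {k}) p"
proof -
  have "k < N" using c k by (auto simp: chart_def)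
  from inverse_replace_row[OF B this nz]
  obtain B' where "is_inverse N ((\<lambda>k i. pd N i (F k) p)(k := (\<lambda>i. pd N i g p))) B'" by blast
  moreover have "(\<lambda>k i. pd N i (F k) p)(k := (\<lambda>i. pd N i g p)) = (\<lambda>l i. pd N i ((F(k := g)) l) p)"
    by (auto simp: fun_eq_iff)
  ultimately show ?thesis using c g by (auto simp: chart_def)
qed

text \<open>The extended system of \<open>regularise\<close> has the same number of free indices, so minimality applies to
  it at every point where it is a chart.\<close>

lemma full_chart_exists:
  assumes n: "n \<ge> 1" and f: "f \<in> R n" and ne: "V n [f] \<noteq> {}"
  shows "\<exists>N F p. chart n f N F {} p"
proof -
  define Q where "Q r \<longleftrightarrow> (\<exists>N F K p. chart n f N F K p \<and> card K = r)" for r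
  have "Q n"
    unfolding Q_def using chart_coordinates[OF n f] ne by (metis card_lessThan ex_in_conv)
  define r where "r = (LEAST r. Q r)"
  have "Q r" unfolding r_def by (rule LeastI[where P = Q and k = n, OF \<open>Q n\<close>])
  then obtain N F K p where c: "chart n f N F K p" and r: "card K = r" unfolding Q_def by blast
  have N: "n \<le> N" "N \<ge> 1" and K: "K \<subseteq> {..<N}" and F: "\<And>k. k < N \<Longrightarrow> F k \<in> R N" and p: "p \<in> tuples N"
    and zero: "\<And>k. k < N \<Longrightarrow> k \<notin> K \<Longrightarrow> F k p = 0" and fp: "more_vars n N f p = 0"
    using c n by (auto simp: chart_def)
  have "finite K" using K finite_subset by blast
  obtain B where B: "is_inverse N (\<lambda>k i. pd N i (F k) p) B" using c by (auto simp: chart_def)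
  obtain F' W q where F': "\<And>k. k < Suc N \<Longrightarrow> F' k \<in> R (Suc N)" "\<And>k. k < N \<Longrightarrow> F' k = more_vars N (Suc N) (F k)"
    and W: "\<And>i k. i < Suc N \<Longrightarrow> k < Suc N \<Longrightarrow> W i k \<in> R (Suc N)"
    and q: "q \<in> tuples (Suc N)" "restrict q {..<N} = p" "F' N q = 0"
    and inv: "\<And>x. x \<in> tuples (Suc N) \<Longrightarrow> F' N x = 0 \<Longrightarrow> is_inverse (Suc N) (\<lambda>k i. pd (Suc N) i (F' k) x) (\<lambda>i k. W i k x)"
    using regularise[OF N(2) F p B] by blast
  let ?f = "more_vars n (Suc N) f"
  have "N \<notin> K" using K by auto
  interpret C: regular_chart S S0 R "Suc N" F' W K ?f
  proof
    show "K \<subseteq> {..<Suc N}" using K by auto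
    show "?f \<in> R (Suc N)" using n N f by (intro more_vars_in_R) auto
    fix x assume x: "x \<in> tuples (Suc N)" "\<And>k. k < Suc N \<Longrightarrow> k \<notin> K \<Longrightarrow> F' k x = 0"
    have inv_x: "is_inverse (Suc N) (\<lambda>k i. pd (Suc N) i (F' k) x) (\<lambda>i k. W i k x)"
      using x \<open>N \<notin> K\<close> by (intro inv) auto
    then show "is_inverse (Suc N) (\<lambda>k i. pd (Suc N) i (F' k) x) (\<lambda>i k. W i k x)" .
    fix g k assume fx: "?f x = 0" and g: "g \<in> R (Suc N)" "g x = 0" and k: "k \<in> K"
    have cx: "chart n f (Suc N) F' K x"
      unfolding chart_def using N K F'(1) x fx inv_x by auto
    show "(\<Sum>i<Suc N. pd (Suc N) i g x * W i k x) = 0"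
    proof (rule ccontr)
      assume "(\<Sum>i<Suc N. pd (Suc N) i g x * W i k x) \<noteq> 0"
      from chart_exchange[OF cx g k inv_x this] have "Q (card (K - {k}))"
        unfolding Q_def by blast
      then have "r \<le> card (K - {k})" unfolding r_def by (rule Least_le)
      then show False using r k \<open>finite K\<close> card_Diff1_less[of K k] by simp
    qed
  qed (use N F' W in auto)
  have "q \<in> C.M"
    unfolding C.M_def using q zero by (auto simp: F'(2) more_vars_def less_Suc_eq)
  moreover have "?f q = 0"
    unfolding more_vars_Suc[OF N(1)] using q fp by (simp add: more_vars_def[of N "Suc N"])
  ultimately have "K = {}" by (rule C.no_free_index)
  then show ?thesis using c by blast
qed

end

theorem theorem1p4:
  fixes S S0 :: "('f, 'r, 'a :: {real_closed_field, linorder_topology}) expansion"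
    and R :: "nat \<Rightarrow> ((nat \<Rightarrow> 'a) \<Rightarrow> 'a) set"
    and f :: "(nat \<Rightarrow> 'a) \<Rightarrow> 'a" and n :: nat
  assumes "is_reduct S0 S"
    and "o_minimal S0"
    and "polynomially_bounded S0"
    and "tame_rings S S0 R"
    and "definably_complete S"
    and "n \<ge> 1"
    and "f \<in> R n"
    and "V n [f] \<noteq> {}"
  shows "\<exists>m fs. length fs = n + m \<and> set fs \<subseteq> R (n + m) \<and>
           V_reg (n + m) fs \<inter> V (n + m) [more_vars n (n + m) f] \<noteq> {}"
proof -
  interpret tame_ring_setting S S0 R
    using assms(3-5) by unfold_locales
  obtain N F p where c: "chart n f N F {} p"
    using full_chart_exists assms(6-8) by blast
  then have "n \<le> N" and F: "\<And>k. k < N \<Longrightarrow> F k \<in> R N" "\<And>k. k < N \<Longrightarrow> F k p = 0"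
    and p: "p \<in> tuples N" "more_vars n N f p = 0" by (auto simp: chart_def)
  obtain B where B: "is_inverse N (\<lambda>k i. pd N i (F k) p) B" using c by (auto simp: chart_def)
  let ?fs = "map F [0..<N]"
  \<comment> \<open>The gradients are the rows of an invertible matrix.\<close>
  have "lin_indep N (map (\<lambda>f. grad N f p) ?fs)"
    unfolding lin_indep_def
  proof (intro allI impI)
    fix c :: "nat \<Rightarrow> 'a" and j
    assume dep: "\<forall>i<N. (\<Sum>j<length (map (\<lambda>f. grad N f p) ?fs). c j * (map (\<lambda>f. grad N f p) ?fs ! j) i) = 0"
      and "j < length (map (\<lambda>f. grad N f p) ?fs)"
    then have j: "j < N" and dep': "\<And>i. i < N \<Longrightarrow> (\<Sum>k<N. c k * pd N i (F k) p) = 0"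
      by (auto simp: grad_def)
    have "c j = (\<Sum>k<N. c k * (if k = j then 1 else 0))"
      using j by (simp add: if_distrib[of "\<lambda>t. _ * t"] cong: if_cong)
    also have "\<dots> = (\<Sum>k<N. c k * (\<Sum>i<N. pd N i (F k) p * B i j))"
      using B j by (intro sum.cong) (auto simp: is_inverse_def)
    also have "\<dots> = (\<Sum>i<N. (\<Sum>k<N. c k * pd N i (F k) p) * B i j)"
      unfolding sum_distrib_left sum_distrib_right by (subst sum.swap) (simp add: mult.assoc)
    also have "\<dots> = 0" using dep' by simp
    finally show "c j = 0" .
  qed
  then have "p \<in> V_reg N ?fs" using F p by (auto simp: V_reg_def V_def)
  moreover have "p \<in> V N [more_vars n N f]" using p by (simp add: V_def)
  moreover have "N = n + (N - n)" using \<open>n \<le> N\<close> by simp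
  ultimately show ?thesis
    using F by (intro exI[of _ "N - n"] exI[of _ ?fs]) auto
qed

end
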